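(* Let $\Phi$ be a finite crystallographic root system or a rank $3$ untwisted affine root system, with positive roots $\Phi^+$. Let $I$ be an order ideal in the root poset on $\Phi^+$. Then $I$ is clean, i.e. every subset $B\subseteq I$ which is biclosed in $I$ is weakly separable in $I$.
   Context: Root systems are (symmetrizable, crystallographic, real, reduced) root systems $\Phi$ in a real vector space $V$ with symmetric bilinear form $(-,-)$: for all $\alpha\in\Phi$, $(\alpha,\alpha)>0$ and $t_\alpha\Phi=\Phi$ where $t_\alpha(\beta)=\beta-2\frac{(\alpha,\beta)}{(\alpha,\alpha)}\alpha$; $\mathbb{R}\alpha\cap\Phi=\{\pm\alpha\}$; and there is a base $\Pi$ with every root in exactly one of $\pm\mathrm{Span}_+(\Pi)$, no element of $\Pi$ in the nonnegative span of the others, and $\Phi\subseteq\mathrm{Span}_\mathbb{Z}\Pi$. $\Phi^+=\Phi\cap\mathrm{Span}_+\Pi$; the rank is $|\Pi|$. The untwisted affine root systems are affinizations $\widetilde\Phi=\{\alpha+k\delta:\alpha\in\Phi_0,k\in\mathbb{Z}\}\subseteq V_0\oplus\mathbb{R}\delta$ of finite irreducible root systems $\Phi_0\subseteq V_0$, with $(\delta,\cdot)=0$ and base $\Pi_0\cup\{\delta-\theta\}$ where $\theta$ is the highest root (imaginary roots $k\delta$ are not roots). The root poset on $\Phi^+$: $\alpha\le\beta$ iff $\beta-\alpha\in\mathrm{Span}_+\Pi$; an order ideal $I$ is a subset closed under going down. For $X\subseteq V$ and $B\subseteq X$: $B$ is closed in $X$ if $\alpha,\beta\in B$ and $\gamma\in\mathrm{Span}_+(\alpha,\beta)\cap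 X$ imply $\gamma\in B$; coclosed if $X\setminus B$ is closed; biclosed if both; weakly separable in $X$ if $\mathrm{Span}_+(B)\cap\mathrm{Span}_+(X\setminus B)=\{0\}$. *)

theory Defs
  imports "HOL-Analysis.Analysis"
begin

text \<open>Nonnegative (real) span of a set: all finite nonnegative linear combinations.
  The empty combination gives 0, so the nonnegative span of the empty set is {0}.\<close>
definition pos_span :: "'a::real_vector set \<Rightarrow> 'a set" where
  "pos_span S = {v. \<exists>T c. finite T \<and> T \<subseteq> S \<and> (\<forall>x\<in>T. c x \<ge> 0) \<and> v = (\<Sum>x\<in>T. c x *\<^sub>R x)}"

definition int_span :: "'a::real_vector set \<Rightarrow> 'a set" where
  "int_span S = {v. \<exists>T c. finite T \<and> T \<subseteq> S \<and> (\<forall>x\<in>T. c x \<in> \<int>) \<and> v = (\<Sum>x\<in>T. c x *\<^sub>R x)}"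

definition rs_refl :: "('a::real_vector \<Rightarrow> 'a \<Rightarrow> real) \<Rightarrow> 'a \<Rightarrow> 'a \<Rightarrow> 'a" where
  "rs_refl B \<alpha> \<beta> = \<beta> - (2 * B \<alpha> \<beta> / B \<alpha> \<alpha>) *\<^sub>R \<alpha>"

definition is_base :: "'a::real_vector set \<Rightarrow> 'a set \<Rightarrow> bool" where
  "is_base \<Phi> \<Delta> \<longleftrightarrow>
     \<Delta> \<subseteq> \<Phi> \<and>
     (\<forall>\<alpha>\<in>\<Phi>. (\<alpha> \<in> pos_span \<Delta>) \<noteq> (\<alpha> \<in> uminus ` pos_span \<Delta>)) \<and>
     (\<forall>\<pi>\<in>\<Delta>. \<pi> \<notin> pos_span (\<Delta> - {\<pi>})) \<and>
     \<Phi> \<subseteq> int_span \<Delta>"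

text \<open>(Symmetrizable, crystallographic, real, reduced) root system Phi with base Pi
  in the real vector space 'a with symmetric bilinear form B.\<close>
definition root_system :: "('a::real_vector \<Rightarrow> 'a \<Rightarrow> real) \<Rightarrow> 'a set \<Rightarrow> 'a set \<Rightarrow> bool" where
  "root_system B \<Phi> \<Delta> \<longleftrightarrow>
     bilinear B \<and> (\<forall>x y. B x y = B y x) \<and>
     (\<forall>\<alpha>\<in>\<Phi>. B \<alpha> \<alpha> > 0 \<and> rs_refl B \<alpha> ` \<Phi> = \<Phi>) \<and>
     (\<forall>\<alpha>\<in>\<Phi>. {c *\<^sub>R \<alpha> | c. True} \<inter> \<Phi> = {\<alpha>, -\<alpha>}) \<and>
     is_base \<Phi> \<Delta>"

definition finite_root_system :: "('a::real_vector \<Rightarrow> 'a \<Rightarrow> real) \<Rightarrow> 'a set \<Rightarrow> 'a set \<Rightarrow> bool" where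
  "finite_root_system B \<Phi> \<Delta> \<longleftrightarrow> root_system B \<Phi> \<Delta> \<and> finite \<Phi>"

definition pos_roots :: "'a::real_vector set \<Rightarrow> 'a set \<Rightarrow> 'a set" where
  "pos_roots \<Phi> \<Delta> = \<Phi> \<inter> pos_span \<Delta>"

definition irreducible_rs :: "('a::real_vector \<Rightarrow> 'a \<Rightarrow> real) \<Rightarrow> 'a set \<Rightarrow> bool" where
  "irreducible_rs B \<Phi> \<longleftrightarrow> \<Phi> \<noteq> {} \<and>
     \<not> (\<exists>\<Phi>1 \<Phi>2. \<Phi>1 \<noteq> {} \<and> \<Phi>2 \<noteq> {} \<and> \<Phi>1 \<union> \<Phi>2 = \<Phi> \<and> \<Phi>1 \<inter> \<Phi>2 = {} \<and>
                 (\<forall>a\<in>\<Phi>1. \<forall>b\<in>\<Phi>2. B a b = 0))"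

definition highest_root :: "'a::real_vector set \<Rightarrow> 'a set \<Rightarrow> 'a \<Rightarrow> bool" where
  "highest_root \<Phi> \<Delta> \<theta> \<longleftrightarrow> \<theta> \<in> pos_roots \<Phi> \<Delta> \<and> (\<forall>\<alpha>\<in>pos_roots \<Phi> \<Delta>. \<theta> - \<alpha> \<in> pos_span \<Delta>)"

text \<open>(Phi, Pi) is the untwisted affinization of a finite irreducible root system (Phi0, Pi0)
  of rank 2 (so the affine system has rank 3), realised inside the ambient space as
  V0 (+) R delta with delta outside the span of Phi0 and (delta, -) = 0.\<close>
definition rank3_untwisted_affine :: "('a::real_vector \<Rightarrow> 'a \<Rightarrow> real) \<Rightarrow> 'a set \<Rightarrow> 'a set \<Rightarrow> bool" where
  "rank3_untwisted_affine B \<Phi> \<Delta> \<longleftrightarrow>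
     (\<exists>\<Phi>0 \<Delta>0 \<delta> \<theta>. finite_root_system B \<Phi>0 \<Delta>0 \<and> irreducible_rs B \<Phi>0 \<and> card \<Delta>0 = 2 \<and>
        \<delta> \<notin> span \<Phi>0 \<and> (\<forall>x. B \<delta> x = 0) \<and>
        highest_root \<Phi>0 \<Delta>0 \<theta> \<and>
        \<Phi> = {\<alpha> + of_int k *\<^sub>R \<delta> | \<alpha> k. \<alpha> \<in> \<Phi>0} \<and>
        \<Delta> = \<Delta>0 \<union> {\<delta> - \<theta>})"

definition order_ideal :: "'a::real_vector set \<Rightarrow> 'a set \<Rightarrow> 'a set \<Rightarrow> bool" where
  "order_ideal \<Phi> \<Delta> I \<longleftrightarrow> I \<subseteq> pos_roots \<Phi> \<Delta> \<and>
     (\<forall>\<beta>\<in>I. \<forall>\<alpha>\<in>pos_roots \<Phi> \<Delta>. \<beta> - \<alpha> \<in> pos_span \<Delta> \<longrightarrow> \<alpha> \<in> I)"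

definition rs_closed :: "'a::real_vector set \<Rightarrow> 'a set \<Rightarrow> bool" where
  "rs_closed X B \<longleftrightarrow> (\<forall>\<alpha>\<in>B. \<forall>\<beta>\<in>B. \<forall>\<gamma>\<in>pos_span {\<alpha>, \<beta>} \<inter> X. \<gamma> \<in> B)"

definition rs_coclosed :: "'a::real_vector set \<Rightarrow> 'a set \<Rightarrow> bool" where
  "rs_coclosed X B \<longleftrightarrow> rs_closed X (X - B)"

definition rs_biclosed :: "'a::real_vector set \<Rightarrow> 'a set \<Rightarrow> bool" where
  "rs_biclosed X B \<longleftrightarrow> rs_closed X B \<and> rs_coclosed X B"

definition weakly_separable :: "'a::real_vector set \<Rightarrow> 'a set \<Rightarrow> bool" where
  "weakly_separable X B \<longleftrightarrow> pos_span B \<inter> pos_span (X - B) = {0}"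

definition clean :: "'a::real_vector set \<Rightarrow> bool" where
  "clean X \<longleftrightarrow> (\<forall>B\<subseteq>X. rs_biclosed X B \<longrightarrow> weakly_separable X B)"

end

theory Submission
  imports Defs "HOL-Library.Multiset"
begin

text \<open>If the two cones share a nonzero vector, Dirichlet approximation of the coefficients gives an
  equality between sums of two nonempty multisets of roots, \<open>M\<close> in \<open>S\<close> and \<open>N\<close> in \<open>I - S\<close>.  Whenever
  \<open>p \<in> M\<close> and \<open>q \<in> N\<close> have positive inner product and \<open>p - q\<close> is a root, this root lies in \<open>S\<close>, or its
  negative in \<open>I - S\<close>, because \<open>I\<close> is an ideal and \<open>S\<close> is biclosed; cancelling the smaller of \<open>p\<close> and \<open>q\<close>
  yields a shorter relation.  In finite type the descent ends in a relation in which all inner products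
  are nonpositive, and this is impossible.

  In the affine case the descent is blocked when \<open>p - q\<close> is a multiple of \<open>\<delta>\<close>.  The main point is that
  \<open>S\<close> and \<open>I - S\<close> cannot both contain two roots whose sum is a multiple of \<open>\<delta>\<close>; this is where rank 3 is
  used.  Hence the multiples of \<open>\<delta>\<close> can be added to one side, and the descent ends in a relation
  expressing a multiple of \<open>\<delta>\<close> by the other side alone.  A relation of this kind reduces to roots
  below \<open>\<delta>\<close>.  As these lie in pairwise different directions modulo \<open>\<delta>\<close>, the descent is not blocked
  among them, and it ends in a configuration that the main point excludes.\<close>

section \<open>Nonnegative and integral combinations\<close>

text \<open>Rank 3 enters twice. Modulo \<delta> the roots form an irreducible system of rank 2, so
  two roots that are neither equal nor opposite modulo \<delta> have a root as sum or difference, or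
  are themselves, modulo \<delta>, the sum and the difference of two further roots; the main point
  is checked on these configurations, level by level along the lines in direction \<delta>. At the
  end of the last descent every root on one side is orthogonal to every root on the other, and in a
  plane this confines each side to one line and its opposite. A constant obstacle is that
  \<open>I\<close> is only an ideal: a root may be used only once it is known to lie below a given
  root of \<open>I\<close>, and this is what makes the case distinctions on levels necessary. In
  finite type, linear independence of the base and integrality of the Cartan numbers are not part of
  the definitions and have to be derived before roots can be subtracted.\<close>

lemma coefficient_sum_add:
  fixes c d :: "'a::real_vector \<Rightarrow> real"
  assumes "finite S" "finite T"
  shows "(\<Sum>x\<in>S. c x *\<^sub>R x) + (\<Sum>x\<in>T. d x *\<^sub>R x) =
    (\<Sum>x\<in>S \<union> T. ((if x \<in> S then c x else 0) + (if x \<in> T then d x else 0)) *\<^sub>R x)"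
proof -
  have "(\<Sum>x\<in>S. c x *\<^sub>R x) = (\<Sum>x\<in>S \<union> T. (if x \<in> S then c x else 0) *\<^sub>R x)"
    by (rule sum.mono_neutral_cong_left) (use assms in auto)
  moreover have "(\<Sum>x\<in>T. d x *\<^sub>R x) = (\<Sum>x\<in>S \<union> T. (if x \<in> T then d x else 0) *\<^sub>R x)"
    by (rule sum.mono_neutral_cong_left) (use assms in auto)
  ultimately show ?thesis by (simp add: scaleR_left_distrib sum.distrib)
qed

lemma pos_span_add:
  assumes "x \<in> pos_span S" "y \<in> pos_span S" shows "x + y \<in> pos_span S"
proof -
  obtain T1 c1 where 1: "finite T1" "T1 \<subseteq> S" "\<forall>x\<in>T1. c1 x \<ge> 0" "x = (\<Sum>x\<in>T1. c1 x *\<^sub>R x)"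
    using assms(1) unfolding pos_span_def by blast
  obtain T2 c2 where 2: "finite T2" "T2 \<subseteq> S" "\<forall>x\<in>T2. c2 x \<ge> 0" "y = (\<Sum>x\<in>T2. c2 x *\<^sub>R x)"
    using assms(2) unfolding pos_span_def by blast
  show ?thesis unfolding pos_span_def
    using 1 2 coefficient_sum_add[OF 1(1) 2(1), of c1 c2]
    by (intro CollectI exI[of _ "T1 \<union> T2"] exI conjI) (assumption | auto)+
qed

lemma pos_span_scale:
  assumes "x \<in> pos_span S" "0 \<le> a" shows "a *\<^sub>R x \<in> pos_span S"
proof -
  obtain T c where "finite T" "T \<subseteq> S" "\<forall>x\<in>T. c x \<ge> 0" "x = (\<Sum>x\<in>T. c x *\<^sub>R x)"
    using assms(1) unfolding pos_span_def by blast
  then show ?thesis unfolding pos_span_def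
    using assms(2) by (intro CollectI exI[of _ T] exI[of _ "\<lambda>x. a * c x"]) (simp add: scaleR_right.sum)
qed

lemma pos_span_0: "0 \<in> pos_span S"
  unfolding pos_span_def by (auto intro!: exI[of _ "{}"])

lemma pos_span_base: "x \<in> S \<Longrightarrow> x \<in> pos_span S"
  unfolding pos_span_def by (auto intro!: exI[of _ "{x}"] exI[of _ "\<lambda>_. 1"])

lemma pos_span_mono: "S \<subseteq> T \<Longrightarrow> pos_span S \<subseteq> pos_span T"
  unfolding pos_span_def by blast

lemma pos_span_subset_span: "pos_span S \<subseteq> span S"
  unfolding pos_span_def by (auto intro!: span_sum span_scale intro: span_base)

lemma pos_span_cancel: "a *\<^sub>R x \<in> pos_span S \<Longrightarrow> 0 < a \<Longrightarrow> x \<in> pos_span S"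
  using pos_span_scale[of "a *\<^sub>R x" S "1 / a"] by simp

lemma pos_span_pair:
  assumes "0 \<le> a" "0 \<le> b" shows "a *\<^sub>R s + b *\<^sub>R t \<in> pos_span {s, t}"
  using assms by (intro pos_span_add pos_span_scale pos_span_base) auto

lemma pos_span_split:
  assumes "x \<in> pos_span S"
  shows "\<exists>d\<ge>0. \<exists>r\<in>pos_span (S - {a}). x = d *\<^sub>R a + r"
proof -
  obtain T c where T: "finite T" "T \<subseteq> S" "\<forall>x\<in>T. c x \<ge> 0" "x = (\<Sum>x\<in>T. c x *\<^sub>R x)"
    using assms(1) unfolding pos_span_def by blast
  have r: "(\<Sum>x\<in>T - {a}. c x *\<^sub>R x) \<in> pos_span (S - {a})"
    unfolding pos_span_def using T by (intro CollectI exI[of _ "T - {a}"] exI[of _ c]) auto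
  show ?thesis
  proof (cases "a \<in> T")
    case True
    then have "x = c a *\<^sub>R a + (\<Sum>x\<in>T - {a}. c x *\<^sub>R x)" using T by (simp add: sum.remove)
    then show ?thesis using r T True by blast
  next
    case False
    then have "x = 0 *\<^sub>R a + (\<Sum>x\<in>T - {a}. c x *\<^sub>R x)" using T by simp
    then show ?thesis using r by blast
  qed
qed

lemma int_span_add:
  assumes "x \<in> int_span S" "y \<in> int_span S" shows "x + y \<in> int_span S"
proof -
  obtain T1 c1 where 1: "finite T1" "T1 \<subseteq> S" "\<forall>x\<in>T1. c1 x \<in> \<int>" "x = (\<Sum>x\<in>T1. c1 x *\<^sub>R x)"
    using assms(1) unfolding int_span_def by blast
  obtain T2 c2 where 2: "finite T2" "T2 \<subseteq> S" "\<forall>x\<in>T2. c2 x \<in> \<int>" "y = (\<Sum>x\<in>T2. c2 x *\<^sub>R x)"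
    using assms(2) unfolding int_span_def by blast
  show ?thesis unfolding int_span_def
    using 1 2 coefficient_sum_add[OF 1(1) 2(1), of c1 c2]
    by (intro CollectI exI[of _ "T1 \<union> T2"] exI conjI) (assumption | auto)+
qed

lemma int_span_multiple: "x \<in> S \<Longrightarrow> of_int k *\<^sub>R x \<in> int_span S"
  unfolding int_span_def by (auto intro!: exI[of _ "{x}"] exI[of _ "\<lambda>_. of_int k"])

lemma int_span_mono: "S \<subseteq> T \<Longrightarrow> int_span S \<subseteq> int_span T"
  unfolding int_span_def by blast

section \<open>Coordinates and integral approximation of linear relations\<close>

lemma coordinates_exist:
  fixes E :: "'a::real_vector set"
  assumes "independent E"
  obtains \<xi> :: "'a \<Rightarrow> 'a \<Rightarrow> real" where "\<And>e. linear (\<xi> e)" "\<And>e e'. e' \<in> E \<Longrightarrow> \<xi> e e' = (if e' = e then 1 else 0)"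
proof -
  have "\<exists>g. linear g \<and> (\<forall>x\<in>E. g x = (if x = e then 1 else (0::real)))" for e
    using linear_independent_extend[OF assms] .
  then show ?thesis using that by metis
qed

lemma coordinate_sum:
  fixes \<xi> :: "'a::real_vector \<Rightarrow> 'a \<Rightarrow> real"
  assumes lin: "linear (\<xi> e)" and \<xi>: "\<And>e'. e' \<in> E \<Longrightarrow> \<xi> e e' = (if e' = e then 1 else 0)"
    and T: "finite T" "T \<subseteq> E"
  shows "\<xi> e (\<Sum>x\<in>T. c x *\<^sub>R x) = (if e \<in> T then c e else 0)"
proof -
  have "\<xi> e (\<Sum>x\<in>T. c x *\<^sub>R x) = (\<Sum>x\<in>T. c x * \<xi> e x)"
    by (simp add: linear_sum[OF lin] linear_scale[OF lin])
  also have "\<dots> = (\<Sum>x\<in>T. if x = e then c e else 0)"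
    by (rule sum.cong) (use \<xi> T in auto)
  finally show ?thesis using T by simp
qed

lemma int_small_zero: "x \<in> \<int> \<Longrightarrow> \<bar>x\<bar> < 1 \<Longrightarrow> x = (0::real)"
  by (auto elim!: Ints_cases)

text \<open>Dirichlet approximation of the coefficients: the perturbed relation has integer
  coordinates of absolute value less than 1.\<close>
lemma integral_relation:
  fixes E T :: "'a::real_vector set" and c :: "'a \<Rightarrow> real"
  assumes E: "independent E" and T: "finite T" "T \<subseteq> int_span E"
    and c: "(\<Sum>t\<in>T. c t *\<^sub>R t) = 0" and eps: "0 < \<epsilon>"
  obtains q :: int and p :: "'a \<Rightarrow> int" where "0 < q" "\<And>t. t \<in> T \<Longrightarrow> \<bar>of_int q * c t - of_int (p t)\<bar> < \<epsilon>"
    "(\<Sum>t\<in>T. of_int (p t) *\<^sub>R t) = 0"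
proof -
  obtain \<xi> where lin: "\<And>e. linear (\<xi> e)" and \<xi>: "\<And>e e'. e' \<in> E \<Longrightarrow> \<xi> e e' = (if e' = e then 1 else (0::real))"
    using coordinates_exist[OF E] by blast
  have "\<forall>t\<in>T. \<exists>S d. finite S \<and> S \<subseteq> E \<and> (\<forall>x\<in>S. d x \<in> \<int>) \<and> t = (\<Sum>x\<in>S. d x *\<^sub>R x)"
    using T(2) unfolding int_span_def by blast
  then obtain S d where S: "\<And>t. t \<in> T \<Longrightarrow> finite (S t)" "\<And>t. t \<in> T \<Longrightarrow> S t \<subseteq> E"
    "\<And>t x. t \<in> T \<Longrightarrow> x \<in> S t \<Longrightarrow> d t x \<in> \<int>" "\<And>t. t \<in> T \<Longrightarrow> t = (\<Sum>x\<in>S t. d t x *\<^sub>R x)"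
    by metis
  have int: "\<xi> e t \<in> \<int>" if "t \<in> T" for e t
    using coordinate_sum[of \<xi> e E, OF lin \<xi> S(1,2)[OF that], of "d t"] S(3,4)[OF that] by simp
  define E0 where "E0 = (\<Union>t\<in>T. S t)"
  have E0: "finite E0" "E0 \<subseteq> E" using S T by (auto simp: E0_def)
  have TE0: "T \<subseteq> span E0"
  proof
    fix t assume t: "t \<in> T"
    have "(\<Sum>x\<in>S t. d t x *\<^sub>R x) \<in> span E0"
      by (intro span_sum span_scale span_base) (use t in \<open>auto simp: E0_def\<close>)
    then show "t \<in> span E0" using S(4)[OF t] by simp
  qed
  \<comment> \<open>\<open>m\<close> dominates the coordinates of all of \<open>T\<close>: with
    rounding errors below \<open>1 / N\<close> and \<open>N > m\<close>, every coordinate of the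
    rounded relation is below 1 in absolute value. The summand 1 makes \<open>N\<close>
    positive.\<close>
  define m where "m = 1 + (\<Sum>t\<in>T. \<Sum>e\<in>E0. \<bar>\<xi> e t\<bar>)"
  have m: "1 \<le> m" by (auto simp: m_def intro!: sum_nonneg)
  obtain N :: nat where N: "max m (1 / \<epsilon>) < real N" using reals_Archimedean2 by blast
  then have N0: "0 < N" using m by (cases N) auto
  have Nm: "m / N < 1" using N N0 by (simp add: field_simps)
  have Ne: "1 / N < \<epsilon>" using N N0 eps by (simp add: field_simps)
  obtain h where h: "bij_betw h {0..<card T} T" using ex_bij_betw_nat_finite[OF T(1)] by blast
  obtain q p where qp: "0 < q" "\<And>i. i < card T \<Longrightarrow> \<bar>of_int q * c (h i) - of_int (p i)\<bar> < 1 / N"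
    using Dirichlet_approx_simult[OF N0, of "card T" "\<lambda>i. c (h i)"] by blast
  define p' where "p' = (\<lambda>t. p (inv_into {0..<card T} h t))"
  have p': "\<bar>of_int q * c t - of_int (p' t)\<bar> < 1 / N" if "t \<in> T" for t
  proof -
    have "h (inv_into {0..<card T} h t) = t" "inv_into {0..<card T} h t \<in> {0..<card T}"
      using h f_inv_into_f[of t h] inv_into_into[of t h] that by (auto simp: bij_betw_def simp del: atLeastLessThan_iff)
    then show ?thesis using qp(2)[of "inv_into {0..<card T} h t"] by (simp add: p'_def)
  qed
  define u where "u = (\<Sum>t\<in>T. of_int (p' t) *\<^sub>R t)"
  have uspan: "u \<in> span E0" unfolding u_def by (intro span_sum span_scale) (use TE0 in auto)
  \<comment> \<open>Subtracting \<open>of_int q\<close> times the given relation leaves only the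
    rounding errors as coefficients.\<close>
  have u: "u = (\<Sum>t\<in>T. (of_int (p' t) - of_int q * c t) *\<^sub>R t)"
  proof -
    have "(\<Sum>t\<in>T. (of_int q * c t) *\<^sub>R t) = of_int q *\<^sub>R (\<Sum>t\<in>T. c t *\<^sub>R t)"
      by (simp add: scaleR_right.sum)
    then show ?thesis using c by (simp add: u_def scaleR_left_diff_distrib sum_subtractf)
  qed
  have \<xi>u: "\<xi> e u = 0" if e: "e \<in> E0" for e
  proof (rule int_small_zero)
    show "\<xi> e u \<in> \<int>"
      unfolding u_def linear_sum[OF lin] linear_scale[OF lin] by (intro Ints_sum) (use int in auto)
    have "\<bar>\<xi> e u\<bar> \<le> (\<Sum>t\<in>T. \<bar>(of_int (p' t) - of_int q * c t) * \<xi> e t\<bar>)"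
      unfolding u linear_sum[OF lin] linear_scale[OF lin] by (rule order_trans[OF sum_abs]) simp
    also have "\<dots> \<le> (\<Sum>t\<in>T. (1 / N) * \<bar>\<xi> e t\<bar>)"
    proof (rule sum_mono)
      fix t assume "t \<in> T"
      then have "\<bar>of_int (p' t) - of_int q * c t\<bar> \<le> 1 / N" using p' by (simp add: abs_minus_commute less_imp_le)
      then show "\<bar>(of_int (p' t) - of_int q * c t) * \<xi> e t\<bar> \<le> (1 / N) * \<bar>\<xi> e t\<bar>"
        unfolding abs_mult by (rule mult_right_mono) simp
    qed
    also have "\<dots> = (\<Sum>t\<in>T. \<bar>\<xi> e t\<bar>) / N" by (simp add: sum_divide_distrib)
    also have "\<dots> \<le> (\<Sum>t\<in>T. \<Sum>e\<in>E0. \<bar>\<xi> e t\<bar>) / N"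
      by (intro divide_right_mono sum_mono) (use e E0 in \<open>auto intro: member_le_sum[of e E0 "\<lambda>e. \<bar>\<xi> e t\<bar>" for t]\<close>)
    also have "\<dots> \<le> m / N" by (intro divide_right_mono) (auto simp: m_def)
    finally show "\<bar>\<xi> e u\<bar> < 1" using Nm by simp
  qed
  obtain a where a: "u = (\<Sum>x\<in>E0. a x *\<^sub>R x)" using uspan span_finite[OF E0(1)] by auto
  have "a e = 0" if "e \<in> E0" for e
    using coordinate_sum[of \<xi> e E, OF lin \<xi> E0, of a] \<xi>u[OF that] a that by simp
  then have u0: "u = 0" using a by simp
  show ?thesis
  proof (rule that[OF qp(1)])
    show "\<bar>of_int q * c t - of_int (p' t)\<bar> < \<epsilon>" if "t \<in> T" for t using p'[OF that] Ne by simp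
    show "(\<Sum>t\<in>T. of_int (p' t) *\<^sub>R t) = 0" using u0 by (simp only: u_def)
  qed
qed

lemma sum_mset_replicate_sum:
  "finite T \<Longrightarrow> sum_mset (\<Sum>t\<in>T. replicate_mset (n t) t) = (\<Sum>t\<in>T. of_nat (n t) *\<^sub>R (t :: 'a::real_vector))"
proof (induction T rule: finite_induct)
  case (insert x T)
  have "sum_mset (replicate_mset k x) = of_nat k *\<^sub>R x" for k
    by (induction k) (auto simp: scaleR_left_distrib)
  with insert show ?case by simp
qed simp

lemma set_mset_replicate_sum:
  "finite T \<Longrightarrow> set_mset (\<Sum>t\<in>T. replicate_mset (n t) t) = {t \<in> T. 0 < n t}"
  unfolding set_mset_sum by auto

text \<open>Two expressions of a common vector form one linear relation, with the coefficients on
  \<open>X - S\<close> negated. It is rounded to integers and the negative part is moved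
  back.\<close>

lemma weakly_separable_from_multisets:
  fixes E X S :: "'a::real_vector set"
  assumes E: "independent E" and X: "X \<subseteq> int_span E" and S: "S \<subseteq> X"
    and no: "\<And>M N. set_mset M \<subseteq> S \<Longrightarrow> set_mset N \<subseteq> X - S \<Longrightarrow> sum_mset M = sum_mset N \<Longrightarrow>
      M \<noteq> {#} \<or> N \<noteq> {#} \<Longrightarrow> False"
  shows "weakly_separable X S"
proof -
  have "v = 0" if v: "v \<in> pos_span S" "v \<in> pos_span (X - S)" for v
  proof (rule ccontr)
    assume v0: "v \<noteq> 0"
    obtain T1 c1 where 1: "finite T1" "T1 \<subseteq> S" "\<forall>x\<in>T1. c1 x \<ge> 0" "v = (\<Sum>x\<in>T1. c1 x *\<^sub>R x)"
      using v(1) unfolding pos_span_def by blast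
    obtain T2 c2 where 2: "finite T2" "T2 \<subseteq> X - S" "\<forall>x\<in>T2. c2 x \<ge> 0" "v = (\<Sum>x\<in>T2. c2 x *\<^sub>R x)"
      using v(2) unfolding pos_span_def by blast
    define c where "c = (\<lambda>x. if x \<in> T1 then c1 x else - c2 x)"
    have disj: "T1 \<inter> T2 = {}" using 1 2 by auto
    have s1: "(\<Sum>x\<in>T1. c x *\<^sub>R x) = v" unfolding 1(4) by (rule sum.cong) (auto simp: c_def)
    have "(\<Sum>x\<in>T2. c x *\<^sub>R x) = (\<Sum>x\<in>T2. - (c2 x *\<^sub>R x))" by (rule sum.cong) (use disj in \<open>auto simp: c_def\<close>)
    then have s2: "(\<Sum>x\<in>T2. c x *\<^sub>R x) = - v" using 2 by (simp add: sum_negf)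
    have c0: "(\<Sum>x\<in>T1 \<union> T2. c x *\<^sub>R x) = 0"
      unfolding sum.union_disjoint[OF 1(1) 2(1) disj] s1 s2 by simp
    obtain t where t: "t \<in> T1" "c1 t > 0"
    proof -
      have "\<exists>t\<in>T1. c1 t *\<^sub>R t \<noteq> 0" using v0 1(4) by (metis (no_types, lifting) sum.neutral)
      then show ?thesis using that 1(3) by force
    qed
    \<comment> \<open>The bound 1 preserves signs, since an integer at distance less than 1 from a
      nonnegative number is itself nonnegative. The bound \<open>c1 t\<close> keeps the multiplicity
      of \<open>t\<close> positive, so the relation is not empty.\<close>
    define \<epsilon> where "\<epsilon> = min 1 (c1 t)"
    have "T1 \<union> T2 \<subseteq> int_span E" "finite (T1 \<union> T2)" "0 < \<epsilon>" using 1 2 S X t by (auto simp: \<epsilon>_def)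
    then obtain q p where q: "0 < q" and qp: "\<And>t. t \<in> T1 \<union> T2 \<Longrightarrow> \<bar>of_int q * c t - of_int (p t)\<bar> < \<epsilon>"
      and p0: "(\<Sum>t\<in>T1 \<union> T2. of_int (p t) *\<^sub>R t) = 0"
      using integral_relation[OF E _ _ c0] by blast
    have q1: "1 \<le> real_of_int q" using q by simp
    have p1: "0 \<le> p t" if "t \<in> T1" for t
    proof -
      have "0 \<le> of_int q * c t" using q1 that 1(3) by (simp add: c_def)
      then have "- 1 < real_of_int (p t)" using qp[of t] that by (simp add: \<epsilon>_def abs_less_iff)
      then show ?thesis by linarith
    qed
    have p2: "p t \<le> 0" if "t \<in> T2" for t
    proof -
      have "0 \<le> of_int q * c2 t" using q1 that 2(3) by simp
      then have "real_of_int (p t) < 1" using qp[of t] that disj by (auto simp: c_def \<epsilon>_def abs_less_iff split: if_splits)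
      then show ?thesis by linarith
    qed
    have pt: "0 < p t"
    proof -
      have "c1 t \<le> of_int q * c1 t" using q1 t by simp
      moreover have "\<bar>of_int q * c1 t - of_int (p t)\<bar> < c1 t" using qp[of t] t by (simp add: c_def \<epsilon>_def)
      ultimately have "0 < real_of_int (p t)" by linarith
      then show ?thesis by linarith
    qed
    define M N where "M = (\<Sum>t\<in>T1. replicate_mset (nat (p t)) t)" and "N = (\<Sum>t\<in>T2. replicate_mset (nat (- p t)) t)"
    have "sum_mset M = (\<Sum>t\<in>T1. of_int (p t) *\<^sub>R t)"
      unfolding M_def sum_mset_replicate_sum[OF 1(1)] by (rule sum.cong) (use p1 in auto)
    moreover have "sum_mset N = - (\<Sum>t\<in>T2. of_int (p t) *\<^sub>R t)"
      unfolding N_def sum_mset_replicate_sum[OF 2(1)] sum_negf[symmetric] by (rule sum.cong) (use p2 in auto)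
    moreover have "(\<Sum>t\<in>T1. of_int (p t) *\<^sub>R t) + (\<Sum>t\<in>T2. of_int (p t) *\<^sub>R t) = 0"
      using p0 sum.union_disjoint[OF 1(1) 2(1) disj] by metis
    ultimately have "sum_mset M = sum_mset N" by (simp add: add_eq_0_iff2)
    moreover have "set_mset M \<subseteq> S" "set_mset N \<subseteq> X - S"
      using 1 2 by (auto simp: M_def N_def set_mset_replicate_sum)
    moreover have "t \<in># M" using t pt 1 by (simp add: M_def set_mset_replicate_sum)
    then have "M \<noteq> {#}" by auto
    ultimately show False using no by blast
  qed
  then show ?thesis using pos_span_0 unfolding weakly_separable_def by blast
qed

section \<open>Relations between multisets\<close>

lemma additive_sum_mset_nonpos:
  fixes g :: "'a::real_vector \<Rightarrow> real"
  assumes "\<And>x y. g (x + y) = g x + g y" "\<And>p. p \<in># M \<Longrightarrow> g p \<le> 0"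
  shows "g (sum_mset M) \<le> 0"
  using assms(2)
proof (induction M)
  case empty
  show ?case using assms(1)[of 0 0] by simp
next
  case (add x M)
  then have "g (sum_mset M) \<le> 0" "g x \<le> 0" by auto
  then show ?case using assms(1)[of x "sum_mset M"] by simp
qed

lemma sum_mset_mem:
  assumes "0 \<in> S" "\<And>x y. x \<in> S \<Longrightarrow> y \<in> S \<Longrightarrow> x + y \<in> S" "set_mset M \<subseteq> S"
  shows "sum_mset M \<in> S"
  using assms(3) by (induction M) (use assms(1,2) in auto)

lemma sum_mset_repeat: "sum_mset (repeat_mset n M) = of_nat n *\<^sub>R (sum_mset M :: 'a::real_vector)"
  by (induction n) (auto simp: scaleR_left_distrib add.commute)

lemma set_repeat_subset: "set_mset (repeat_mset n M) \<subseteq> set_mset M"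
  by (induction n) auto

text \<open>Each step replaces \<open>p\<close> and \<open>q\<close> by one difference, so the total
  size drops while the side receiving the difference stays nonempty. The sets are arbitrary because
  the descent is run on the two halves of an ideal, with multiples of \<delta> added to one half,
  and on roots below \<delta> alone.\<close>

lemma relation_descent:
  fixes f :: "'a::ab_group_add \<Rightarrow> 'a \<Rightarrow> real"
  assumes step: "\<And>p q. p \<in> P \<Longrightarrow> q \<in> Q \<Longrightarrow> 0 < f p q \<Longrightarrow> p - q \<in> P \<or> q - p \<in> Q"
    and "set_mset M \<subseteq> P" "set_mset N \<subseteq> Q" "sum_mset M = sum_mset N" "M \<noteq> {#} \<or> N \<noteq> {#}"
  shows "\<exists>M' N'. set_mset M' \<subseteq> P \<and> set_mset N' \<subseteq> Q \<and> sum_mset M' = sum_mset N' \<and>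
    (M' \<noteq> {#} \<or> N' \<noteq> {#}) \<and> (\<forall>p\<in>#M'. \<forall>q\<in>#N'. f p q \<le> 0)"
  using assms(2-)
proof (induction "size M + size N" arbitrary: M N rule: less_induct)
  case less
  show ?case
  proof (cases "\<forall>p\<in>#M. \<forall>q\<in>#N. f p q \<le> 0")
    case True
    then show ?thesis using less.prems by blast
  next
    case False
    then obtain p q where pq: "p \<in># M" "q \<in># N" "0 < f p q" by force
    then obtain M0 N0 where M: "M = add_mset p M0" and N: "N = add_mset q N0"
      by (meson multi_member_split)
    have e: "p + sum_mset M0 = q + sum_mset N0" using less.prems(3) M N by simp
    from step pq less.prems have "p - q \<in> P \<or> q - p \<in> Q" by blast
    then show ?thesis
    proof
      assume "p - q \<in> P"
      moreover have "sum_mset (add_mset (p - q) M0) = sum_mset N0"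
        using e by (simp add: algebra_simps)
      ultimately show ?thesis
        using less.hyps[of "add_mset (p - q) M0" N0] less.prems M N by auto
    next
      assume "q - p \<in> Q"
      moreover have "sum_mset M0 = sum_mset (add_mset (q - p) N0)"
        using e by (simp add: algebra_simps)
      ultimately show ?thesis
        using less.hyps[of M0 "add_mset (q - p) N0"] less.prems M N by auto
    qed
  qed
qed

lemma int_least:
  assumes "0 \<le> k" "P (k::int)"
  obtains n where "0 \<le> n" "P n" "\<And>u. 0 \<le> u \<Longrightarrow> u < n \<Longrightarrow> \<not> P u"
proof -
  define n where "n = (LEAST m::nat. P (int m))"
  have "P (int (nat k))" using assms by simp
  then have "P (int n)" unfolding n_def by (rule LeastI)
  moreover have "\<not> P u" if "0 \<le> u" "u < int n" for u
    using not_less_Least[of "nat u" "\<lambda>m. P (int m)"] that by (simp add: n_def)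
  ultimately show ?thesis using that[of "int n"] by simp
qed

text \<open>The unknowns are the Cartan integers between a root and two orthogonal roots whose
  half-integral combination it is. A value 1 is recorded where the corresponding reflection has to
  subtract the root exactly once.\<close>

lemma int_product_cases:
  assumes "1 \<le> m" "1 \<le> n" "1 \<le> a" "1 \<le> b" "m * a + n * b = (4::int)"
  shows "m = n \<and> (m = 1 \<or> m = 2) \<or> (m = 1 \<and> n = 2 \<and> b = 1) \<or> (m = 2 \<and> n = 1 \<and> a = 1) \<or>
    (m = 1 \<and> n = 3 \<and> b = 1) \<or> (m = 3 \<and> n = 1 \<and> a = 1)"
proof -
  have *: "c \<le> c * d" if "1 \<le> c" "1 \<le> d" for c d :: int
    using mult_left_mono[of 1 d c] that by simp
  have "m \<le> m * a" "n \<le> n * b" "a \<le> m * a" "b \<le> n * b"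
    using *[of m a] *[of n b] *[of a m] *[of b n] assms(1-4) by (simp_all add: mult.commute)
  moreover from this have "1 \<le> m * a" "1 \<le> n * b" using assms(1,2) by linarith+
  ultimately have "m \<le> 3" "n \<le> 3" "a \<le> 3" "b \<le> 3" using assms(5) by linarith+
  then have m: "m = 1 \<or> m = 2 \<or> m = 3" and n: "n = 1 \<or> n = 2 \<or> n = 3" using assms(1,2) by linarith+
  from m n show ?thesis using assms(3-5) by (elim disjE) (hypsubst, presburger)+
qed

section \<open>Biclosed sets on lines of affine roots\<close>

text \<open>These are the properties that concern single lines in direction \<delta> and the order;
  \<open>K\<close> stands for the nonnegative span of the base.\<close>

locale affine_roots =
  fixes \<Phi> K I :: "'a::real_vector set" and \<delta> :: 'a
  assumes K_add: "x \<in> K \<Longrightarrow> y \<in> K \<Longrightarrow> x + y \<in> K"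
    and K_scale: "x \<in> K \<Longrightarrow> 0 \<le> c \<Longrightarrow> c *\<^sub>R x \<in> K"
    and delta_K: "\<delta> \<in> K"
    and delta_neg: "- \<delta> \<notin> K"
    and root_uminus: "r \<in> \<Phi> \<Longrightarrow> - r \<in> \<Phi>"
    and root_shift: "r \<in> \<Phi> \<Longrightarrow> r + of_int k *\<^sub>R \<delta> \<in> \<Phi>"
    and root_sign: "r \<in> \<Phi> \<Longrightarrow> (r \<in> K) \<noteq> (- r \<in> K)"
    and root_level: "r \<in> \<Phi> \<Longrightarrow> \<exists>k::int. r + of_int k *\<^sub>R \<delta> \<in> K \<and> \<delta> - (r + of_int k *\<^sub>R \<delta>) \<in> K"
    and I_roots: "I \<subseteq> \<Phi> \<inter> K"
    and I_ideal: "r \<in> I \<Longrightarrow> s \<in> \<Phi> \<Longrightarrow> s \<in> K \<Longrightarrow> r - s \<in> K \<Longrightarrow> s \<in> I"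
begin

abbreviation shift :: "'a \<Rightarrow> int \<Rightarrow> 'a" where
  "shift x k \<equiv> x + of_int k *\<^sub>R \<delta>"

text \<open>A line in direction \<delta> that contains roots meets this set in exactly one point. An
  element together with an integer level thus describes every root, and \<open>\<delta> - x\<close>
  represents the line opposite to that of \<open>x\<close>.\<close>

definition small :: "'a set" where
  "small = {x \<in> \<Phi>. x \<in> K \<and> \<delta> - x \<in> K}"

text \<open>A symmetric form of biclosedness, so that each argument also holds with the two halves
  exchanged.\<close>

definition closed_split :: "'a set \<Rightarrow> 'a set \<Rightarrow> bool" where
  "closed_split A D \<longleftrightarrow> A \<union> D = I \<and> A \<inter> D = {} \<and> rs_closed I A \<and> rs_closed I D"

lemma closed_split_sym: "closed_split A D \<Longrightarrow> closed_split D A"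
  by (auto simp: closed_split_def)

lemma closed_split_cases: "closed_split A D \<Longrightarrow> r \<in> I \<Longrightarrow> r \<in> A \<or> r \<in> D"
  by (auto simp: closed_split_def)

lemma closed_split_disj: "closed_split A D \<Longrightarrow> r \<in> A \<Longrightarrow> r \<in> D \<Longrightarrow> False"
  by (auto simp: closed_split_def)

lemma closed_split_I: "closed_split A D \<Longrightarrow> r \<in> A \<Longrightarrow> r \<in> I" "closed_split A D \<Longrightarrow> r \<in> D \<Longrightarrow> r \<in> I"
  by (auto simp: closed_split_def)

lemma I_D: "r \<in> I \<Longrightarrow> r \<in> \<Phi>" "r \<in> I \<Longrightarrow> r \<in> K"
  using I_roots by auto

lemma closed_split_comb:
  assumes "closed_split A D" "s \<in> A" "t \<in> A" "r \<in> I" "r = a *\<^sub>R s + b *\<^sub>R t" "0 \<le> a" "0 \<le> b"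
  shows "r \<in> A"
  using assms pos_span_pair[of a b s t] unfolding closed_split_def rs_closed_def by blast

lemma closed_split_sum:
  assumes "closed_split A D" "s \<in> A" "t \<in> A" "r \<in> I" "r = s + t"
  shows "r \<in> A"
  using closed_split_comb[OF assms(1-4), of 1 1] assms(5) by simp

lemma closed_split_avg:
  assumes "closed_split A D" "s \<in> A" "t \<in> A" "r \<in> I" "r + r = s + t"
  shows "r \<in> A"
proof -
  have "r = (1/2) *\<^sub>R (r + r)" by (simp add: scaleR_2[symmetric])
  also have "\<dots> = (1/2) *\<^sub>R s + (1/2) *\<^sub>R t" by (simp only: assms(5) scaleR_right_distrib)
  finally show ?thesis using closed_split_comb[OF assms(1-4), of "1/2" "1/2"] by simp
qed

lemma summand:
  assumes "r \<in> I" "s \<in> \<Phi>" "s \<in> K" "t \<in> K" "r = s + t"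
  shows "s \<in> I"
  using I_ideal[OF assms(1-3)] assms by simp

text \<open>The ideal contains \<open>t\<close> because the remainder \<open>s\<close> is positive;
  if \<open>t\<close> were in \<open>D\<close>, closedness of \<open>D\<close> would carry
  \<open>r\<close> into \<open>D\<close>.\<close>

lemma closed_split_diff:
  assumes "closed_split A D" "r \<in> A" "s \<in> D" "t \<in> \<Phi>" "t \<in> K" "r = s + t"
  shows "t \<in> A"
proof -
  have rI: "r \<in> I" and "s \<in> K" using assms closed_split_I I_D by blast+
  then have "t \<in> I" using summand[of r t s] assms by (simp add: add.commute)
  then show ?thesis
    using closed_split_cases[OF assms(1)] closed_split_disj[OF assms(1)]
      closed_split_sum[OF closed_split_sym[OF assms(1)] \<open>s \<in> D\<close> _ rI assms(6)] assms(2) by blast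
qed

lemma delta_ge: "0 \<le> k \<Longrightarrow> of_int k *\<^sub>R \<delta> \<in> K"
  using K_scale delta_K by simp

lemma delta_nonneg:
  assumes "of_int k *\<^sub>R \<delta> \<in> K" shows "0 \<le> k"
proof (rule ccontr)
  assume "\<not> 0 \<le> k"
  then have "(- 1 / of_int k) *\<^sub>R (of_int k *\<^sub>R \<delta>) \<in> K"
    by (intro K_scale assms) (simp add: field_simps)
  with \<open>\<not> 0 \<le> k\<close> delta_neg show False by simp
qed

lemma smallD: "x \<in> small \<Longrightarrow> x \<in> \<Phi>" "x \<in> small \<Longrightarrow> x \<in> K" "x \<in> small \<Longrightarrow> \<delta> - x \<in> K"
  by (auto simp: small_def)

lemma small_compl: "x \<in> small \<Longrightarrow> \<delta> - x \<in> small"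
  using root_shift[OF root_uminus, of x 1] by (auto simp: small_def)

lemma K_level:
  assumes "x \<in> small" shows "shift x k \<in> K \<longleftrightarrow> 0 \<le> k"
proof
  assume a: "0 \<le> k" then show "shift x k \<in> K"
    using K_add delta_ge smallD assms by blast
next
  assume b: "shift x k \<in> K" show "0 \<le> k"
  proof (rule ccontr)
    assume "\<not> 0 \<le> k"
    then have "(\<delta> - x) + of_int (- k - 1) *\<^sub>R \<delta> \<in> K"
      by (intro K_add[OF smallD(3)[OF assms]] delta_ge) simp
    then have "- shift x k \<in> K" by (simp add: algebra_simps)
    with b root_sign root_shift smallD(1)[OF assms] show False by blast
  qed
qed

lemma root_small: "r \<in> \<Phi> \<Longrightarrow> \<exists>x\<in>small. \<exists>k. r = shift x k"
proof -
  assume r: "r \<in> \<Phi>"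
  then obtain k where k: "shift r k \<in> K" "\<delta> - shift r k \<in> K" using root_level by blast
  with r root_shift have "shift r k \<in> small" by (simp add: small_def)
  moreover have "r = shift (shift r k) (- k)" by simp
  ultimately show ?thesis by blast
qed

lemma pos_root_small:
  assumes "r \<in> \<Phi>" "r \<in> K" obtains x k where "x \<in> small" "0 \<le> k" "r = shift x k"
  using root_small[OF assms(1)] K_level assms(2) by blast

lemma small_unique:
  assumes "x \<in> small" "y \<in> small" "x = shift y k" shows "k = 0"
proof -
  have "0 \<le> k" using K_level[OF assms(2), of k] assms smallD by auto
  have "y = shift x (- k)" using assms(3) by simp
  then have "0 \<le> - k" using K_level[OF assms(1), of "- k"] assms smallD by metis
  with \<open>0 \<le> k\<close> show ?thesis by simp
qed

section \<open>Opposite roots and thresholds\<close>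

definition has_opposites :: "'a set \<Rightarrow> bool" where
  "has_opposites A \<longleftrightarrow> (\<exists>r\<in>A. \<exists>s\<in>A. \<exists>k::int. r + s = of_int k *\<^sub>R \<delta>)"

text \<open>On the part in \<open>I\<close> of the line through \<open>x\<close>, the set \<open>A\<close> consists of the levels from \<open>n\<close> upwards; it
  contains all of \<open>I\<close> on the line through \<open>- x\<close>, whose lowest positive root is \<open>\<delta> - x\<close>.\<close>
definition threshold :: "'a set \<Rightarrow> 'a \<Rightarrow> int \<Rightarrow> bool" where
  "threshold A x n \<longleftrightarrow> x \<in> small \<and> 0 \<le> n \<and> \<delta> - x \<in> A \<and> shift x n \<in> A \<and>
    (\<forall>u\<ge>n. shift x u \<in> I \<longrightarrow> shift x u \<in> A) \<and> (\<forall>u\<ge>0. u < n \<longrightarrow> shift x u \<notin> A) \<and>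
    (\<forall>u\<ge>0. shift (\<delta> - x) u \<in> I \<longrightarrow> shift (\<delta> - x) u \<in> A)"

text \<open>The two given roots of \<open>A\<close> add up to \<open>i + j + 1\<close> times
  \<delta>, so a suitable nonnegative real multiple \<open>b\<close> of their sum lifts the first
  one to any higher level.\<close>

lemma opposite_upward:
  assumes "closed_split A D" "shift x i \<in> A" "shift (\<delta> - x) j \<in> A" "x \<in> small" "i \<le> u" "shift x u \<in> I"
  shows "shift x u \<in> A"
proof -
  have "shift x i \<in> K" "shift (\<delta> - x) j \<in> K"
    using I_D(2)[OF closed_split_I(1)[OF assms(1)]] assms(2,3) by auto
  then have "0 \<le> i" "0 \<le> j"
    using K_level[OF assms(4)] K_level[OF small_compl[OF assms(4)]] by auto
  then have p: "0 < real_of_int (i + j + 1)" by simp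
  define b where "b = real_of_int (u - i) / real_of_int (i + j + 1)"
  have b0: "0 \<le> b" using p assms(5) by (simp add: b_def)
  have e: "b * real_of_int (i + j + 1) = real_of_int (u - i)" using p by (simp add: b_def)
  have "(1 + b) *\<^sub>R shift x i + b *\<^sub>R shift (\<delta> - x) j = shift x i + (b * real_of_int (i + j + 1)) *\<^sub>R \<delta>"
    by (simp add: algebra_simps)
  also have "\<dots> = shift x u" by (simp only: e) (simp add: algebra_simps)
  finally show ?thesis
    using closed_split_comb[OF assms(1,2,3,6), of "1 + b" b] b0 by simp
qed

text \<open>Take the lowest levels of \<open>A\<close> on the two opposite lines. If both were
  positive, \<open>x\<close> and \<open>\<delta> - x\<close> would lie in \<open>D\<close>, and by
  \<open>opposite_upward\<close> so would every root of \<open>I\<close> on the line of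
  \<open>x\<close>, including one of \<open>A\<close>.\<close>

lemma opposites_threshold:
  assumes b: "closed_split A D" and "has_opposites A" obtains x n where "threshold A x n"
proof -
  obtain r s k where rs: "r \<in> A" "s \<in> A" "r + s = of_int k *\<^sub>R \<delta>"
    using assms by (auto simp: has_opposites_def)
  obtain x i where x: "x \<in> small" "0 \<le> i" "r = shift x i"
    using pos_root_small rs b closed_split_I I_D by metis
  \<comment> \<open>The 1 is subtracted because the opposite line is measured from
    \<open>\<delta> - x\<close> and not from \<open>- x\<close>.\<close>
  define j where "j = k - i - 1"
  have s: "s = shift (\<delta> - x) j" using rs x by (simp add: algebra_simps j_def eq_diff_eq add_eq_0_iff)
  have x': "\<delta> - x \<in> small" using x small_compl by blast
  have "0 \<le> j" using s rs b closed_split_I I_D K_level[OF x'] by metis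
  obtain n where n: "0 \<le> n" "shift x n \<in> A" "\<And>u. 0 \<le> u \<Longrightarrow> u < n \<Longrightarrow> shift x u \<notin> A"
    using int_least[of i "\<lambda>i. shift x i \<in> A"] x rs by blast
  obtain m where m: "0 \<le> m" "shift (\<delta> - x) m \<in> A" "\<And>u. 0 \<le> u \<Longrightarrow> u < m \<Longrightarrow> shift (\<delta> - x) u \<notin> A"
    using int_least[of j "\<lambda>i. shift (\<delta> - x) i \<in> A"] \<open>0 \<le> j\<close> s rs by blast
  have up: "shift x u \<in> A" if "n \<le> u" "shift x u \<in> I" for u
    using opposite_upward[OF b n(2) m(2) x(1)] that by blast
  have up': "shift (\<delta> - x) u \<in> A" if "m \<le> u" "shift (\<delta> - x) u \<in> I" for u
    using opposite_upward[OF b m(2) _ x', of n u] n that by simp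
  have "n = 0 \<or> m = 0"
  proof (rule ccontr)
    assume h: "\<not> (n = 0 \<or> m = 0)"
    have "shift x 0 \<in> I"
      using summand[of "shift x n" x "of_int n *\<^sub>R \<delta>"] b n closed_split_I smallD[OF x(1)] delta_ge by force
    moreover have "shift (\<delta> - x) 0 \<in> I"
      using summand[of "shift (\<delta> - x) m" "\<delta> - x" "of_int m *\<^sub>R \<delta>"] b m closed_split_I smallD[OF x'] delta_ge by force
    ultimately have "shift x 0 \<in> D" "shift (\<delta> - x) 0 \<in> D"
      using closed_split_cases[OF b] n(3)[of 0] m(3)[of 0] h n(1) m(1) by (metis order_le_less)+
    then have "shift x n \<in> D"
      using opposite_upward[OF closed_split_sym[OF b], of x 0 0 n] x n b closed_split_I by blast
    then show False using closed_split_disj b n by blast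
  qed
  then show ?thesis
  proof
    assume "m = 0"
    then have "threshold A x n" using n m x up up' by (auto simp: threshold_def)
    then show ?thesis by (rule that)
  next
    assume "n = 0"
    then have "threshold A (\<delta> - x) m" using n m x' up up' by (auto simp: threshold_def)
    then show ?thesis by (rule that)
  qed
qed

lemma K_levelI: "x \<in> small \<Longrightarrow> 0 \<le> k \<Longrightarrow> shift x k \<in> K"
  by (simp only: K_level)

lemma threshold_small: "threshold A x n \<Longrightarrow> x \<in> small"
  by (simp add: threshold_def)

lemma threshold_compl: "threshold A x n \<Longrightarrow> \<delta> - x \<in> A"
  by (simp add: threshold_def)

lemma threshold_top: "threshold A x n \<Longrightarrow> shift x n \<in> A"
  by (simp add: threshold_def)

lemma threshold_compl_ge: "threshold A x n \<Longrightarrow> shift (\<delta> - x) u \<in> I \<Longrightarrow> shift (\<delta> - x) u \<in> A"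
  using K_level[OF small_compl[of x], of u] I_D by (auto simp: threshold_def)

lemma threshold_ge: "threshold A x n \<Longrightarrow> n \<le> u \<Longrightarrow> shift x u \<in> I \<Longrightarrow> shift x u \<in> A"
  by (simp add: threshold_def)

lemma threshold_less:
  assumes b: "closed_split A D" and n: "threshold A x n" and u: "0 \<le> u" "u < n" shows "shift x u \<in> D"
proof -
  have x: "x \<in> small" using n threshold_small by blast
  have "shift x u \<in> I"
  proof (rule summand)
    show "shift x n \<in> I" using b n threshold_top closed_split_I by blast
    show "shift x u \<in> \<Phi>" using x smallD root_shift by blast
    show "shift x u \<in> K" using K_level[OF x] u by simp
    show "of_int (n - u) *\<^sub>R \<delta> \<in> K" by (rule delta_ge) (use u in simp)
  qed (simp add: algebra_simps)
  then show ?thesis using closed_split_cases[OF b] n u by (auto simp: threshold_def)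
qed

text \<open>At threshold 0 both lines belong to \<open>A\<close> from the bottom, so either may
  represent the pair.\<close>

lemma threshold_zero_flip:
  assumes "threshold A x 0" shows "threshold A (\<delta> - x) 0"
  using assms small_compl[of x] threshold_compl_ge[OF assms] threshold_ge[OF assms] by (simp add: threshold_def)

lemma threshold_n_nonneg: "threshold A x n \<Longrightarrow> 0 \<le> n"
  by (simp add: threshold_def)

section \<open>Thresholds on lines with a root as sum or difference\<close>

lemma closed_split_diff':
  assumes "closed_split A D" "r \<in> A" "s \<in> D" "t \<in> \<Phi>" "t \<in> K" "r = t + s"
  shows "t \<in> A"
  using closed_split_diff[OF assms(1-5)] assms(6) by (simp add: add.commute)

lemma root_diff_swap: "x - y \<in> \<Phi> \<Longrightarrow> y - x \<in> \<Phi>"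
  using root_uminus[of "x - y"] by simp

text \<open>Both \<open>x = (x - y) + y\<close> and
  \<open>\<delta> - y = (x - y) + (\<delta> - x)\<close> have their second summand in the other
  half, so \<open>x - y\<close> is forced into both halves.\<close>

lemma threshold_diff_aux_00:
  assumes b: "closed_split A D" and x: "threshold A x 0" and y: "threshold D y 0" and d: "x - y \<in> \<Phi>" "x - y \<in> K"
  shows False
proof -
  have "x \<in> A" "\<delta> - x \<in> A" "y \<in> D" "\<delta> - y \<in> D" using x y by (auto simp: threshold_def)
  then have "x - y \<in> A" using closed_split_diff'[OF b _ _ d, of x y] by auto
  moreover have "x - y \<in> D"
    by (rule closed_split_diff'[OF closed_split_sym[OF b] \<open>\<delta> - y \<in> D\<close> \<open>\<delta> - x \<in> A\<close> d]) simp
  ultimately show False using b closed_split_disj by blast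
qed

lemma threshold_diff_00:
  assumes b: "closed_split A D" and x: "threshold A x 0" and y: "threshold D y 0" and d: "x - y \<in> \<Phi>"
  shows False
proof (cases "x - y \<in> K")
  case True then show ?thesis using threshold_diff_aux_00 assms by blast
next
  case False
  then have "y - x \<in> K" using root_sign[OF d] by simp
  then show ?thesis using threshold_diff_aux_00[OF closed_split_sym[OF b] y x root_diff_swap[OF d]] by simp
qed

text \<open>At level \<open>n\<close>, \<open>x - y\<close> is the sum of
  \<open>\<delta> - y\<close> and of \<open>x\<close> just below its threshold, both in
  \<open>D\<close>. Adding \<open>y\<close>, also in \<open>D\<close>, gives the threshold root of
  \<open>A\<close>.\<close>

lemma threshold_diff_n0:
  assumes b: "closed_split A D" and x: "threshold A x n" and y: "threshold D y 0" and d: "x - y \<in> \<Phi>" and n: "1 \<le> n"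
  shows False
proof -
  note xs = threshold_small[OF x] and ys = threshold_small[OF y]
  note K = smallD(2)[OF xs] smallD(2)[OF ys] smallD(3)[OF xs] smallD(3)[OF ys]
  have yD: "y \<in> D" "\<delta> - y \<in> D" using y by (auto simp: threshold_def)
  have "shift (x - y) n \<in> I"
  proof (rule summand)
    show "shift x n \<in> I" using threshold_top[OF x] b closed_split_I by blast
    show "shift x n = shift (x - y) n + y" by simp
    show "shift (x - y) n \<in> \<Phi>" using d root_shift by blast
    show "shift (x - y) n \<in> K"
      using K_add[OF K_add[OF K(1,4)] delta_ge[of "n - 1"]] n by (simp add: algebra_simps)
  qed fact
  moreover have "shift (x - y) n = shift x (n - 1) + (\<delta> - y)" by (simp add: algebra_simps)
  moreover have "shift x (n - 1) \<in> D" by (rule threshold_less[OF b x]) (use n in auto)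
  ultimately have "shift (x - y) n \<in> D" using closed_split_sum[OF closed_split_sym[OF b]] yD by blast
  then have "shift x n \<in> D"
    by (rule closed_split_sum[OF closed_split_sym[OF b] _ yD(1) closed_split_I(1)[OF b threshold_top[OF x]]]) simp
  then show False using threshold_top[OF x] b closed_split_disj by blast
qed

text \<open>What completes \<open>x + y\<close> to the threshold root of \<open>x\<close> is
  \<open>\<delta> - y\<close> at level \<open>n - 1\<close>, which lies in \<open>D\<close> with all
  of \<open>I\<close> on its line.\<close>

lemma threshold_sum_aux:
  assumes b: "closed_split A D" and x: "threshold A x n" and y: "threshold D y m" and d: "x + y \<in> \<Phi>" and n: "1 \<le> n"
  shows "x + y \<in> A"
proof (rule closed_split_diff'[OF b threshold_top[OF x]])
  note xs = threshold_small[OF x] and ys = threshold_small[OF y]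
  note K = smallD(2)[OF xs] smallD(2)[OF ys] smallD(3)[OF xs] smallD(3)[OF ys]
  show "x + y \<in> \<Phi>" by fact
  show xy: "x + y \<in> K" using K_add K by blast
  show e: "shift x n = (x + y) + shift (\<delta> - y) (n - 1)" by (simp add: algebra_simps)
  have "shift (\<delta> - y) (n - 1) \<in> I"
  proof (rule summand)
    show "shift x n \<in> I" using threshold_top[OF x] b closed_split_I by blast
    show "shift x n = shift (\<delta> - y) (n - 1) + (x + y)" by (simp add: algebra_simps)
    show "shift (\<delta> - y) (n - 1) \<in> \<Phi>" using small_compl[OF ys] smallD root_shift by blast
    show "shift (\<delta> - y) (n - 1) \<in> K" by (rule K_levelI[OF small_compl[OF ys]]) (use n in simp)
  qed fact
  then show "shift (\<delta> - y) (n - 1) \<in> D" using threshold_compl_ge[OF y] by blast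
qed

lemma threshold_sum:
  assumes b: "closed_split A D" and x: "threshold A x n" and y: "threshold D y m" and d: "x + y \<in> \<Phi>" and n: "1 \<le> n" "1 \<le> m"
  shows False
proof -
  have "x + y \<in> D" using threshold_sum_aux[OF closed_split_sym[OF b] y x] d n by (simp add: add.commute)
  then show False using threshold_sum_aux[OF b x y d n(1)] b closed_split_disj by blast
qed

text \<open>The root \<open>?w\<close> is tested twice: as the difference of the two threshold roots
  it lies in \<open>A\<close>, as the sum of \<open>\<delta> - y\<close> and a root below the
  threshold of \<open>x\<close> it lies in \<open>D\<close>.\<close>

lemma threshold_diff_less:
  assumes b: "closed_split A D" and x: "threshold A x n" and y: "threshold D y m" and d: "x - y \<in> \<Phi>" and n: "1 \<le> m" "m < n"
  shows False
proof -
  note xs = threshold_small[OF x] and ys = threshold_small[OF y]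
  note K = smallD(2)[OF xs] smallD(2)[OF ys] smallD(3)[OF xs] smallD(3)[OF ys]
  let ?w = "shift (x - y) (n - m)"
  have w: "?w \<in> \<Phi>" using d root_shift by blast
  have wK: "?w \<in> K"
    using K_add[OF K_add[OF K(1,4)] delta_ge[of "n - m - 1"]] n by (simp add: algebra_simps)
  have e: "shift x n = ?w + shift y m" by (simp add: algebra_simps)
  have A: "?w \<in> A" using closed_split_diff'[OF b threshold_top[OF x] threshold_top[OF y] w wK e] .
  have "?w = shift x (n - m - 1) + (\<delta> - y)" by (simp add: algebra_simps)
  moreover have "shift x (n - m - 1) \<in> D" by (rule threshold_less[OF b x]) (use n in auto)
  ultimately have "?w \<in> D" using closed_split_sum[OF closed_split_sym[OF b]] threshold_compl[OF y] A b closed_split_I by blast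
  with A b closed_split_disj show False by blast
qed

text \<open>The levels \<open>n\<close> and \<open>n - 1\<close> give the same difference
  \<open>x - y\<close>, but the halves containing the two roots are exchanged.\<close>

lemma threshold_diff_eq:
  assumes b: "closed_split A D" and x: "threshold A x n" and y: "threshold D y n" and d: "x - y \<in> \<Phi>" "x - y \<in> K" and n: "1 \<le> n"
  shows False
proof -
  have "x - y \<in> A" by (rule closed_split_diff'[OF b threshold_top[OF x] threshold_top[OF y] d]) simp
  moreover have "x - y \<in> D"
    by (rule closed_split_diff'[OF closed_split_sym[OF b] threshold_less[OF b x] threshold_less[OF closed_split_sym[OF b] y] d, of "n - 1" "n - 1"])
      (use n in auto)
  ultimately show False using b closed_split_disj by blast
qed

lemma threshold_diff_pos:
  assumes b: "closed_split A D" and x: "threshold A x n" and y: "threshold D y m" and d: "x - y \<in> \<Phi>" and n: "1 \<le> n" "1 \<le> m"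
  shows False
proof -
  consider "m < n" | "n < m" | "n = m" by linarith
  then show ?thesis
  proof cases
    case 1 then show ?thesis using threshold_diff_less assms by blast
  next
    case 2 then show ?thesis
      using threshold_diff_less[OF closed_split_sym[OF b] y x root_diff_swap[OF d]] n by blast
  next
    case 3
    show ?thesis
    proof (cases "x - y \<in> K")
      case True then show ?thesis using threshold_diff_eq assms 3 by blast
    next
      case False
      then have "y - x \<in> K" using root_sign[OF d] by simp
      then show ?thesis using threshold_diff_eq[OF closed_split_sym[OF b] y] x root_diff_swap[OF d] n 3 by blast
    qed
  qed
qed

text \<open>If a threshold is 0, the complement of its line may be used instead, which turns a sum
  into a difference up to \<delta> and sign. The sum needs its own argument only when both
  thresholds are positive.\<close>

lemma threshold_no_root:
  assumes b: "closed_split A D" and x: "threshold A x n" and y: "threshold D y m" and d: "x - y \<in> \<Phi> \<or> x + y \<in> \<Phi>"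
  shows False
proof -
  have fl: "x - (\<delta> - y) \<in> \<Phi>" "(\<delta> - x) - y \<in> \<Phi>" if "x + y \<in> \<Phi>"
  proof -
    show "x - (\<delta> - y) \<in> \<Phi>" using root_shift[OF that, of "-1"] by (simp add: algebra_simps)
    show "(\<delta> - x) - y \<in> \<Phi>" using root_shift[OF root_uminus[OF that], of "1"] by (simp add: algebra_simps)
  qed
  consider "n = 0" "m = 0" | "n = 0" "1 \<le> m" | "1 \<le> n" "m = 0" | "1 \<le> n" "1 \<le> m"
    using threshold_n_nonneg[OF x] threshold_n_nonneg[OF y] by linarith
  then show ?thesis
  proof cases
    case 1
    then show ?thesis using threshold_diff_00[OF b] threshold_zero_flip[of D y] x y d fl by blast
  next
    case 2
    then show ?thesis
      using threshold_diff_n0[OF closed_split_sym[OF b] y] threshold_zero_flip[of A x] x d fl root_diff_swap by blast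
  next
    case 3
    then show ?thesis using threshold_diff_n0[OF b x] threshold_zero_flip[of D y] y d fl by blast
  next
    case 4
    then show ?thesis using threshold_sum[OF b x y] threshold_diff_pos[OF b x y] d by blast
  qed
qed

section \<open>Thresholds in the midpoint configuration\<close>

lemma I_level:
  assumes "r \<in> I" "r = shift s i + t" "s \<in> small" "0 \<le> i" "t \<in> K" shows "shift s i \<in> I"
  using summand[OF assms(1) root_shift[OF smallD(1)[OF assms(3)]] K_levelI[OF assms(3,4)] assms(5,2)] .

lemma I_level0:
  assumes "r \<in> I" "r = s + t" "s \<in> small" "t \<in> K" shows "s \<in> I"
  using I_level[OF assms(1) _ assms(3), of 0 t] assms by simp

lemma small_sum3:
  assumes s: "r \<in> small" "s \<in> small" "t \<in> small" and e: "r + s + t = of_int k *\<^sub>R \<delta>"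
  shows "1 \<le> k"
proof -
  note K = s[THEN smallD(2)]
  have "0 \<le> k" using K_add[OF K_add[OF K(1,2)] K(3)] e delta_nonneg by simp
  moreover have "k \<noteq> 0"
  proof
    assume "k = 0"
    then have "- r = s + t" using e by (simp add: add_eq_0_iff algebra_simps)
    then have "- r \<in> K" using K_add[OF K(2,3)] by simp
    then show False using root_sign smallD s by blast
  qed
  ultimately show ?thesis by simp
qed

text \<open>The triple \<open>r\<close>, \<open>s\<close>, \<open>\<delta> - x\<close> and the
  triple of complements both sum to multiples of \<delta>. That both multiples are positive bounds
  \<open>k\<close> from below and from above.\<close>

lemma small_sum_level:
  assumes s: "r \<in> small" "s \<in> small" "x \<in> small" and e: "r + s = shift x k"
  shows "k = 0 \<or> k = 1"
proof -
  have "r + s + (\<delta> - x) = of_int (k + 1) *\<^sub>R \<delta>" by (simp add: e algebra_simps)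
  then have "1 \<le> k + 1" using small_sum3 s small_compl by blast
  moreover have "(\<delta> - r) + (\<delta> - s) + x = of_int 2 *\<^sub>R \<delta> - (r + s) + x" by (simp add: scaleR_2)
  then have "(\<delta> - r) + (\<delta> - s) + x = of_int (2 - k) *\<^sub>R \<delta>" by (simp only: e) (simp add: algebra_simps)
  then have "1 \<le> 2 - k" using small_sum3 s small_compl by blast
  ultimately show ?thesis by linarith
qed

text \<open>Everything depends on the half of \<open>R'\<close>: in \<open>D\<close> it carries
  \<open>R = y + R'\<close> and then \<open>x\<close> into \<open>D\<close>, and in \<open>A\<close>
  it forces \<open>\<delta> - R\<close> into both halves.\<close>

lemma threshold_half_00:
  assumes b: "closed_split A D" and nx: "threshold A x 0" and ny: "threshold D y 0"
    and R: "R \<in> small" "R' \<in> small" and x: "x = R + R'" and y: "y = R - R'"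
  shows False
proof -
  note K = R[THEN smallD(2)]
  have c: "x \<in> A" "\<delta> - x \<in> A" "y \<in> D" "\<delta> - y \<in> D" using nx ny by (auto simp: threshold_def)
  have xI: "x \<in> I" and y'I: "\<delta> - y \<in> I" using c b closed_split_I by auto
  have RI: "R \<in> I" "R' \<in> I"
    by (rule I_level0[OF xI x R(1) K(2)], rule I_level0[OF xI _ R(2) K(1)]) (simp add: x add.commute)
  have R'A: "R' \<in> A"
  proof (rule ccontr)
    assume "R' \<notin> A"
    then have "R' \<in> D" using RI b closed_split_cases by blast
    then have "R \<in> D"
      by (rule closed_split_sum[OF closed_split_sym[OF b] c(3) _ RI(1)]) (simp add: y)
    then have "x \<in> D" by (rule closed_split_sum[OF closed_split_sym[OF b] _ \<open>R' \<in> D\<close> xI x])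
    then show False using c b closed_split_disj by blast
  qed
  have "\<delta> - R \<in> D"
    by (rule closed_split_diff'[OF closed_split_sym[OF b] c(4) R'A]) (use small_compl[OF R(1)] smallD y in auto)
  moreover have "\<delta> - R \<in> A"
    by (rule closed_split_sum[OF b c(2) R'A]) (use x calculation b closed_split_I in auto)
  ultimately show False using b closed_split_disj by blast
qed

text \<open>\<open>R\<close> is the midpoint of \<open>x\<close> and \<open>y\<close>, both at level
  0 and at level \<open>n - 1\<close>, and lies in \<open>D\<close> at both. Adding
  \<open>\<delta> - y\<close> to \<open>R\<close> gives \<open>R'\<close> at level 1, and this plus
  \<open>R\<close> at level \<open>n - 1\<close> is the threshold root of \<open>A\<close>. The
  digits 0 and 1 in the name are the excess of \<open>R + R'\<close> over \<open>x\<close> and of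
  \<open>R + (\<delta> - R')\<close> over \<open>y\<close>, in multiples of \<delta>.\<close>

lemma threshold_half_n0_01:
  assumes b: "closed_split A D" and nx: "threshold A x n" and ny: "threshold D y 0" and n: "1 \<le> n"
    and R: "R \<in> small" "R' \<in> small" and x: "x = R + R'" and y: "y = R - R'"
  shows False
proof -
  note K = R[THEN smallD(2)] nx[THEN threshold_small, THEN smallD(2)] ny[THEN threshold_small, THEN smallD(3)]
  have xA: "shift x n \<in> A" and xI: "shift x n \<in> I" using threshold_top[OF nx] b closed_split_I by auto
  have yD: "\<delta> - y \<in> D" using threshold_compl[OF ny] .
  have xD: "shift x (n - 1) \<in> D" by (rule threshold_less[OF b nx]) (use n in auto)
  have RI: "shift R (n - 1) \<in> I"
    by (rule I_level[OF xI _ R(1), of _ "shift R' 1"]) (use n x K_levelI[OF R(2), of 1] in \<open>auto simp: algebra_simps\<close>)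
  have R'I: "shift R' 1 \<in> I"
    by (rule I_level[OF xI _ R(2), of _ "shift R (n - 1)"]) (use n x K_levelI[OF R(1), of "n - 1"] in \<open>auto simp: algebra_simps\<close>)
  have yI: "shift y (n - 1) \<in> I"
    by (rule I_level[OF xI _ threshold_small[OF ny], of _ "x + (\<delta> - y)"]) (use n K_add[OF K(3,4)] in \<open>auto simp: algebra_simps\<close>)
  have y2: "shift y (n - 1) \<in> D" using threshold_ge[OF ny _ yI] n by simp
  have R1: "shift R (n - 1) \<in> D"
    by (rule closed_split_avg[OF closed_split_sym[OF b] xD y2 RI]) (simp add: x y algebra_simps)
  have "R \<in> D"
  proof -
    have xD0: "shift x 0 \<in> D" by (rule threshold_less[OF b nx]) (use n in auto)
    have RI: "R \<in> I"
      by (rule I_level0[OF xI _ R(1), of "shift R' n"]) (use n x K_levelI[OF R(2), of n] in \<open>auto simp: algebra_simps\<close>)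
    show ?thesis by (rule closed_split_avg[OF closed_split_sym[OF b] xD0 threshold_top[OF ny] RI]) (simp add: x y)
  qed
  then have R'1: "shift R' 1 \<in> D"
    by (rule closed_split_sum[OF closed_split_sym[OF b] _ yD R'I]) (simp add: y)
  have "shift x n \<in> D" by (rule closed_split_sum[OF closed_split_sym[OF b] R1 R'1 xI]) (simp add: x algebra_simps)
  then show False using xA b closed_split_disj by blast
qed

lemma threshold_half_n0_10:
  assumes b: "closed_split A D" and nx: "threshold A x n" and ny: "threshold D y 0" and n: "1 \<le> n"
    and R: "R \<in> small" "R' \<in> small" and x: "x = R + R' - \<delta>" and y: "y = R + (\<delta> - R')"
  shows False
proof -
  note K = R[THEN smallD(2)] R[THEN smallD(3)] nx[THEN threshold_small, THEN smallD(2)] ny[THEN threshold_small, THEN smallD(3)]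
  have xA: "shift x n \<in> A" and xI: "shift x n \<in> I" using threshold_top[OF nx] b closed_split_I by auto
  have yD: "\<delta> - y \<in> D" "y \<in> D" using threshold_compl[OF ny] threshold_top[OF ny] by auto
  then have yI0: "y \<in> I" using b closed_split_I by blast
  have xD: "shift x (n - 1) \<in> D" by (rule threshold_less[OF b nx]) (use n in auto)
  have xD0: "shift x 0 \<in> D" by (rule threshold_less[OF b nx]) (use n in auto)
  have RI: "shift R (n - 1) \<in> I"
    by (rule I_level[OF xI _ R(1), of _ "R'"]) (use n x K in \<open>auto simp: algebra_simps\<close>)
  have R'I: "R' \<in> I"
    by (rule I_level0[OF xI _ R(2), of "shift R (n - 1)"]) (use n x K_levelI[OF R(1), of "n - 1"] in \<open>auto simp: algebra_simps\<close>)
  have yI: "shift y (n - 1) \<in> I"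
    by (rule I_level[OF xI _ threshold_small[OF ny], of _ "x + (\<delta> - y)"]) (use n K_add[OF K(5,6)] in \<open>auto simp: algebra_simps\<close>)
  have y2: "shift y (n - 1) \<in> D" using threshold_ge[OF ny _ yI] n by simp
  have R1: "shift R (n - 1) \<in> D"
    by (rule closed_split_avg[OF closed_split_sym[OF b] xD y2 RI]) (simp add: x y algebra_simps)
  have "R \<in> I" by (rule I_level0[OF yI0 y R(1) K(4)])
  then have "R \<in> D" by (rule closed_split_avg[OF closed_split_sym[OF b] xD0 yD(2)]) (simp add: x y)
  then have R'1: "R' \<in> D"
    by (rule closed_split_sum[OF closed_split_sym[OF b] _ yD(1) R'I]) (simp add: y)
  have "shift x n \<in> D" by (rule closed_split_sum[OF closed_split_sym[OF b] R1 R'1 xI]) (simp add: x algebra_simps)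
  then show False using xA b closed_split_disj by blast
qed

text \<open>\<open>R\<close> at level \<open>k\<close> is the midpoint of \<open>x\<close> at level
  \<open>n\<close> and \<open>y\<close> at level \<open>m - j\<close>, both in \<open>A\<close>, and
  also of \<open>x\<close> at level \<open>n - j\<close> and \<open>y\<close> at level
  \<open>m\<close>, both in \<open>D\<close>. The parity of \<open>n + m\<close> decides whether
  \<open>j\<close> is 1 or 2.\<close>

lemma threshold_half_nm_mid:
  assumes b: "closed_split A D" and nx: "threshold A x n" and ny: "threshold D y m" and n: "1 \<le> n" "1 \<le> m"
    and R: "R \<in> small" "R' \<in> small" and x: "x = R + R'" and y: "y = R - R'"
    and j: "0 \<le> j" "j \<le> n" "j \<le> m" "2 * k = n + m - j" "j \<in> {1, 2}"
  shows False
proof -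
  note K = R[THEN smallD(2)] R[THEN smallD(3)]
  have xA: "shift x n \<in> A" and xI: "shift x n \<in> I" using threshold_top[OF nx] b closed_split_I by auto
  have yD: "shift y m \<in> D" and yI: "shift y m \<in> I" using threshold_top[OF ny] b closed_split_I by auto
  have xD: "shift x (n - j) \<in> D" by (rule threshold_less[OF b nx]) (use j in auto)
  have yA: "shift y (m - j) \<in> A" by (rule threshold_less[OF closed_split_sym[OF b] ny]) (use j in auto)
  have m: "m = 2 * k + j - n" using j by simp
  have k0: "0 \<le> k" using j n by linarith
  \<comment> \<open>This root lies below the threshold root of \<open>x\<close> or below that of
    \<open>y\<close>, depending on which line reaches high enough.\<close>
  have RI: "shift R k \<in> I"
  proof (cases "k \<le> n")
    case True
    show ?thesis
      by (rule I_level[OF xI _ R(1) k0, of "shift R' (n - k)"])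
        (use True x K_levelI[OF R(2), of "n - k"] in \<open>auto simp: algebra_simps\<close>)
  next
    case False
    then have "0 \<le> m - k - 1" using j by auto
    then show ?thesis
      by (intro I_level[OF yI _ R(1) k0, of "shift (\<delta> - R') (m - k - 1)"])
        (use y K_levelI[OF small_compl[OF R(2)], of "m - k - 1"] in \<open>auto simp: algebra_simps\<close>)
  qed
  have "shift R k \<in> A" by (rule closed_split_avg[OF b xA yA RI]) (simp add: x y m algebra_simps, (simp add: scaleR_left_distrib[symmetric])?)
  moreover have "shift R k \<in> D"
    by (rule closed_split_avg[OF closed_split_sym[OF b] xD yD RI]) (simp add: x y m algebra_simps, (simp add: scaleR_left_distrib[symmetric])?)
  ultimately show False using b closed_split_disj by blast
qed

text \<open>At threshold 1 there is no room for \<open>j = 2\<close> in the midpoint argument.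
  Instead \<open>R\<close> is forced into \<open>A\<close>, as otherwise \<open>D\<close> would
  generate the threshold root of \<open>x\<close>; then \<open>\<delta> - R'\<close> and the
  threshold root of \<open>y\<close> follow it into \<open>A\<close>.\<close>

lemma threshold_half_n1:
  assumes b: "closed_split A D" and nx: "threshold A x n" and ny: "threshold D y 1" and n: "1 \<le> n"
    and R: "R \<in> small" "R' \<in> small" and x: "x = R + R'" and y: "y = R - R'"
  shows False
proof -
  note K = R[THEN smallD(2)] R[THEN smallD(3)] nx[THEN threshold_small, THEN smallD(2)] ny[THEN threshold_small, THEN smallD(3)]
  have xA: "shift x n \<in> A" and xI: "shift x n \<in> I" using threshold_top[OF nx] b closed_split_I by auto
  have yD: "shift y 1 \<in> D" and yI: "shift y 1 \<in> I" using threshold_top[OF ny] b closed_split_I by auto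
  have xD: "shift x (n - 1) \<in> D" by (rule threshold_less[OF b nx]) (use n in auto)
  have RI: "shift R (n - 1) \<in> I"
    by (rule I_level[OF xI _ R(1), of _ "shift R' 1"]) (use n x K_levelI[OF R(2), of 1] in \<open>auto simp: algebra_simps\<close>)
  have R0I: "R \<in> I"
    by (rule I_level0[OF xI _ R(1), of "shift R' n"]) (use n x K_levelI[OF R(2), of n] in \<open>auto simp: algebra_simps\<close>)
  have R'I: "shift R' 1 \<in> I"
    by (rule I_level[OF xI _ R(2), of _ "shift R (n - 1)"]) (use n x K_levelI[OF R(1), of "n - 1"] in \<open>auto simp: algebra_simps\<close>)
  have R''I: "\<delta> - R' \<in> I"
    by (rule I_level0[OF yI _ small_compl[OF R(2)], of R]) (use y K in \<open>auto simp: algebra_simps\<close>)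
  have "R \<in> A"
  proof (rule ccontr)
    assume "R \<notin> A"
    then have RD: "R \<in> D" using R0I b closed_split_cases by blast
    have R'1: "shift R' 1 \<in> D"
      by (rule closed_split_sum[OF closed_split_sym[OF b] RD threshold_compl[OF ny] R'I]) (simp add: y)
    have R1: "shift R (n - 1) \<in> D"
    proof (cases "n = 1")
      case True then show ?thesis using RD by simp
    next
      case False
      have yI: "shift y (n - 1) \<in> I"
        by (rule I_level[OF xI _ threshold_small[OF ny], of _ "x + (\<delta> - y)"])
          (use n K_add[OF K(5,6)] in \<open>auto simp: algebra_simps\<close>)
      have y2: "shift y (n - 1) \<in> D" by (rule threshold_ge[OF ny _ yI]) (use n False in auto)
      show ?thesis by (rule closed_split_avg[OF closed_split_sym[OF b] xD y2 RI]) (simp add: x y algebra_simps)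
    qed
    have "shift x n \<in> D" by (rule closed_split_sum[OF closed_split_sym[OF b] R1 R'1 xI]) (simp add: x algebra_simps)
    then show False using xA b closed_split_disj by blast
  qed
  have "\<delta> - R' \<in> A"
    by (rule closed_split_sum[OF b threshold_compl[OF nx] \<open>R \<in> A\<close> R''I]) (simp add: x)
  then have "shift y 1 \<in> A"
    by (rule closed_split_sum[OF b \<open>R \<in> A\<close> _ yI]) (simp add: y algebra_simps)
  then show False using yD b closed_split_disj by blast
qed

text \<open>Both lines have a root of \<open>A\<close> at level \<open>m - 1\<close>, which puts
  \<open>R\<close> at this level into \<open>A\<close>. Subtraction then puts
  \<open>\<delta> - R'\<close> and \<open>R\<close> into \<open>D\<close>, and these generate the
  threshold root of \<open>x\<close>.\<close>

lemma threshold_half_1m: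
  assumes b: "closed_split A D" and nx: "threshold A x 1" and ny: "threshold D y m" and m: "2 \<le> m"
    and R: "R \<in> small" "R' \<in> small" and x: "x = R + R'" and y: "y = R - R'"
  shows False
proof -
  note K = R[THEN smallD(2)] R[THEN smallD(3)] nx[THEN threshold_small, THEN smallD(3)] ny[THEN threshold_small, THEN smallD(2)]
  have xA: "shift x 1 \<in> A" and xI: "shift x 1 \<in> I" using threshold_top[OF nx] b closed_split_I by auto
  have yD: "shift y m \<in> D" and yI: "shift y m \<in> I" using threshold_top[OF ny] b closed_split_I by auto
  have yA: "shift y (m - 1) \<in> A" by (rule threshold_less[OF closed_split_sym[OF b] ny]) (use m in auto)
  have xI': "shift x (m - 1) \<in> I"
    by (rule I_level[OF yI _ threshold_small[OF nx], of _ "y + (\<delta> - x)"])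
      (use m K_add[OF K(6,5)] in \<open>auto simp: algebra_simps\<close>)
  have xA': "shift x (m - 1) \<in> A" by (rule threshold_ge[OF nx _ xI']) (use m in auto)
  have RI: "shift R (m - 1) \<in> I"
    by (rule I_level[OF yI _ R(1), of _ "\<delta> - R'"]) (use m y K in \<open>auto simp: algebra_simps\<close>)
  have R0I: "R \<in> I"
    by (rule I_level0[OF xI _ R(1), of "shift R' 1"]) (use x K_levelI[OF R(2), of 1] in \<open>auto simp: algebra_simps\<close>)
  have R'I: "shift R' 1 \<in> I"
    by (rule I_level[OF xI _ R(2), of _ R]) (use x K in \<open>auto simp: algebra_simps\<close>)
  have R''I: "\<delta> - R' \<in> I"
    by (rule I_level0[OF yI _ small_compl[OF R(2)], of "shift R (m - 1)"])
      (use m y K_levelI[OF R(1), of "m - 1"] in \<open>auto simp: algebra_simps\<close>)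
  have RA: "shift R (m - 1) \<in> A" by (rule closed_split_avg[OF b xA' yA RI]) (simp add: x y algebra_simps)
  have R''D: "\<delta> - R' \<in> D"
    by (rule closed_split_diff[OF closed_split_sym[OF b] yD RA]) (use y small_compl[OF R(2)] smallD in \<open>auto simp: algebra_simps\<close>)
  have "R \<in> D"
    by (rule closed_split_diff[OF closed_split_sym[OF b] R''D threshold_compl[OF nx]]) (use x R smallD in \<open>auto simp: algebra_simps\<close>)
  then have R'D: "shift R' 1 \<in> D"
    by (rule closed_split_sum[OF closed_split_sym[OF b] _ threshold_compl[OF ny] R'I]) (simp add: y)
  have "shift x 1 \<in> D" by (rule closed_split_sum[OF closed_split_sym[OF b] \<open>R \<in> D\<close> R'D xI]) (simp add: x)
  then show False using xA b closed_split_disj by blast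
qed

lemma threshold_half_nm_01:
  assumes b: "closed_split A D" and nx: "threshold A x n" and ny: "threshold D y m" and n: "1 \<le> n" "1 \<le> m"
    and R: "R \<in> small" "R' \<in> small" and x: "x = R + R'" and y: "y = R - R'"
  shows False
proof -
  consider "m = 1" | "n = 1" "2 \<le> m" | "2 \<le> n" "2 \<le> m" using n by linarith
  then show ?thesis
  proof cases
    case 1 then show ?thesis using threshold_half_n1 assms by blast
  next
    case 2 then show ?thesis using threshold_half_1m assms by blast
  next
    case 3
    have "\<exists>j k. j \<in> {1, 2} \<and> 2 * k = n + m - j"
    proof (cases "even (n + m)")
      case True
      then have "2 * ((n + m) div 2 - 1) = n + m - 2" by auto
      then show ?thesis by blast
    next
      case False
      then have "2 * ((n + m) div 2) = n + m - 1" by presburger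
      then show ?thesis by blast
    qed
    then obtain j k where j: "j \<in> {1, 2}" "2 * k = n + m - j" by blast
    with 3 have "0 \<le> j" "j \<le> n" "j \<le> m" by auto
    then show ?thesis using threshold_half_nm_mid[OF b nx ny n R x y _ _ _ j(2) j(1)] by blast
  qed
qed

text \<open>At level \<open>n - 1\<close>, \<open>R'\<close> is the midpoint of \<open>x\<close> and
  \<open>\<delta> - y\<close>, both in \<open>D\<close>; subtracting it from the threshold root of
  \<open>x\<close> leaves a translate of \<open>R\<close>. This translate depends only on
  \<open>a\<close>, so the argument with exchanged halves places it in \<open>D\<close> as
  well.\<close>

lemma threshold_half_nm_eq_aux:
  assumes b: "closed_split A D" and nx: "threshold A x n" and ny: "threshold D y m" and n: "1 \<le> n"
    and R: "R \<in> small" "R' \<in> small" and a: "a = 0 \<or> a = 1"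
    and x: "R + R' = shift x a" and y: "R + (\<delta> - R') = shift y a"
  shows "shift R (1 - a) \<in> A"
proof -
  note K = R[THEN smallD(2)] R[THEN smallD(3)] nx[THEN threshold_small, THEN smallD(2)] ny[THEN threshold_small, THEN smallD(2)]
  have x': "x = R + R' - of_int a *\<^sub>R \<delta>" and y': "y = R + (\<delta> - R') - of_int a *\<^sub>R \<delta>" using x y by simp_all
  have xA: "shift x n \<in> A" and xI: "shift x n \<in> I" using threshold_top[OF nx] b closed_split_I by auto
  have xD: "shift x (n - 1) \<in> D" by (rule threshold_less[OF b nx]) (use n in auto)
  have yI: "shift (\<delta> - y) (n - 1) \<in> I"
    by (rule I_level[OF xI _ small_compl[OF threshold_small[OF ny]], of _ "x + y"])
      (use n K_add[OF K(5,6)] in \<open>auto simp: algebra_simps\<close>)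
  have yD: "shift (\<delta> - y) (n - 1) \<in> D" by (rule threshold_compl_ge[OF ny yI])
  have R'I: "shift R' (n - 1) \<in> I"
    by (rule I_level[OF xI _ R(2), of _ "shift R (1 - a)"])
      (use n a x' K_levelI[OF R(1), of "1 - a"] in \<open>auto simp: algebra_simps\<close>)
  have R'D: "shift R' (n - 1) \<in> D" by (rule closed_split_avg[OF closed_split_sym[OF b] xD yD R'I]) (simp add: x' y' algebra_simps)
  show ?thesis
    by (rule closed_split_diff'[OF b xA R'D])
      (use a x' R smallD(1) root_shift[of R "1 - a"] K_levelI[OF R(1), of "1 - a"] in \<open>auto simp: algebra_simps\<close>)
qed

lemma threshold_half_nm_eq:
  assumes b: "closed_split A D" and nx: "threshold A x n" and ny: "threshold D y m" and n: "1 \<le> n" "1 \<le> m"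
    and R: "R \<in> small" "R' \<in> small" and a: "a = 0 \<or> a = 1"
    and x: "R + R' = shift x a" and y: "R + (\<delta> - R') = shift y a"
  shows False
proof -
  have "shift R (1 - a) \<in> D"
    by (rule threshold_half_nm_eq_aux[OF closed_split_sym[OF b] ny nx n(2) R(1) small_compl[OF R(2)] a y]) (simp add: x)
  then show False using threshold_half_nm_eq_aux[OF b nx ny n(1) R a x y] b closed_split_disj by blast
qed

lemma threshold_half_n0:
  assumes b: "closed_split A D" and nx: "threshold A x n" and ny: "threshold D y 0" and n: "1 \<le> n"
    and R: "R \<in> small" "R' \<in> small"
    and x: "R + R' = shift x a" and y: "R + (\<delta> - R') = shift y c" and ac: "a = 0 \<or> a = 1" "c = 0 \<or> c = 1"
  shows False
proof -
  have main: False if "threshold D y 0" "R \<in> small" "R' \<in> small" "R + R' = shift x a" "R + (\<delta> - R') = shift y (1 - a)" for y R R'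
  proof (cases "a = 0")
    case True
    then have "x = R + R'" "y = R - R'" using that by (simp_all add: algebra_simps)
    then show False using threshold_half_n0_01[OF b nx] that n by blast
  next
    case False
    then have "a = 1" using ac by simp
    then have "x = R + R' - \<delta>" "y = R + (\<delta> - R')" using that by simp_all
    then show False using threshold_half_n0_10[OF b nx] that n by blast
  qed
  show False
  proof (cases "c = 1 - a")
    case True then show False using main ny R x y by blast
  next
    case False
    then have c: "c = a" using ac by auto
    \<comment> \<open>Replacing \<open>y\<close> by its complement and exchanging \<open>R\<close>
      with \<open>R'\<close> changes the level \<open>c = a\<close> into
      \<open>1 - a\<close>.\<close>
    have y': "y = R + (\<delta> - R') - of_int a *\<^sub>R \<delta>" using y c by simp
    show False
      by (rule main[OF threshold_zero_flip[OF ny] R(2,1)]) (use x in \<open>simp_all add: y' algebra_simps\<close>)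
  qed
qed

lemma threshold_half_00_all:
  assumes b: "closed_split A D" and nx: "threshold A x 0" and ny: "threshold D y 0"
    and R: "R \<in> small" "R' \<in> small"
    and x: "R + R' = shift x a" and y: "R + (\<delta> - R') = shift y c" and ac: "a = 0 \<or> a = 1" "c = 0 \<or> c = 1"
  shows False
proof -
  have m1: False if "threshold A x 0" "threshold D y 0" "R \<in> small" "R' \<in> small" "R + R' = shift x 0" "R + (\<delta> - R') = shift y 1" for x y R R'
    by (rule threshold_half_00[OF b that(1-4)]) (use that(5,6) in \<open>simp_all add: algebra_simps\<close>)
  have m2: False if h: "threshold A x 0" "threshold D y 0" "R \<in> small" "R' \<in> small" "R + R' = shift x 0" "R + (\<delta> - R') = shift y c" "c = 0 \<or> c = 1" for x y R R' c
  proof (cases "c = 1")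
    case True then show False using m1 h by blast
  next
    case False
    then have "c = 0" using h by simp
    then have y': "y = R + (\<delta> - R')" using h by simp
    show False
      by (rule m1[OF h(1) threshold_zero_flip[OF h(2)] h(4,3)]) (use h(5) in \<open>simp_all add: y' algebra_simps\<close>)
  qed
  show False
  proof (cases "a = 0")
    case True then show False using m2[OF nx ny R] x y ac by blast
  next
    case False
    then have x': "x = R + R' - \<delta>" using x ac by auto
    show False
      by (rule m2[OF threshold_zero_flip[OF nx] ny small_compl[OF R(2)] small_compl[OF R(1)], of c])
        (use y ac(2) in \<open>simp_all add: x' algebra_simps\<close>)
  qed
qed

text \<open>\<open>small_sum_level\<close> leaves four alignments. For positive thresholds, the
  alignment \<open>a = 1\<close>, \<open>c = 0\<close> becomes \<open>a = 0\<close>,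
  \<open>c = 1\<close> when the halves are exchanged and \<open>R'\<close> is replaced by its
  complement.\<close>

lemma threshold_no_half:
  assumes b: "closed_split A D" and nx: "threshold A x n" and ny: "threshold D y m"
    and R: "R \<in> small" "R' \<in> small"
    and x: "R + R' = shift x a" and y: "R + (\<delta> - R') = shift y c"
  shows False
proof -
  have ac: "a = 0 \<or> a = 1" "c = 0 \<or> c = 1"
    using small_sum_level[OF R threshold_small[OF nx] x] small_sum_level[OF R(1) small_compl[OF R(2)] threshold_small[OF ny] y] .
  consider "n = 0" "m = 0" | "n = 0" "1 \<le> m" | "1 \<le> n" "m = 0" | "1 \<le> n" "1 \<le> m"
    using threshold_n_nonneg[OF nx] threshold_n_nonneg[OF ny] by linarith
  then show ?thesis
  proof cases
    case 1
    then show ?thesis using threshold_half_00_all[OF b _ _ R x y ac] nx ny by blast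
  next
    case 2
    have "R + (\<delta> - (\<delta> - R')) = shift x a" using x by simp
    then show ?thesis
      using threshold_half_n0[OF closed_split_sym[OF b] ny _ 2(2) R(1) small_compl[OF R(2)] y _ ac(2,1)] nx 2 by blast
  next
    case 3
    then show ?thesis using threshold_half_n0[OF b nx _ _ R x y ac] ny by blast
  next
    case 4
    consider "a = c" | "a = 0" "c = 1" | "a = 1" "c = 0" using ac by auto
    then show ?thesis
    proof cases
      case 1 then show ?thesis using threshold_half_nm_eq[OF b nx ny 4 R ac(1) x] y by blast
    next
      case 2
      then have "x = R + R'" "y = R - R'" using x y by (simp_all add: algebra_simps)
      then show ?thesis using threshold_half_nm_01[OF b nx ny 4 R] by blast
    next
      case 3
      then have "y = R + (\<delta> - R')" "x = R - (\<delta> - R')" using x y by (simp_all add: algebra_simps)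
      then show ?thesis
        using threshold_half_nm_01[OF closed_split_sym[OF b] ny nx 4(2,1) R(1) small_compl[OF R(2)]] by blast
    qed
  qed
qed

end

section \<open>Descent in affine systems of rank three\<close>

text \<open>In \<open>\<Lambda>\<close> null vectors are integral, not just real, multiples of
  \<delta>. The assumptions \<open>root_perp\<close> and \<open>root_pair\<close> express that the
  system has rank two modulo \<delta>.\<close>

locale affine_plane = affine_roots +
  fixes f :: "'a \<Rightarrow> 'a \<Rightarrow> real" and \<Lambda> :: "'a set"
  assumes f_bilinear: "bilinear f"
    and f_sym: "f x y = f y x"
    and f_delta: "f \<delta> x = 0"
    and lat_add: "x \<in> \<Lambda> \<Longrightarrow> y \<in> \<Lambda> \<Longrightarrow> x + y \<in> \<Lambda>"
    and lat_roots: "\<Phi> \<subseteq> \<Lambda>"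
    and lat_delta: "of_int k *\<^sub>R \<delta> \<in> \<Lambda>"
    and f_root: "r \<in> \<Phi> \<Longrightarrow> 0 < f r r"
    and f_null: "x \<in> \<Lambda> \<Longrightarrow> f x x \<le> 0 \<Longrightarrow> \<exists>k::int. x = of_int k *\<^sub>R \<delta>"
    and root_diff: "r \<in> \<Phi> \<Longrightarrow> s \<in> \<Phi> \<Longrightarrow> 0 < f r s \<Longrightarrow> r - s \<in> \<Phi> \<or> (\<exists>k::int. r - s = of_int k *\<^sub>R \<delta>)"
    and root_perp: "p \<in> \<Phi> \<Longrightarrow> p' \<in> \<Phi> \<Longrightarrow> q \<in> \<Phi> \<Longrightarrow> f p q = 0 \<Longrightarrow> f p' q = 0 \<Longrightarrow>
      \<exists>k::int. p - p' = of_int k *\<^sub>R \<delta> \<or> p + p' = of_int k *\<^sub>R \<delta>"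
    and root_pair: "x \<in> \<Phi> \<Longrightarrow> y \<in> \<Phi> \<Longrightarrow>
      (\<exists>k::int. x - y = of_int k *\<^sub>R \<delta> \<or> x + y = of_int k *\<^sub>R \<delta>) \<or> x - y \<in> \<Phi> \<or> x + y \<in> \<Phi> \<or>
      (\<exists>r\<in>\<Phi>. \<exists>s\<in>\<Phi>. \<exists>a c::int. r + s = x + of_int a *\<^sub>R \<delta> \<and> r - s = y + of_int c *\<^sub>R \<delta>)"
begin

lemma has_opposites_exclusive:
  assumes b: "closed_split A D" and "has_opposites A" "has_opposites D" shows False
proof -
  obtain x n where x: "threshold A x n" using opposites_threshold[OF b \<open>has_opposites A\<close>] .
  obtain y m where y: "threshold D y m" using opposites_threshold[OF closed_split_sym[OF b] \<open>has_opposites D\<close>] .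
  note s = threshold_small[OF x] threshold_small[OF y]
  from root_pair[OF smallD(1)[OF s(1)] smallD(1)[OF s(2)]] consider
      k where "x - y = of_int k *\<^sub>R \<delta>" | k where "x + y = of_int k *\<^sub>R \<delta>" | "x - y \<in> \<Phi> \<or> x + y \<in> \<Phi>"
    | r s' a c where "r \<in> \<Phi>" "s' \<in> \<Phi>" "r + s' = shift x a" "r - s' = shift y c"
    by blast
  then show False
  proof cases
    case (1 k)
    then have e: "x = shift y k" by (simp add: algebra_simps)
    then have "k = 0" using small_unique s by blast
    then have "x = y" using e by simp
    then show False using threshold_compl[OF x] threshold_compl[OF y] b closed_split_disj by blast
  next
    case (2 k)
    then have e: "x = shift (\<delta> - y) (k - 1)" by (simp add: algebra_simps)
    then have "k - 1 = 0" using small_unique[OF s(1) small_compl[OF s(2)]] by blast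
    then have "x = \<delta> - y" using e by simp
    then have "shift (\<delta> - y) n \<in> A" using threshold_top[OF x] by simp
    then show False using threshold_compl_ge[OF y, of n] b closed_split_disj closed_split_I by blast
  next
    case 3 then show False using threshold_no_root[OF b x y] by blast
  next
    case (4 r s' a c)
    obtain R i where R: "R \<in> small" "r = shift R i" using root_small 4 by blast
    obtain R' j where R': "R' \<in> small" "s' = shift R' j" using root_small 4 by blast
    have "R + R' = (r + s') - of_int (i + j) *\<^sub>R \<delta>" by (simp add: R R' algebra_simps)
    also have "\<dots> = shift x (a - i - j)" by (simp only: 4) (simp add: algebra_simps)
    finally have 1: "R + R' = shift x (a - i - j)" .
    have "R + (\<delta> - R') = (r - s') + of_int (1 - i + j) *\<^sub>R \<delta>" by (simp add: R R' algebra_simps)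
    also have "\<dots> = shift y (c + 1 - i + j)" by (simp only: 4) (simp add: algebra_simps)
    finally show False using threshold_no_half[OF b x y R(1) R'(1) 1] by blast
  qed
qed

section \<open>Descent modulo \<delta>\<close>

lemma f_add: "f (x + y) z = f x z + f y z" "f z (x + y) = f z x + f z y"
  using f_bilinear bilinear_ladd bilinear_radd by blast+

lemma f_imag: "f (of_int k *\<^sub>R \<delta>) x = 0" "f x (of_int k *\<^sub>R \<delta>) = 0"
proof -
  show "f (of_int k *\<^sub>R \<delta>) x = 0" using bilinear_lmul[OF f_bilinear] f_delta by simp
  then show "f x (of_int k *\<^sub>R \<delta>) = 0" using f_sym by metis
qed

lemma f_minus: "f x (- y) = - f x y"
  using bilinear_rneg[OF f_bilinear] .

lemma sum_mset_pos:
  assumes "set_mset M \<subseteq> {x \<in> K. - x \<notin> K}" "M \<noteq> {#}"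
  shows "sum_mset M \<in> K" "sum_mset M \<noteq> 0"
proof -
  have 0: "0 \<in> K" using delta_ge[of 0] by simp
  have K: "sum_mset N \<in> K" if "set_mset N \<subseteq> K" for N
    using sum_mset_mem[OF 0] K_add that by blast
  show "sum_mset M \<in> K" using K assms by auto
  obtain x N where M: "M = add_mset x N" using assms multiset_cases by blast
  then have "sum_mset N \<in> K" "- x \<notin> K" using K assms by auto
  then show "sum_mset M \<noteq> 0" using M by (auto simp: add_eq_0_iff)
qed

lemma I_pointed: "I \<subseteq> {x \<in> K. - x \<notin> K}"
  using I_roots root_sign by blast

lemma imag_pos:
  assumes "set_mset M \<subseteq> I" "M \<noteq> {#}" "sum_mset M = of_int k *\<^sub>R \<delta>" shows "0 < k"
proof -
  have "0 \<le> k" using sum_mset_pos(1)[of M] I_pointed assms delta_nonneg by auto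
  moreover have "k \<noteq> 0" using sum_mset_pos(2)[of M] I_pointed assms by auto
  ultimately show ?thesis by simp
qed

text \<open>The product of the common sum with itself, expanded over the two multisets, has only
  nonpositive terms, so this sum is a null vector.\<close>

lemma stuck_imaginary:
  assumes le: "\<forall>p\<in>#M. \<forall>q\<in>#N. f p q \<le> 0" and e: "sum_mset M = sum_mset N"
    and S: "set_mset N \<subseteq> \<Lambda>"
  shows "\<exists>k::int. sum_mset N = of_int k *\<^sub>R \<delta>"
proof (rule f_null)
  have "0 \<in> \<Lambda>" using lat_delta[of 0] by simp
  then show "sum_mset N \<in> \<Lambda>" using sum_mset_mem[of \<Lambda> N] lat_add S by blast
  have "f p (sum_mset N) \<le> 0" if "p \<in># M" for p
    by (rule additive_sum_mset_nonpos) (use f_add le that in auto)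
  then have "f (sum_mset M) (sum_mset N) \<le> 0"
    using additive_sum_mset_nonpos[of "\<lambda>x. f x (sum_mset N)" M] f_add by simp
  then show "f (sum_mset N) (sum_mset N) \<le> 0" using e by simp
qed

text \<open>\<open>\<delta> - x\<close> lies below \<open>q\<close>, the remainder being twice
  \<open>x\<close> plus a nonnegative multiple of \<delta>. In \<open>A\<close> it would carry
  \<open>q\<close> into \<open>A\<close> by \<open>opposite_upward\<close>; so it is in
  \<open>D\<close>, opposite to \<open>q\<close>.\<close>

lemma mixed_line_has_opposites:
  assumes b: "closed_split A D" and p: "p \<in> A" and q: "q \<in> D" and e: "q = shift p j" and j: "1 \<le> j"
  shows "has_opposites D"
proof -
  have pI: "p \<in> I" and qI: "q \<in> I" using b p q closed_split_I by auto
  obtain x u where x: "x \<in> small" "0 \<le> u" "p = shift x u" using pos_root_small I_D[OF pI] by metis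
  have q': "q = shift x (u + j)" using e x by (simp add: algebra_simps)
  have x'I: "\<delta> - x \<in> I"
  proof (rule I_ideal[OF qI])
    show "\<delta> - x \<in> \<Phi>" "\<delta> - x \<in> K" using small_compl[OF x(1)] smallD by auto
    have "x + x \<in> K" using K_add smallD(2)[OF x(1)] by blast
    then have "(x + x) + of_int (u + j - 1) *\<^sub>R \<delta> \<in> K" using K_add delta_ge[of "u + j - 1"] x(2) j by simp
    then show "q - (\<delta> - x) \<in> K" by (simp add: q' algebra_simps)
  qed
  have "\<delta> - x \<in> D"
  proof (rule ccontr)
    assume "\<delta> - x \<notin> D"
    then have "shift (\<delta> - x) 0 \<in> A" using x'I b closed_split_cases by auto
    then have "q \<in> A" using opposite_upward[OF b, of x u 0 "u + j"] p x j qI q' by simp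
    then show False using q b closed_split_disj by blast
  qed
  moreover have "q + (\<delta> - x) = of_int (u + j + 1) *\<^sub>R \<delta>" by (simp add: q' algebra_simps)
  ultimately show ?thesis using q unfolding has_opposites_def by blast
qed

lemma closed_split_split:
  assumes b: "closed_split A D" and p: "p \<in> A" and q: "q \<in> D" and r: "p - q \<in> \<Phi>"
  shows "p - q \<in> A \<or> q - p \<in> D"
proof (cases "p - q \<in> K")
  case True
  have "p - q \<in> A" by (rule closed_split_diff[OF b p q r True]) simp
  then show ?thesis ..
next
  case False
  then have "q - p \<in> K" using root_sign[OF r] by simp
  have "q - p \<in> D" by (rule closed_split_diff[OF closed_split_sym[OF b] q p root_diff_swap[OF r] \<open>q - p \<in> K\<close>]) simp
  then show ?thesis ..
qed

lemma imaginary_relation: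
  assumes b: "closed_split A D" and no: "\<not> has_opposites D" and M: "set_mset M \<subseteq> A" and N: "set_mset N \<subseteq> D"
    and e: "sum_mset M = sum_mset N" "M \<noteq> {#} \<or> N \<noteq> {#}"
  shows "\<exists>N'. set_mset N' \<subseteq> D \<and> N' \<noteq> {#} \<and> (\<exists>k::int. sum_mset N' = of_int k *\<^sub>R \<delta>)"
proof -
  \<comment> \<open>As no two elements of D are opposite modulo \<delta>, the positive multiples of \<delta> may be put on the side of A.\<close>
  define E where "E = {of_int k *\<^sub>R \<delta> | k::int. 1 \<le> k}"
  have "\<exists>M' N'. set_mset M' \<subseteq> A \<union> E \<and> set_mset N' \<subseteq> D \<and> sum_mset M' = sum_mset N' \<and>
    (M' \<noteq> {#} \<or> N' \<noteq> {#}) \<and> (\<forall>p\<in>#M'. \<forall>q\<in>#N'. f p q \<le> 0)"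
  proof (rule relation_descent[OF _ _ N e])
    show "set_mset M \<subseteq> A \<union> E" using M by blast
    fix p q assume p: "p \<in> A \<union> E" and q: "q \<in> D" and pq: "0 < f p q"
    \<comment> \<open>Elements of \<open>E\<close> have product 0 with everything, so the descent
      never selects them.\<close>
    have pA: "p \<in> A" using p pq f_imag by (auto simp: E_def)
    have "p \<in> \<Phi>" "q \<in> \<Phi>" using pA q b closed_split_I I_D by blast+
    then consider "p - q \<in> \<Phi>" | k where "p - q = of_int k *\<^sub>R \<delta>" using root_diff pq by blast
    then show "p - q \<in> A \<union> E \<or> q - p \<in> D"
    proof cases
      case 1
      then show ?thesis using closed_split_split[OF b pA q] by blast
    next
      case (2 k)
      consider "1 \<le> k" | "k = 0" | "1 \<le> - k" by linarith
      then show ?thesis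
      proof cases
        case 1 then show ?thesis using 2 by (auto simp: E_def)
      next
        case zero: 2
        then have "p = q" using 2 by simp
        then show ?thesis using pA q b closed_split_disj by blast
      next
        \<comment> \<open>Here the multiple of \<delta> would belong on the side of
          \<open>D\<close>; but then \<open>D\<close> contains the higher of two roots on a line,
          and hence opposites.\<close>
        case 3
        have "q = shift p (- k)" using 2 by (simp add: algebra_simps)
        then show ?thesis using mixed_line_has_opposites[OF b pA q _ 3] no by blast
      qed
    qed
  qed
  then obtain M' N' where *: "set_mset M' \<subseteq> A \<union> E" "set_mset N' \<subseteq> D" "sum_mset M' = sum_mset N'"
    "M' \<noteq> {#} \<or> N' \<noteq> {#}" "\<forall>p\<in>#M'. \<forall>q\<in>#N'. f p q \<le> 0" by blast
  have "E \<subseteq> {x \<in> K. - x \<notin> K}"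
  proof -
    have "- (of_int k *\<^sub>R \<delta>) \<notin> K" if "1 \<le> k" for k
      using delta_nonneg[of "- k"] that by auto
    then show ?thesis using delta_ge by (auto simp: E_def)
  qed
  then have "set_mset M' \<subseteq> {x \<in> K. - x \<notin> K}" using * I_pointed b by (auto simp: closed_split_def)
  then have "N' \<noteq> {#}" using * sum_mset_pos(2)[of M'] by auto
  moreover have "set_mset N' \<subseteq> \<Lambda>" using * b closed_split_I I_D lat_roots by blast
  ultimately show ?thesis using stuck_imaginary[OF *(5,3)] *(2) by blast
qed

text \<open>In an irreducible relation no two members can be merged, modulo \<delta>, into an
  element of \<open>D\<close>. Each member has a negative product with another one, their sum is a
  root outside \<open>I\<close>, and \<open>key\<close> forces both to be small. This sum is also
  small, which gives the last conjunct; it is used to bound the roots on the other side.\<close>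

lemma small_imaginary:
  assumes b: "closed_split A D" and no: "\<not> has_opposites D" and "set_mset N \<subseteq> D" "N \<noteq> {#}" "sum_mset N = of_int k *\<^sub>R \<delta>"
  shows "\<exists>N'. set_mset N' \<subseteq> D \<inter> small \<and> N' \<noteq> {#} \<and> (\<exists>k::int. sum_mset N' = of_int k *\<^sub>R \<delta>) \<and> \<not> small \<subseteq> I"
  using assms(3-)
proof (induction "size N" arbitrary: N k rule: less_induct)
  case less
  note N = less.prems
  show ?case
  proof (cases "\<exists>p q N0 h. \<exists>j::int. N = add_mset p (add_mset q N0) \<and> h \<in> D \<and> p + q = shift h j")
    case True
    then obtain p q N0 h and j :: int where h: "N = add_mset p (add_mset q N0)" "h \<in> D" "p + q = shift h j"
      by blast
    have "sum_mset (add_mset h N0) = sum_mset N - of_int j *\<^sub>R \<delta>"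
      using h(1,3) by (simp add: algebra_simps)
    also have "\<dots> = of_int (k - j) *\<^sub>R \<delta>" by (simp add: N algebra_simps)
    finally have e: "sum_mset (add_mset h N0) = of_int (k - j) *\<^sub>R \<delta>" .
    show ?thesis by (rule less.hyps[OF _ _ _ e]) (use N h in auto)
  next
    case irreducible: False
    have *: "p \<in> small \<and> \<not> small \<subseteq> I" if p: "p \<in># N" for p
    proof -
      obtain N1 where N1: "N = add_mset p N1" using p multi_member_split by metis
      have pD: "p \<in> D" and pI: "p \<in> I" and pR: "p \<in> \<Phi>" using p N b closed_split_I I_D by blast+
      have "\<exists>q\<in>#N1. f p q < 0"
      proof (rule ccontr)
        assume "\<not> ?thesis"
        then have "f p q \<ge> 0" if "q \<in># N1" for q using that by force
        then have "- f p (sum_mset N1) \<le> 0"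
          by (intro additive_sum_mset_nonpos[of "\<lambda>x. - f p x"]) (auto simp: f_add)
        moreover have "f p p + f p (sum_mset N1) = 0"
          using f_imag(2)[of p k] N(3) by (simp add: N1 f_add[symmetric])
        ultimately show False using f_root[OF pR] by simp
      qed
      then obtain q N0 where q: "N1 = add_mset q N0" "f p q < 0" using multi_member_split by metis
      then have qN: "q \<in># N" and NN: "N = add_mset p (add_mset q N0)" using N1 by auto
      have qD: "q \<in> D" and qI: "q \<in> I" and qR: "q \<in> \<Phi>" using qN N b closed_split_I I_D by blast+
      have notimag: "p + q \<noteq> of_int l *\<^sub>R \<delta>" for l using no pD qD by (auto simp: has_opposites_def)
      have h: "p + q \<in> \<Phi>" using root_diff[OF pR root_uminus[OF qR]] q(2) f_minus notimag by auto
      have hK: "p + q \<in> K" using K_add I_D pI qI by blast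
      have hI: "p + q \<notin> I"
      proof
        assume "p + q \<in> I"
        then have "p + q \<in> D" using closed_split_sum[OF closed_split_sym[OF b] pD qD] by blast
        then show False using irreducible NN by (metis add.right_neutral of_int_0 scaleR_zero_left)
      qed
      obtain z l where z: "z \<in> small" "0 \<le> l" "p + q = shift z l" using pos_root_small h hK by metis
      obtain x i where x: "x \<in> small" "0 \<le> i" "p = shift x i" using pos_root_small pR I_D pI by metis
      obtain y j where y: "y \<in> small" "0 \<le> j" "q = shift y j" using pos_root_small qR I_D qI by metis
      \<comment> \<open>\<open>p - z\<close> is opposite to \<open>q\<close> modulo \<delta>, hence
        in \<open>A\<close>; subtracting it from \<open>p\<close> puts \<open>z\<close> into
        \<open>D\<close>, so \<open>p\<close> and \<open>q\<close> could have been merged.\<close>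
      have key: False if pD: "p \<in> D" and qD: "q \<in> D" and zK: "p - z \<in> K" and e: "p + q = shift z l"
        and NN: "N = add_mset p (add_mset q N0)" for p q
      proof -
        have pI: "p \<in> I" and qR: "q \<in> \<Phi>" using pD qD b closed_split_I I_D by blast+
        have pz: "p - z = - shift q (- l)" using e by (simp add: algebra_simps add_eq_0_iff eq_diff_eq)
        then have zR: "p - z \<in> \<Phi>" using root_uminus root_shift qR by metis
        have "p - z \<in> I" by (rule I_ideal[OF pI zR zK]) (use z smallD in auto)
        moreover have "(p - z) + q = of_int l *\<^sub>R \<delta>" by (simp add: pz)
        ultimately have pzA: "p - z \<in> A" using no qD b closed_split_cases by (auto simp: has_opposites_def)
        have "z \<in> D" by (rule closed_split_diff[OF closed_split_sym[OF b] pD pzA]) (use z smallD in auto)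
        then show False using irreducible NN e by blast
      qed
      have big: "shift x i - z \<in> K" if "x \<in> small" "1 \<le> i" for x i
      proof -
        have "(x + (\<delta> - z)) + of_int (i - 1) *\<^sub>R \<delta> \<in> K"
          using K_add[OF K_add[OF smallD(2)[OF that(1)] smallD(3)[OF z(1)]] delta_ge[of "i - 1"]] that by simp
        then show ?thesis by (simp add: algebra_simps)
      qed
      have "\<not> 1 \<le> i" using key[OF pD qD _ z(3) NN] big[OF x(1)] x(3) by blast
      then have "i = 0" using x by simp
      then have px: "p = x" using x by simp
      have "\<not> 1 \<le> j"
        using key[OF qD pD _ _ NN[unfolded add_mset_commute[of p q]]] big[OF y(1)] y(3) z(3)
        by (metis add.commute)
      then have "j = 0" using y by simp
      then have qy: "q = y" using y by simp
      have "l = 0 \<or> l = 1" using small_sum_level[OF x(1) y(1) z(1)] z(3) px qy by blast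
      moreover have "l \<noteq> 1"
      proof
        assume "l = 1"
        then have "p - z = \<delta> - y" using z(3) qy by (simp add: algebra_simps)
        then show False using key[OF pD qD _ z(3) NN] smallD(3)[OF y(1)] by simp
      qed
      ultimately have "p + q = z" using z(3) by simp
      then show ?thesis using hI z(1) px x(1) by auto
    qed
    obtain p where "p \<in># N" using N by blast
    then show ?thesis using * N by blast
  qed
qed

text \<open>Small roots that differ by a multiple of \<delta> are equal, so nothing blocks the
  descent. When it stops both sums are multiples of \<delta>, and nonpositive products with total 0
  all vanish. By \<open>root_perp\<close> each side lies on one line and its opposite, and a sum
  that is a multiple of \<delta> needs both.\<close>

lemma small_relation_False:
  assumes b: "closed_split A D" and M: "set_mset M \<subseteq> A \<inter> small" "M \<noteq> {#}" "sum_mset M = of_int k *\<^sub>R \<delta>"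
    and N: "set_mset N \<subseteq> D \<inter> small" "N \<noteq> {#}" "sum_mset N = of_int l *\<^sub>R \<delta>"
  shows False
proof -
  have k: "0 < k" and l: "0 < l" using imag_pos M N b closed_split_I by (metis Int_subset_iff subset_eq)+
  \<comment> \<open>Repetition makes both sums equal to \<open>k * l\<close> times \<delta>.\<close>
  define M1 N1 where "M1 = repeat_mset (nat l) M" and "N1 = repeat_mset (nat k) N"
  have "sum_mset M1 = sum_mset N1"
    using k l by (simp add: M1_def N1_def sum_mset_repeat M N mult.commute)
  moreover have "M1 \<noteq> {#}" "set_mset M1 \<subseteq> A \<inter> small" "set_mset N1 \<subseteq> D \<inter> small"
    using M N k l set_repeat_subset[of "nat l" M] set_repeat_subset[of "nat k" N]
    by (auto simp: M1_def N1_def repeat_mset_eq_empty_iff)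
  moreover have "p - q \<in> A \<inter> small \<or> q - p \<in> D \<inter> small"
    if "p \<in> A \<inter> small" "q \<in> D \<inter> small" "0 < f p q" for p q
  proof -
    have s: "p \<in> small" "q \<in> small" using that by auto
    have "p - q \<noteq> of_int k *\<^sub>R \<delta>" for k
    proof
      assume "p - q = of_int k *\<^sub>R \<delta>"
      then have "p = shift q k" by (simp add: algebra_simps)
      then have "p = q" using small_unique[OF s] by simp
      then show False using that b closed_split_disj by blast
    qed
    then have "p - q \<in> A \<or> q - p \<in> D"
      using root_diff[OF s[THEN smallD(1)] that(3)] closed_split_split[OF b] that by blast
    moreover have sm: "r - s \<in> small" if "r - s \<in> I" "r \<in> small" "s \<in> small" for r s
    proof -
      have "\<delta> - (r - s) \<in> K" using K_add[OF smallD(3)[OF that(2)] smallD(2)[OF that(3)]] by (simp add: algebra_simps)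
      then show ?thesis using I_D that by (simp add: small_def)
    qed
    ultimately show ?thesis using s b closed_split_I by blast
  qed
  ultimately obtain M' N' where *: "set_mset M' \<subseteq> A \<inter> small" "set_mset N' \<subseteq> D \<inter> small"
    "sum_mset M' = sum_mset N'" "M' \<noteq> {#} \<or> N' \<noteq> {#}" "\<forall>p\<in>#M'. \<forall>q\<in>#N'. f p q \<le> 0"
    using relation_descent[of "A \<inter> small" "D \<inter> small" f M1 N1] by blast
  have AI: "A \<subseteq> I" "D \<subseteq> I" using b by (auto simp: closed_split_def)
  have ne: "M' \<noteq> {#}" "N' \<noteq> {#}"
    using * sum_mset_pos(2)[of M'] sum_mset_pos(2)[of N'] I_pointed AI by fastforce+
  have "set_mset N' \<subseteq> \<Lambda>" using * lat_roots I_roots AI by blast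
  then obtain c where c: "sum_mset N' = of_int c *\<^sub>R \<delta>" using stuck_imaginary[OF *(5,3)] by blast
  have orth: "f p q = 0" if pq: "p \<in># M'" "q \<in># N'" for p q
  proof -
    obtain N0 where N0: "N' = add_mset q N0" using multi_member_split[OF pq(2)] by blast
    have "f p (sum_mset N0) \<le> 0"
      by (rule additive_sum_mset_nonpos) (use f_add *(5) pq N0 in auto)
    moreover have "f p q + f p (sum_mset N0) = 0"
      using f_imag(2)[of p c] c by (simp add: N0 f_add[symmetric])
    moreover have "f p q \<le> 0" using *(5) pq by blast
    ultimately show ?thesis by linarith
  qed
  have has_opposites: "has_opposites S" if S: "set_mset L \<subseteq> S" "S \<subseteq> I" and L: "L \<noteq> {#}" "sum_mset L = of_int c *\<^sub>R \<delta>"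
    and q: "q \<in> \<Phi>" "\<And>p. p \<in># L \<Longrightarrow> f p q = 0" for L S q
  proof -
    obtain p L0 where L0: "L = add_mset p L0" using L multiset_cases by blast
    have pR: "p \<in> \<Phi>" using S L0 I_roots by auto
    have "\<exists>p'\<in>#L0. f p p' < 0"
    proof (rule ccontr)
      assume "\<not> ?thesis"
      then have "f p q \<ge> 0" if "q \<in># L0" for q using that by force
      then have "- f p (sum_mset L0) \<le> 0"
        by (intro additive_sum_mset_nonpos[of "\<lambda>x. - f p x"]) (auto simp: f_add)
      moreover have "f p p + f p (sum_mset L0) = 0"
        using f_imag(2)[of p c] L(2) by (simp add: L0 f_add[symmetric])
      ultimately show False using f_root[OF pR] by simp
    qed
    then obtain p' where p': "p' \<in># L" "f p p' < 0" using L0 by auto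
    then have p'R: "p' \<in> \<Phi>" using S I_roots by auto
    obtain k where "p - p' = of_int k *\<^sub>R \<delta> \<or> p + p' = of_int k *\<^sub>R \<delta>"
      using root_perp[OF pR p'R q(1)] q(2) p' L0 by auto
    moreover have "p - p' \<noteq> of_int k *\<^sub>R \<delta>"
    proof
      assume "p - p' = of_int k *\<^sub>R \<delta>"
      then have "p' = p + of_int (- k) *\<^sub>R \<delta>" by (simp add: algebra_simps)
      then have "f p p' = f p p" using f_add(2) f_imag(2) by (metis add.right_neutral)
      then show False using f_root[OF pR] p' by simp
    qed
    ultimately show ?thesis using p' L0 S unfolding has_opposites_def by fastforce
  qed
  obtain p q where pq: "p \<in># M'" "q \<in># N'" using ne by blast
  then have R: "p \<in> \<Phi>" "q \<in> \<Phi>" using * AI I_roots by blast+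
  have "has_opposites A" by (rule has_opposites[OF _ AI(1) ne(1) _ R(2)]) (use * c orth[OF _ pq(2)] in auto)
  moreover have "f r p = 0" if "r \<in># N'" for r using orth[OF pq(1) that] f_sym by metis
  then have "has_opposites D" by (intro has_opposites[OF _ AI(2) ne(2) _ R(1)]) (use * c in auto)
  ultimately show False using has_opposites_exclusive[OF b] by blast
qed

text \<open>If \<open>A\<close> has opposites, they are already the required relation on its side.
  They are small, because a root of \<open>A\<close> at level 1 or higher would have every small
  root below it, whereas some small root is outside \<open>I\<close>.\<close>

lemma no_relation_aux:
  assumes b: "closed_split A D" and no: "\<not> has_opposites D" and M: "set_mset M \<subseteq> A" and N: "set_mset N \<subseteq> D"
    and e: "sum_mset M = sum_mset N" "M \<noteq> {#} \<or> N \<noteq> {#}"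
  shows False
proof -
  obtain N1 and l l0 :: int where N1: "set_mset N1 \<subseteq> D \<inter> small" "N1 \<noteq> {#}" "sum_mset N1 = of_int l *\<^sub>R \<delta>"
    and sm: "\<not> small \<subseteq> I"
    using imaginary_relation[OF b no M N e] small_imaginary[OF b no] by meson
  have "\<exists>M1. \<exists>k::int. set_mset M1 \<subseteq> A \<inter> small \<and> M1 \<noteq> {#} \<and> sum_mset M1 = of_int k *\<^sub>R \<delta>"
  proof (cases "has_opposites A")
    case False
    then show ?thesis
      using imaginary_relation[OF closed_split_sym[OF b] False N M] e small_imaginary[OF closed_split_sym[OF b] False] by metis
  next
    case True
    then obtain r s k where rs: "r \<in> A" "s \<in> A" "r + s = of_int k *\<^sub>R \<delta>" by (auto simp: has_opposites_def)
    have "r \<in> small" if "r \<in> A" for r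
    proof -
      have rI: "r \<in> I" using that b closed_split_I by blast
      obtain x i where x: "x \<in> small" "0 \<le> i" "r = shift x i" using pos_root_small I_D[OF rI] by metis
      have "\<not> 1 \<le> i"
      proof
        assume i: "1 \<le> i"
        have "z \<in> I" if z: "z \<in> small" for z
        proof (rule I_ideal[OF rI])
          show "z \<in> \<Phi>" "z \<in> K" using z smallD by auto
          have "(x + (\<delta> - z)) + of_int (i - 1) *\<^sub>R \<delta> \<in> K"
            using K_add[OF K_add[OF smallD(2)[OF x(1)] smallD(3)[OF z(1)]] delta_ge[of "i - 1"]] i by simp
          then show "r - z \<in> K" by (simp add: x algebra_simps)
        qed
        then show False using sm by blast
      qed
      then have "i = 0" using x by simp
      then show ?thesis using x by simp
    qed
    then have "set_mset {#r, s#} \<subseteq> A \<inter> small" using rs by auto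
    moreover have "sum_mset {#r, s#} = of_int k *\<^sub>R \<delta>" using rs by simp
    moreover have "{#r, s#} \<noteq> {#}" by simp
    ultimately show ?thesis by (intro exI conjI)
  qed
  then show False using small_relation_False[OF b _ _ _ N1] by blast
qed

theorem no_relation:
  assumes b: "closed_split A D" and M: "set_mset M \<subseteq> A" and N: "set_mset N \<subseteq> D"
    and e: "sum_mset M = sum_mset N" "M \<noteq> {#} \<or> N \<noteq> {#}"
  shows False
proof (cases "has_opposites D")
  case False
  then show ?thesis using no_relation_aux[OF b _ M N] e by blast
next
  case True
  then have "\<not> has_opposites A" using has_opposites_exclusive[OF b] by blast
  then show ?thesis using no_relation_aux[OF closed_split_sym[OF b] _ N M] e by metis
qed

end

section \<open>Finite root systems\<close>

locale finite_roots =
  fixes B :: "'a::real_vector \<Rightarrow> 'a \<Rightarrow> real" and \<Phi> \<Delta> :: "'a set"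
  assumes root_system: "root_system B \<Phi> \<Delta>" and finite_roots: "finite \<Phi>"
begin

lemma B_bilinear: "bilinear B" and B_sym: "B x y = B y x"
  using root_system by (auto simp: root_system_def)

lemmas B_simps = bilinear_ladd[OF B_bilinear] bilinear_radd[OF B_bilinear] bilinear_lmul[OF B_bilinear]
  bilinear_rmul[OF B_bilinear] bilinear_lsub[OF B_bilinear] bilinear_rsub[OF B_bilinear]
  bilinear_lneg[OF B_bilinear] bilinear_rneg[OF B_bilinear]

lemma linear_B: "linear (B x)" "linear (\<lambda>x. B x y)"
  using B_bilinear by (auto simp: bilinear_def)

lemma B_root: "\<alpha> \<in> \<Phi> \<Longrightarrow> 0 < B \<alpha> \<alpha>"
  using root_system by (auto simp: root_system_def)

abbreviation refl :: "'a \<Rightarrow> 'a \<Rightarrow> 'a" where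
  "refl \<equiv> rs_refl B"

lemma refl_image: "\<alpha> \<in> \<Phi> \<Longrightarrow> refl \<alpha> ` \<Phi> = \<Phi>"
  using root_system by (simp add: root_system_def)

lemma refl_root: "\<alpha> \<in> \<Phi> \<Longrightarrow> \<beta> \<in> \<Phi> \<Longrightarrow> refl \<alpha> \<beta> \<in> \<Phi>"
  using refl_image by blast

lemma linear_refl: "linear (refl \<alpha>)"
proof (rule linearI)
  show "refl \<alpha> (x + y) = refl \<alpha> x + refl \<alpha> y" for x y
    by (simp add: rs_refl_def B_simps add_divide_distrib algebra_simps)
  show "refl \<alpha> (c *\<^sub>R x) = c *\<^sub>R refl \<alpha> x" for c x
    by (simp add: rs_refl_def B_simps algebra_simps)
qed

lemma refl_self: "\<alpha> \<in> \<Phi> \<Longrightarrow> refl \<alpha> \<alpha> = - \<alpha>"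
  using B_root[of \<alpha>] by (simp add: rs_refl_def scaleR_2)

lemma refl_isometry:
  assumes "\<alpha> \<in> \<Phi>" shows "B (refl \<alpha> x) (refl \<alpha> y) = B x y"
  using B_root[OF assms] B_sym[of x \<alpha>] by (simp add: rs_refl_def B_simps field_simps)

lemma refl_inj: assumes "\<alpha> \<in> \<Phi>" shows "inj_on (refl \<alpha>) \<Phi>"
  using finite_roots refl_image[OF assms] by (simp add: eq_card_imp_inj_on)

lemma root_uminus: "\<alpha> \<in> \<Phi> \<Longrightarrow> - \<alpha> \<in> \<Phi>"
  using refl_root[of \<alpha> \<alpha>] refl_self by simp

lemma root_multiple: "\<alpha> \<in> \<Phi> \<Longrightarrow> c *\<^sub>R \<alpha> \<in> \<Phi> \<Longrightarrow> c *\<^sub>R \<alpha> = \<alpha> \<or> c *\<^sub>R \<alpha> = - \<alpha>"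
  using root_system unfolding root_system_def by blast

lemma base: "\<Delta> \<subseteq> \<Phi>" "\<pi> \<in> \<Delta> \<Longrightarrow> \<pi> \<notin> pos_span (\<Delta> - {\<pi>})" "\<Phi> \<subseteq> int_span \<Delta>"
  using root_system by (auto simp: root_system_def is_base_def)

lemma root_sign:
  assumes "\<alpha> \<in> \<Phi>" shows "(\<alpha> \<in> pos_span \<Delta>) \<noteq> (- \<alpha> \<in> pos_span \<Delta>)"
proof -
  have "(\<alpha> \<in> pos_span \<Delta>) \<noteq> (\<alpha> \<in> uminus ` pos_span \<Delta>)"
    using root_system assms by (auto simp: root_system_def is_base_def)
  moreover have "\<alpha> \<in> uminus ` pos_span \<Delta> \<longleftrightarrow> - \<alpha> \<in> pos_span \<Delta>"
    by (metis add.inverse_inverse image_iff)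
  ultimately show ?thesis by simp
qed

lemma base_pos: "\<pi> \<in> \<Delta> \<Longrightarrow> - \<pi> \<notin> pos_span \<Delta>"
  using root_sign[of \<pi>] base(1) pos_span_base by blast

text \<open>The operator \<open>L\<close> commutes with all reflections, so every root is an eigenvector of it, with a
  positive eigenvalue.  It stands in for the positive definiteness of \<open>B\<close>, which is not assumed.\<close>

definition L :: "'a \<Rightarrow> 'a" where
  "L x = (\<Sum>\<alpha>\<in>\<Phi>. (2 * B \<alpha> x / B \<alpha> \<alpha>) *\<^sub>R \<alpha>)"

definition lam :: "'a \<Rightarrow> real" where
  "lam \<beta> = B (L \<beta>) \<beta> / B \<beta> \<beta>"

lemma linear_L: "linear L"
proof (rule linearI)
  show "L (x + y) = L x + L y" for x y
    by (simp add: L_def B_simps add_divide_distrib distrib_left scaleR_left_distrib sum.distrib)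
  show "L (c *\<^sub>R x) = c *\<^sub>R L x" for c x
    by (simp add: L_def B_simps scaleR_right.sum mult.left_commute)
qed

lemma B_L: "B (L x) y = (\<Sum>\<alpha>\<in>\<Phi>. 2 * B \<alpha> x * B \<alpha> y / B \<alpha> \<alpha>)"
  unfolding L_def by (simp add: linear_sum[OF linear_B(2)] B_simps)

lemma L_sym: "B (L x) y = B x (L y)"
proof -
  have "B (L x) y = B (L y) x" unfolding B_L by (rule sum.cong) auto
  then show ?thesis using B_sym by simp
qed

lemma L_refl: assumes "\<gamma> \<in> \<Phi>" shows "L (refl \<gamma> x) = refl \<gamma> (L x)"
proof -
  have "L (refl \<gamma> x) = (\<Sum>\<alpha>\<in>refl \<gamma> ` \<Phi>. (2 * B \<alpha> (refl \<gamma> x) / B \<alpha> \<alpha>) *\<^sub>R \<alpha>)"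
    unfolding L_def refl_image[OF assms] ..
  also have "\<dots> = (\<Sum>\<alpha>\<in>\<Phi>. (2 * B \<alpha> x / B \<alpha> \<alpha>) *\<^sub>R refl \<gamma> \<alpha>)"
    unfolding sum.reindex[OF refl_inj[OF assms]] by (simp add: refl_isometry[OF assms])
  also have "\<dots> = refl \<gamma> (L x)"
    unfolding L_def by (simp add: linear_sum[OF linear_refl] linear_scale[OF linear_refl])
  finally show ?thesis .
qed

text \<open>\<open>refl \<beta>\<close> negates \<open>L \<beta>\<close>, and it negates only
  multiples of \<beta>.\<close>

lemma L_root: assumes "\<beta> \<in> \<Phi>" shows "L \<beta> = lam \<beta> *\<^sub>R \<beta>"
proof -
  define c where "c = B \<beta> (L \<beta>) / B \<beta> \<beta>"
  have "refl \<beta> (L \<beta>) = - L \<beta>"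
    using L_refl[OF assms, of \<beta>] refl_self[OF assms] linear_neg[OF linear_L] by simp
  then have "L \<beta> - (2 * c) *\<^sub>R \<beta> = - L \<beta>" by (simp add: rs_refl_def c_def)
  then have "2 *\<^sub>R L \<beta> = (2 * c) *\<^sub>R \<beta>" by (simp add: scaleR_2 algebra_simps)
  then have "(1/2) *\<^sub>R (2 *\<^sub>R L \<beta>) = (1/2) *\<^sub>R ((2 * c) *\<^sub>R \<beta>)" by (rule arg_cong)
  then have "L \<beta> = c *\<^sub>R \<beta>" by simp
  moreover have "c = lam \<beta>" by (simp add: c_def lam_def B_sym)
  ultimately show ?thesis by simp
qed

lemma lam_pos: assumes "\<beta> \<in> \<Phi>" shows "0 < lam \<beta>"
proof -
  have "2 * B \<beta> \<beta> * B \<beta> \<beta> / B \<beta> \<beta> \<le> B (L \<beta>) \<beta>"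
    unfolding B_L by (rule member_le_sum) (use assms finite_roots B_root in \<open>auto simp: less_imp_le\<close>)
  then have "0 < B (L \<beta>) \<beta>" using B_root[OF assms] by simp
  then show ?thesis using B_root[OF assms] by (simp add: lam_def)
qed

lemma L_nonneg: "0 \<le> B (L x) x"
  unfolding B_L by (rule sum_nonneg) (use B_root in \<open>auto simp: less_imp_le\<close>)

lemma L_null: assumes "B (L x) x \<le> 0" shows "L x = 0"
proof -
  have nn: "\<forall>\<alpha>\<in>\<Phi>. 0 \<le> 2 * B \<alpha> x * B \<alpha> x / B \<alpha> \<alpha>" using B_root by (auto simp: less_imp_le)
  have "(\<Sum>\<alpha>\<in>\<Phi>. 2 * B \<alpha> x * B \<alpha> x / B \<alpha> \<alpha>) = 0"
    using assms L_nonneg[of x] unfolding B_L by simp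
  then have "\<forall>\<alpha>\<in>\<Phi>. 2 * B \<alpha> x * B \<alpha> x / B \<alpha> \<alpha> = 0"
    using sum_nonneg_eq_0_iff[OF finite_roots, of "\<lambda>\<alpha>. 2 * B \<alpha> x * B \<alpha> x / B \<alpha> \<alpha>"] nn by blast
  then show ?thesis unfolding L_def by (intro sum.neutral) auto
qed

lemma lam_eq: assumes "\<alpha> \<in> \<Phi>" "\<beta> \<in> \<Phi>" "B \<alpha> \<beta> \<noteq> 0" shows "lam \<alpha> = lam \<beta>"
  using L_sym[of \<alpha> \<beta>] assms by (simp add: L_root B_simps)

text \<open>The common sum \<open>v\<close> is paired with \<open>L v\<close>, which has positive
  coefficients on the roots of \<open>M\<close>. The sign condition gives
  \<open>B (L v) v \<le> 0\<close>, hence \<open>L v = 0\<close>, which no nonempty positive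
  combination of positive roots satisfies.\<close>

lemma no_relation:
  assumes M: "set_mset M \<subseteq> pos_roots \<Phi> \<Delta>" and N: "set_mset N \<subseteq> pos_roots \<Phi> \<Delta>"
    and e: "sum_mset M = sum_mset N" and ne: "M \<noteq> {#} \<or> N \<noteq> {#}"
    and le: "\<forall>p\<in>#M. \<forall>q\<in>#N. B p q \<le> 0"
  shows False
proof -
  let ?v = "sum_mset N"
  have "B p ?v \<le> 0" if "p \<in># M" for p
    by (rule additive_sum_mset_nonpos) (use le that in \<open>auto simp: B_simps\<close>)
  moreover have "p \<in> \<Phi>" if "p \<in># M" for p using M that by (auto simp: pos_roots_def)
  ultimately have "B (L (sum_mset M)) ?v \<le> 0"
    by (intro additive_sum_mset_nonpos[of "\<lambda>x. B (L x) ?v"])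
      (auto simp: linear_add[OF linear_L] B_simps L_root less_imp_le lam_pos mult_nonneg_nonpos)
  then have L0: "L ?v = 0" using L_null e by simp
  have nonzero: "L (sum_mset M) \<noteq> 0" if M: "set_mset M \<subseteq> pos_roots \<Phi> \<Delta>" "M \<noteq> {#}" for M
  proof -
    have *: "L (sum_mset M) \<in> pos_span \<Delta>" if "set_mset M \<subseteq> pos_roots \<Phi> \<Delta>" for M
      using that
    proof (induction M)
      case empty then show ?case by (simp add: linear_0[OF linear_L] pos_span_0)
    next
      case (add p M)
      then have "p \<in> \<Phi>" "p \<in> pos_span \<Delta>" "L (sum_mset M) \<in> pos_span \<Delta>" by (auto simp: pos_roots_def)
      then show ?case
        by (simp add: linear_add[OF linear_L] L_root less_imp_le lam_pos pos_span_add pos_span_scale)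
    qed
    obtain p M0 where p: "M = add_mset p M0" using M multiset_cases by blast
    then have pR: "p \<in> \<Phi>" "p \<in> pos_span \<Delta>" using M by (auto simp: pos_roots_def)
    show ?thesis
    proof
      assume "L (sum_mset M) = 0"
      then have "lam p *\<^sub>R (- p) = L (sum_mset M0)"
        using p pR by (simp add: linear_add[OF linear_L] L_root add_eq_0_iff)
      then have "lam p *\<^sub>R (- p) \<in> pos_span \<Delta>" using * p M by auto
      then have "- p \<in> pos_span \<Delta>" using lam_pos[OF pR(1)] by (rule pos_span_cancel)
      then show False using root_sign pR by blast
    qed
  qed
  show False using nonzero[OF M] nonzero[OF N] L0 e ne by auto
qed

section \<open>Simple roots and Cartan integers\<close>

lemma base_obtuse:
  assumes "\<pi> \<in> \<Delta>" "\<rho> \<in> \<Delta>" "\<pi> \<noteq> \<rho>" shows "B \<pi> \<rho> \<le> 0"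
proof (rule ccontr)
  assume "\<not> B \<pi> \<rho> \<le> 0"
  define c where "c = 2 * B \<pi> \<rho> / B \<pi> \<pi>"
  have R: "\<pi> \<in> \<Phi>" "\<rho> \<in> \<Phi>" using assms base by auto
  have c: "0 < c" using \<open>\<not> B \<pi> \<rho> \<le> 0\<close> B_root R by (simp add: c_def)
  have s: "refl \<pi> \<rho> = \<rho> - c *\<^sub>R \<pi>" by (simp add: rs_refl_def c_def)
  have "\<rho> - c *\<^sub>R \<pi> \<in> \<Phi>" using refl_root[OF R] s by simp
  then consider "\<rho> - c *\<^sub>R \<pi> \<in> pos_span \<Delta>" | "c *\<^sub>R \<pi> - \<rho> \<in> pos_span \<Delta>"
    using root_sign by fastforce
  then show False
  proof cases
    \<comment> \<open>Coefficients cannot be compared, as independence is itself derived from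
      obtuseness. For \<open>d < 1\<close> the equation expresses \<rho> by the other simple roots;
      otherwise it makes \<open>- \<pi>\<close> a nonnegative combination.\<close>
    case 1
    then obtain d r where d: "0 \<le> d" "r \<in> pos_span (\<Delta> - {\<rho>})" "\<rho> - c *\<^sub>R \<pi> = d *\<^sub>R \<rho> + r"
      using pos_span_split by blast
    have e: "c *\<^sub>R \<pi> + r = (1 - d) *\<^sub>R \<rho>" using d(3) by (simp add: algebra_simps)
    show False
    proof (cases "d < 1")
      case True
      have "\<pi> \<in> pos_span (\<Delta> - {\<rho>})" using assms by (intro pos_span_base) auto
      then have "(1 / (1 - d)) *\<^sub>R (c *\<^sub>R \<pi> + r) \<in> pos_span (\<Delta> - {\<rho>})"
        using d True c by (intro pos_span_scale pos_span_add) auto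
      then have "\<rho> \<in> pos_span (\<Delta> - {\<rho>})" using True unfolding e by simp
      then show False using base assms by blast
    next
      case False
      have "r \<in> pos_span \<Delta>" using d(2) pos_span_mono[of "\<Delta> - {\<rho>}" \<Delta>] by blast
      then have "(1 / c) *\<^sub>R ((d - 1) *\<^sub>R \<rho> + r) \<in> pos_span \<Delta>"
        using False c assms pos_span_base by (intro pos_span_scale pos_span_add) auto
      moreover have "(d - 1) *\<^sub>R \<rho> + r = c *\<^sub>R (- \<pi>)" using e by (simp add: algebra_simps)
      ultimately have "- \<pi> \<in> pos_span \<Delta>" using c by simp
      then show False using base_pos assms by blast
    qed
  next
    case 2
    then obtain d r where d: "0 \<le> d" "r \<in> pos_span (\<Delta> - {\<pi>})" "c *\<^sub>R \<pi> - \<rho> = d *\<^sub>R \<pi> + r"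
      using pos_span_split by blast
    have e: "\<rho> + r = (c - d) *\<^sub>R \<pi>" using d(3) by (simp add: algebra_simps)
    show False
    proof (cases "d < c")
      case True
      have "\<rho> \<in> pos_span (\<Delta> - {\<pi>})" using assms by (intro pos_span_base) auto
      then have "(1 / (c - d)) *\<^sub>R (\<rho> + r) \<in> pos_span (\<Delta> - {\<pi>})"
        using d True c by (intro pos_span_scale pos_span_add) auto
      then have "\<pi> \<in> pos_span (\<Delta> - {\<pi>})" using True unfolding e by simp
      then show False using base assms by blast
    next
      case False
      have "r \<in> pos_span \<Delta>" using d(2) pos_span_mono[of "\<Delta> - {\<pi>}" \<Delta>] by blast
      then have "(d - c) *\<^sub>R \<pi> + r \<in> pos_span \<Delta>"
        using False assms pos_span_base by (intro pos_span_scale pos_span_add) auto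
      moreover have "(d - c) *\<^sub>R \<pi> + r = - \<rho>" using e by (simp add: algebra_simps)
      ultimately show False using base_pos assms by simp
    qed
  qed
qed

lemma finite_base: "finite \<Delta>"
  using base(1) finite_roots finite_subset by blast

text \<open>A dependency writes one vector \<open>v\<close> with positive coefficients over two
  disjoint, mutually obtuse sets of simple roots. Hence \<open>B (L v) v \<le> 0\<close> and
  \<open>L v = 0\<close>, although \<open>L v\<close> is again a positive combination of either
  set.\<close>

lemma base_independent: "independent \<Delta>"
proof
  assume "dependent \<Delta>"
  then obtain T a where T: "finite T" "T \<subseteq> \<Delta>" "(\<Sum>v\<in>T. a v *\<^sub>R v) = 0" "\<exists>v\<in>T. a v \<noteq> 0"
    unfolding dependent_explicit by blast
  define P N where "P = {v \<in> T. 0 < a v}" and "N = {v \<in> T. a v < 0}"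
  have PN: "finite P" "finite N" "P \<subseteq> \<Delta>" "N \<subseteq> \<Delta>" "P \<inter> N = {}" using T by (auto simp: P_def N_def)
  have roots: "P \<subseteq> \<Phi>" "N \<subseteq> \<Phi>" using PN base by auto
  define v where "v = (\<Sum>x\<in>P. a x *\<^sub>R x)"
  have "(\<Sum>x\<in>T. a x *\<^sub>R x) = (\<Sum>x\<in>P \<union> N. a x *\<^sub>R x)"
    by (rule sum.mono_neutral_right) (use T in \<open>auto simp: P_def N_def\<close>)
  also have "\<dots> = v + (\<Sum>x\<in>N. a x *\<^sub>R x)" unfolding v_def by (rule sum.union_disjoint) (use PN in auto)
  finally have v: "v = (\<Sum>x\<in>N. (- a x) *\<^sub>R x)" using T(3) by (simp add: sum_negf eq_neg_iff_add_eq_0)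
  have Bxv: "B x v \<le> 0" if "x \<in> P" for x
  proof -
    have "B x v = (\<Sum>y\<in>N. (- a y) * B x y)"
      unfolding v by (simp add: linear_sum[OF linear_B(1)] B_simps sum_negf)
    also have "\<dots> \<le> 0"
    proof (rule sum_nonpos)
      fix y assume "y \<in> N"
      then have "x \<in> \<Delta>" "y \<in> \<Delta>" "x \<noteq> y" "0 \<le> - a y" using that PN by (auto simp: N_def)
      then have "B x y \<le> 0" "0 \<le> - a y" using base_obtuse by auto
      then show "(- a y) * B x y \<le> 0" by (rule mult_nonneg_nonpos[rotated])
    qed
    finally show ?thesis .
  qed
  have "B (L v) v = (\<Sum>x\<in>P. a x * lam x * B x v)"
  proof -
    have "L v = (\<Sum>x\<in>P. (a x * lam x) *\<^sub>R x)" unfolding v_def linear_sum[OF linear_L] linear_scale[OF linear_L]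
      by (rule sum.cong) (use roots L_root in auto)
    then show ?thesis by (simp add: linear_sum[OF linear_B(2)] B_simps)
  qed
  also have "\<dots> \<le> 0"
  proof (rule sum_nonpos)
    fix x assume x: "x \<in> P"
    then have "0 \<le> a x * lam x" using lam_pos[of x] roots by (auto simp: P_def)
    then show "a x * lam x * B x v \<le> 0" using Bxv[OF x] by (rule mult_nonneg_nonpos)
  qed
  finally have Lv: "L v = 0" using L_null by simp
  have empty: "S = {}" if S: "finite S" "S \<subseteq> \<Delta>" "\<And>x. x \<in> S \<Longrightarrow> 0 < c x" "L (\<Sum>x\<in>S. c x *\<^sub>R x) = 0" for S c
  proof (rule ccontr)
    assume "S \<noteq> {}"
    then obtain x where x: "x \<in> S" by blast
    have SR: "S \<subseteq> \<Phi>" using S base by auto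
    have "L (\<Sum>x\<in>S. c x *\<^sub>R x) = (\<Sum>x\<in>S. (c x * lam x) *\<^sub>R x)"
      unfolding linear_sum[OF linear_L] linear_scale[OF linear_L]
      by (rule sum.cong) (use SR L_root in auto)
    then have 0: "(c x * lam x) *\<^sub>R x + (\<Sum>y\<in>S - {x}. (c y * lam y) *\<^sub>R y) = 0"
      using S(4) sum.remove[OF S(1) x, of "\<lambda>x. (c x * lam x) *\<^sub>R x"] by simp
    have p: "0 < c y * lam y" if "y \<in> S" for y using S(3) lam_pos SR that by auto
    have "(\<Sum>y\<in>S - {x}. (c y * lam y) *\<^sub>R y) \<in> pos_span \<Delta>"
      unfolding pos_span_def using S p by (intro CollectI exI[of _ "S - {x}"] exI[of _ "\<lambda>y. c y * lam y"]) (auto simp: less_imp_le)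
    moreover have "(\<Sum>y\<in>S - {x}. (c y * lam y) *\<^sub>R y) = (c x * lam x) *\<^sub>R (- x)"
      using 0 by (simp add: add_eq_0_iff)
    ultimately have "(c x * lam x) *\<^sub>R (- x) \<in> pos_span \<Delta>" by (simp only:)
    then have "- x \<in> pos_span \<Delta>" using p[OF x] by (rule pos_span_cancel)
    then show False using base_pos S x by blast
  qed
  have "P = {}" by (rule empty[of P a]) (use PN Lv in \<open>auto simp: P_def v_def\<close>)
  moreover have "N = {}" by (rule empty[of N "\<lambda>x. - a x"]) (use PN Lv v in \<open>auto simp: N_def\<close>)
  ultimately show False using T(4) by (force simp: P_def N_def)
qed

lemma root_span: "\<Phi> \<subseteq> span \<Delta>"
proof
  fix x assume "x \<in> \<Phi>"
  then obtain T c where "T \<subseteq> \<Delta>" "x = (\<Sum>x\<in>T. c x *\<^sub>R x)" using base(3) unfolding int_span_def by blast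
  then show "x \<in> span \<Delta>" by (auto intro!: span_sum span_scale intro: span_base)
qed

text \<open>For a simple root the Cartan number is the change of an integral coordinate under its
  reflection. Any other positive root is carried to one of smaller height by a simple reflection, an
  isometry that permutes the roots.\<close>

lemma cartan_integer:
  assumes "\<alpha> \<in> \<Phi>" "\<beta> \<in> \<Phi>" shows "2 * B \<alpha> \<beta> / B \<alpha> \<alpha> \<in> \<int>"
proof -
  obtain \<xi> where lin: "\<And>e. linear (\<xi> e)" and \<xi>: "\<And>e e'. e' \<in> \<Delta> \<Longrightarrow> \<xi> e e' = (if e' = e then 1 else (0::real))"
    using coordinates_exist[OF base_independent] by blast
  have int: "\<xi> e x \<in> \<int>" if x: "x \<in> \<Phi>" for e x
  proof -
    obtain T c where "finite T" "T \<subseteq> \<Delta>" "\<forall>x\<in>T. c x \<in> \<int>" "x = (\<Sum>x\<in>T. c x *\<^sub>R x)"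
      using x base(3) unfolding int_span_def by blast
    then show ?thesis using coordinate_sum[of \<xi> e \<Delta>, OF lin \<xi>, of T c] by auto
  qed
  have nonneg: "0 \<le> \<xi> e x" if x: "x \<in> pos_span \<Delta>" for e x
  proof -
    obtain T c where "finite T" "T \<subseteq> \<Delta>" "\<forall>x\<in>T. c x \<ge> 0" "x = (\<Sum>x\<in>T. c x *\<^sub>R x)"
      using x unfolding pos_span_def by blast
    then show ?thesis using coordinate_sum[of \<xi> e \<Delta>, OF lin \<xi>, of T c] by auto
  qed
  have expand: "x = (\<Sum>e\<in>\<Delta>. \<xi> e x *\<^sub>R e)" if x: "x \<in> \<Phi>" for x
  proof -
    obtain a where a: "x = (\<Sum>e\<in>\<Delta>. a e *\<^sub>R e)" using x root_span span_finite[OF finite_base] by auto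
    have "(\<Sum>e\<in>\<Delta>. \<xi> e x *\<^sub>R e) = (\<Sum>e\<in>\<Delta>. a e *\<^sub>R e)"
    proof (rule sum.cong)
      fix e assume "e \<in> \<Delta>"
      then have "\<xi> e x = a e" unfolding a using coordinate_sum[of \<xi> e \<Delta>, OF lin \<xi> finite_base, of a] by simp
      then show "\<xi> e x *\<^sub>R e = a e *\<^sub>R e" by simp
    qed simp
    then show ?thesis using a by simp
  qed
  define ht where "ht x = (\<Sum>e\<in>\<Delta>. \<xi> e x)" for x
  have pos: "\<forall>\<beta>\<in>\<Phi>. 2 * B \<alpha> \<beta> / B \<alpha> \<alpha> \<in> \<int>" if "\<alpha> \<in> \<Phi>" "\<alpha> \<in> pos_span \<Delta>" for \<alpha>
    using that
  proof (induction "nat \<lfloor>ht \<alpha>\<rfloor>" arbitrary: \<alpha> rule: less_induct)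
    case less
    note \<alpha> = less.prems
    have "0 < B \<alpha> \<alpha>" using B_root \<alpha> by blast
    also have "B \<alpha> \<alpha> = (\<Sum>e\<in>\<Delta>. \<xi> e \<alpha> * B \<alpha> e)"
      by (subst (2) expand[OF \<alpha>(1)]) (simp add: linear_sum[OF linear_B(1)] B_simps)
    finally obtain \<pi> where \<pi>: "\<pi> \<in> \<Delta>" "0 < \<xi> \<pi> \<alpha> * B \<alpha> \<pi>" by (meson not_le sum_nonpos)
    then have "0 < B \<alpha> \<pi>" using nonneg[OF \<alpha>(2), of \<pi>] by (simp add: zero_less_mult_iff)
    have \<pi>R: "\<pi> \<in> \<Phi>" using \<pi> base by auto
    define c where "c = 2 * B \<pi> \<alpha> / B \<pi> \<pi>"
    have c: "0 < c" using \<open>0 < B \<alpha> \<pi>\<close> B_root[OF \<pi>R] by (simp add: c_def B_sym)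
    have s: "refl \<pi> \<alpha> = \<alpha> - c *\<^sub>R \<pi>" by (simp add: rs_refl_def c_def)
    show ?case
    proof (cases "\<forall>\<rho>\<in>\<Delta> - {\<pi>}. \<xi> \<rho> \<alpha> = 0")
      case True
      have "\<alpha> = (\<Sum>e\<in>\<Delta>. \<xi> e \<alpha> *\<^sub>R e)" using expand \<alpha> by blast
      also have "\<dots> = \<xi> \<pi> \<alpha> *\<^sub>R \<pi>" using True \<pi> finite_base by (subst sum.remove[of _ \<pi>]) auto
      finally have "\<alpha> = \<pi> \<or> \<alpha> = - \<pi>" using root_multiple[OF \<pi>R] \<alpha> by metis
      then have e: "\<alpha> = \<pi>" using base_pos \<pi> \<alpha> by auto
      show ?thesis
      proof
        fix \<beta> assume \<beta>: "\<beta> \<in> \<Phi>"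
        have "\<xi> \<pi> (refl \<pi> \<beta>) = \<xi> \<pi> \<beta> - 2 * B \<pi> \<beta> / B \<pi> \<pi>"
          by (simp add: rs_refl_def linear_diff[OF lin] linear_scale[OF lin] \<xi> \<pi>)
        then have "2 * B \<pi> \<beta> / B \<pi> \<pi> = \<xi> \<pi> \<beta> - \<xi> \<pi> (refl \<pi> \<beta>)" by simp
        then show "2 * B \<alpha> \<beta> / B \<alpha> \<alpha> \<in> \<int>" using int \<beta> refl_root[OF \<pi>R \<beta>] e by simp
      qed
    next
      case False
      \<comment> \<open>The coordinate at \<rho> is positive and unchanged by the reflection, so the
        reflected root stays positive.\<close>
      then obtain \<rho> where \<rho>: "\<rho> \<in> \<Delta>" "\<rho> \<noteq> \<pi>" "\<xi> \<rho> \<alpha> \<noteq> 0" by blast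
      let ?g = "refl \<pi> \<alpha>"
      have g: "?g \<in> \<Phi>" using refl_root \<pi>R \<alpha> by blast
      have \<xi>g: "\<xi> e ?g = \<xi> e \<alpha> - (if e = \<pi> then c else 0)" for e
        by (simp add: s linear_diff[OF lin] linear_scale[OF lin] \<xi> \<pi>)
      have "0 < \<xi> \<rho> ?g" using \<xi>g \<rho> nonneg[OF \<alpha>(2), of \<rho>] by simp
      then have "- ?g \<notin> pos_span \<Delta>" using nonneg[of "- ?g" \<rho>] linear_neg[OF lin] by force
      then have gp: "?g \<in> pos_span \<Delta>" using root_sign[OF g] by blast
      have "ht ?g = ht \<alpha> - c" using \<pi> finite_base by (simp add: ht_def \<xi>g sum_subtractf)
      moreover have "ht ?g \<in> \<int>" "ht \<alpha> \<in> \<int>" unfolding ht_def using int g \<alpha> by (auto intro: Ints_sum)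
      moreover have "0 \<le> ht ?g" unfolding ht_def using nonneg[OF gp] by (auto intro: sum_nonneg)
      ultimately have "nat \<lfloor>ht ?g\<rfloor> < nat \<lfloor>ht \<alpha>\<rfloor>" using c by (auto elim!: Ints_cases)
      then have IH: "\<forall>\<beta>\<in>\<Phi>. 2 * B ?g \<beta> / B ?g ?g \<in> \<int>" using less.hyps g gp by blast
      show ?thesis
      proof
        fix \<beta> assume \<beta>: "\<beta> \<in> \<Phi>"
        have "2 * B ?g (refl \<pi> \<beta>) / B ?g ?g \<in> \<int>" using IH refl_root[OF \<pi>R \<beta>] by blast
        then show "2 * B \<alpha> \<beta> / B \<alpha> \<alpha> \<in> \<int>" using refl_isometry[OF \<pi>R] by simp
      qed
    qed
  qed
  show ?thesis
  proof (cases "\<alpha> \<in> pos_span \<Delta>")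
    case True then show ?thesis using pos assms by blast
  next
    case False
    then have "2 * B (- \<alpha>) \<beta> / B (- \<alpha>) (- \<alpha>) \<in> \<int>" using pos[of "- \<alpha>"] root_sign root_uminus assms by blast
    then show ?thesis by (simp add: B_simps)
  qed
qed

text \<open>The component \<open>u\<close> of \<alpha> orthogonal to \<beta> is a nonzero
  eigenvector of \<open>L\<close>, so \<open>B u u\<close> is positive and Cauchy-Schwarz is strict.
  The two Cartan integers then have product below 4; one of them is 1, and its reflection produces
  the difference up to sign.\<close>

lemma root_diff:
  assumes a: "\<alpha> \<in> \<Phi>" and b: "\<beta> \<in> \<Phi>" and p: "0 < B \<alpha> \<beta>" and ne: "\<alpha> \<noteq> \<beta>"
  shows "\<alpha> - \<beta> \<in> \<Phi>"
proof -
  have Ba: "0 < B \<alpha> \<alpha>" and Bb: "0 < B \<beta> \<beta>" using B_root a b by auto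
  define t where "t = B \<alpha> \<beta> / B \<beta> \<beta>"
  define u where "u = \<alpha> - t *\<^sub>R \<beta>"
  have Lu: "L u = lam \<alpha> *\<^sub>R u"
    using lam_eq[OF a b] p by (simp add: u_def linear_diff[OF linear_L] linear_scale[OF linear_L] L_root a b algebra_simps)
  have "0 < B u u"
  proof (rule ccontr)
    assume "\<not> 0 < B u u"
    then have "B (L u) u \<le> 0" using lam_pos[OF a] by (simp add: Lu B_simps mult_nonneg_nonpos)
    then have "L u = 0" by (rule L_null)
    then have "\<alpha> = t *\<^sub>R \<beta>" using Lu lam_pos[OF a] by (simp add: u_def)
    then have "\<alpha> = \<beta> \<or> \<alpha> = - \<beta>" using root_multiple[OF b] a by metis
    then show False using ne p Bb by (auto simp: B_simps)
  qed
  moreover have "B u u = B \<alpha> \<alpha> - B \<alpha> \<beta> * B \<alpha> \<beta> / B \<beta> \<beta>"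
    using Bb B_sym[of \<beta> \<alpha>] by (simp add: u_def B_simps t_def field_simps)
  ultimately have lt: "B \<alpha> \<beta> * B \<alpha> \<beta> < B \<alpha> \<alpha> * B \<beta> \<beta>" using Bb by (simp add: field_simps)
  obtain m :: int where m: "2 * B \<alpha> \<beta> / B \<alpha> \<alpha> = of_int m" using cartan_integer[OF a b] by (auto elim: Ints_cases)
  obtain n :: int where n: "2 * B \<beta> \<alpha> / B \<beta> \<beta> = of_int n" using cartan_integer[OF b a] by (auto elim: Ints_cases)
  have "0 < real_of_int m" "0 < real_of_int n"
    unfolding m[symmetric] n[symmetric] using p Ba Bb by (auto simp: B_sym)
  then have mn0: "0 < m" "0 < n" by auto
  have "real_of_int m * real_of_int n < 4"
    unfolding m[symmetric] n[symmetric] using lt Ba Bb B_sym[of \<beta> \<alpha>] by (simp add: field_simps)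
  then have mn: "m * n < 4" by (metis of_int_less_iff of_int_mult of_int_numeral)
  have "m = 1 \<or> n = 1"
  proof (rule ccontr)
    assume "\<not> ?thesis"
    then have "2 \<le> m" "2 \<le> n" using mn0 by auto
    then have "2 * 2 \<le> m * n" by (intro mult_mono) auto
    then show False using mn by simp
  qed
  then show ?thesis
  proof
    assume "m = 1"
    then have "refl \<alpha> \<beta> = \<beta> - \<alpha>" using m by (simp add: rs_refl_def)
    then show ?thesis using refl_root[OF a b] root_uminus[of "\<beta> - \<alpha>"] by simp
  next
    assume "n = 1"
    then have "refl \<beta> \<alpha> = \<alpha> - \<beta>" using n by (simp add: rs_refl_def)
    then show ?thesis using refl_root[OF b a] by simp
  qed
qed

theorem finite_ideal_clean:
  assumes "order_ideal \<Phi> \<Delta> I" shows "clean I"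
  unfolding clean_def
proof (intro allI impI)
  fix S assume S: "S \<subseteq> I" and bc: "rs_biclosed I S"
  have I: "I \<subseteq> pos_roots \<Phi> \<Delta>" and ideal: "\<And>\<beta> \<alpha>. \<beta> \<in> I \<Longrightarrow> \<alpha> \<in> pos_roots \<Phi> \<Delta> \<Longrightarrow> \<beta> - \<alpha> \<in> pos_span \<Delta> \<Longrightarrow> \<alpha> \<in> I"
    using assms by (auto simp: order_ideal_def)
  have up: "r \<in> X" if "rs_closed I X" "s \<in> X" "t \<in> X" "r \<in> I" "r = s + t" for X r s t
    using that pos_span_add pos_span_base[of s "{s, t}"] pos_span_base[of t "{s, t}"]
    unfolding rs_closed_def by blast
  have cl: "rs_closed I S" "rs_closed I (I - S)" using bc by (auto simp: rs_biclosed_def rs_coclosed_def)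
  have half: "p - q \<in> X"
    if X: "rs_closed I X" "rs_closed I (I - X)" and p: "p \<in> X" "p \<in> I" and q: "q \<in> I - X"
      and r: "p - q \<in> \<Phi>" "p - q \<in> pos_span \<Delta>" for X p q
  proof (rule ccontr)
    assume n: "p - q \<notin> X"
    have "q \<in> pos_span \<Delta>" using q I by (auto simp: pos_roots_def)
    then have "p - q \<in> I" using ideal[OF p(2), of "p - q"] r by (simp add: pos_roots_def)
    then have "p \<in> I - X" using up[OF X(2) q _ p(2), of "p - q"] n by simp
    then show False using p by blast
  qed
  show "weakly_separable I S"
  proof (rule weakly_separable_from_multisets[OF base_independent _ S])
    show "I \<subseteq> int_span \<Delta>" using I base by (auto simp: pos_roots_def)
    fix M N assume MN: "set_mset M \<subseteq> S" "set_mset N \<subseteq> I - S" "sum_mset M = sum_mset N" "M \<noteq> {#} \<or> N \<noteq> {#}"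
    have "p - q \<in> S \<or> q - p \<in> I - S" if pq: "p \<in> S" "q \<in> I - S" "0 < B p q" for p q
    proof -
      have R: "p \<in> \<Phi>" "q \<in> \<Phi>" "p \<in> I" "q \<in> I" "p \<noteq> q" using pq S I by (auto simp: pos_roots_def)
      have d: "p - q \<in> \<Phi>" using root_diff[OF R(1,2) pq(3) R(5)] .
      show ?thesis
      proof (cases "p - q \<in> pos_span \<Delta>")
        case True then show ?thesis using half[OF cl pq(1) R(3) pq(2) d] by blast
      next
        case False
        have "I - (I - S) = S" using S by blast
        moreover have "q - p \<in> pos_span \<Delta>" "q - p \<in> \<Phi>" using False root_sign[OF d] root_uminus[OF d] by auto
        ultimately show ?thesis using half[of "I - S" q p] cl pq R by simp
      qed
    qed
    then obtain M' N' where *: "set_mset M' \<subseteq> S" "set_mset N' \<subseteq> I - S" "sum_mset M' = sum_mset N'"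
      "M' \<noteq> {#} \<or> N' \<noteq> {#}" "\<forall>p\<in>#M'. \<forall>q\<in>#N'. B p q \<le> 0"
      using relation_descent[of S "I - S" B M N] MN by blast
    then show False using no_relation[of M' N'] S I by blast
  qed
qed

end

section \<open>Affinizations of rank two systems\<close>

locale rank2_roots = finite_roots +
  assumes irreducible: "irreducible_rs B \<Phi>" and card_base: "card \<Delta> = 2"
begin

lemma irreducibleD:
  assumes "S \<noteq> {}" "T \<noteq> {}" "S \<union> T = \<Phi>" "S \<inter> T = {}"
  shows "\<exists>a\<in>S. \<exists>b\<in>T. B a b \<noteq> 0"
  using irreducible assms unfolding irreducible_rs_def by metis

text \<open>Roots with different eigenvalues are orthogonal, so two eigenvalues would split the
  system.\<close>

lemma lam_const:
  assumes "\<alpha> \<in> \<Phi>" "\<beta> \<in> \<Phi>" shows "lam \<alpha> = lam \<beta>"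
proof (rule ccontr)
  assume n: "lam \<alpha> \<noteq> lam \<beta>"
  let ?A = "{x \<in> \<Phi>. lam x = lam \<alpha>}"
  have "\<forall>a\<in>?A. \<forall>b\<in>\<Phi> - ?A. B a b = 0" using lam_eq by fastforce
  moreover have "\<exists>a\<in>?A. \<exists>b\<in>\<Phi> - ?A. B a b \<noteq> 0"
    by (rule irreducibleD) (use assms n in auto)
  ultimately show False by blast
qed

lemma B_definite:
  assumes x: "x \<in> span \<Phi>" and "B x x \<le> 0" shows "x = 0"
proof -
  obtain \<alpha> where \<alpha>: "\<alpha> \<in> \<Phi>" using irreducible by (auto simp: irreducible_rs_def)
  have "L x = lam \<alpha> *\<^sub>R x"
  proof (rule linear_eq_on_span[OF linear_L _ _ x])
    show "linear (\<lambda>x. lam \<alpha> *\<^sub>R x)" by (rule linearI) (auto simp: algebra_simps)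
    show "L y = lam \<alpha> *\<^sub>R y" if "y \<in> \<Phi>" for y using L_root[OF that] lam_const[OF \<alpha> that] by simp
  qed
  moreover from this have "B (L x) x \<le> 0"
    using assms lam_pos[OF \<alpha>] by (simp add: B_simps mult_nonneg_nonpos)
  ultimately have "lam \<alpha> *\<^sub>R x = 0" using L_null by metis
  then show ?thesis using lam_pos[OF \<alpha>] by simp
qed

section \<open>Pairs of roots in the plane\<close>

lemma B_span_zero: "\<forall>s\<in>S. B w s = 0 \<Longrightarrow> v \<in> span S \<Longrightarrow> B w v = 0"
  using linear_eq_0_on_span[OF linear_B(1), of S w v] by blast

lemma third_in_span:
  assumes "p \<in> \<Phi>" "q \<in> \<Phi>" "r \<in> \<Phi>" "q \<notin> span {p}" shows "r \<in> span {p, q}"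
proof (rule ccontr)
  assume r: "r \<notin> span {p, q}"
  have "p \<noteq> 0" using B_root[OF assms(1)] bilinear_lzero[OF B_bilinear] by force
  then have "independent {p}" by simp
  then have "independent (insert q {p})" using assms(4) by (rule independent_insertI[rotated])
  then have "independent {p, q}" by (subst insert_commute)
  with r have "independent (insert r {p, q})" by (rule independent_insertI)
  moreover have "insert r {p, q} \<subseteq> span \<Delta>" using assms root_span by auto
  ultimately have "card (insert r {p, q}) \<le> card \<Delta>" using independent_span_bound[OF finite_base] by blast
  moreover have "q \<noteq> p" "r \<noteq> p" "r \<noteq> q" using r assms(4) span_base[of r "{p, q}"] span_base[of q "{p}"] by auto
  ultimately show False using card_base by simp
qed

lemma root_perp:
  assumes p: "p \<in> \<Phi>" and p': "p' \<in> \<Phi>" and q: "q \<in> \<Phi>" and "B p q = 0" "B p' q = 0"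
  shows "p = p' \<or> p = - p'"
proof (cases "p' \<in> span {p}")
  case True
  then obtain c where "p' = c *\<^sub>R p" by (auto simp: span_singleton)
  then show ?thesis using root_multiple[OF p, of c] p' by auto
next
  case False
  have "B q q = 0" by (rule B_span_zero[OF _ third_in_span[OF p p' q False]]) (use assms B_sym in auto)
  then show ?thesis using B_root[OF q] by simp
qed

lemma half_sum:
  assumes x: "x \<in> \<Phi>" and y: "y \<in> \<Phi>" and xy: "B x y = 0" and r: "(1/2) *\<^sub>R (x + y) \<in> \<Phi>"
  shows "\<exists>r\<in>\<Phi>. \<exists>s\<in>\<Phi>. r + s = x \<and> r - s = y"
proof -
  let ?r = "(1/2) *\<^sub>R (x + y)"
  have "refl y ?r = ?r - y" using xy B_root[OF y] B_sym[of x y] by (simp add: rs_refl_def B_simps)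
  then have s: "?r - y \<in> \<Phi>" using refl_root[OF y r] by simp
  have "?r + ?r = x + y" using scaleR_half_double[of "x + y"] by (simp add: scaleR_right_distrib)
  then have "?r + (?r - y) = x" by (metis add_diff_cancel_right' add_diff_eq)
  moreover have "?r - (?r - y) = y" by simp
  ultimately show ?thesis using r s by blast
qed

text \<open>If every root were orthogonal to \<open>x\<close> or to \<open>y\<close>, planarity
  would leave only these two roots and their negatives, a reducible system. The reflections in
  \<open>x\<close> and \<open>y\<close> correct the two signs independently.\<close>

lemma linking_root:
  assumes x: "x \<in> \<Phi>" and y: "y \<in> \<Phi>" and xy: "B x y = 0"
  obtains w where "w \<in> \<Phi>" "0 < B w x" "0 < B w y"
proof -
  have "\<exists>w\<in>\<Phi>. B w x \<noteq> 0 \<and> B w y \<noteq> 0"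
  proof (rule ccontr)
    assume n: "\<not> ?thesis"
    let ?A = "{r \<in> \<Phi>. B r y = 0}" and ?C = "{r \<in> \<Phi>. B r y \<noteq> 0}"
    have ne: "x \<in> ?A" "y \<in> ?C" using x y xy B_root[OF y] by auto
    have "B a b = 0" if a: "a \<in> ?A" and b: "b \<in> ?C" for a b
    proof -
      have "a = x \<or> a = - x" using root_perp[of a x y] a x y xy by simp
      moreover have "b = y \<or> b = - y" using root_perp[of b y x] b n x y xy B_sym by auto
      ultimately show ?thesis using xy by (auto simp: B_simps)
    qed
    moreover have "\<exists>a\<in>?A. \<exists>b\<in>?C. B a b \<noteq> 0"
      by (rule irreducibleD) (use ne in blast)+
    ultimately show False by blast
  qed
  then obtain w where w: "w \<in> \<Phi>" "B w x \<noteq> 0" "B w y \<noteq> 0" by blast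
  have flip: "B (refl z w) z = - B w z" if "z \<in> \<Phi>" for z w
    using B_root[OF that] B_sym[of z w] by (simp add: rs_refl_def B_simps)
  have fixed: "B (refl z w) u = B w u" if "B z u = 0" for z u w
    using that by (simp add: rs_refl_def B_simps)
  obtain w1 where w1: "w1 \<in> \<Phi>" "0 < B w1 x" "B w1 y \<noteq> 0"
  proof (cases "0 < B w x")
    case True then show ?thesis using that w by blast
  next
    case False
    then have "0 < B (refl x w) x" using flip[OF x] w by simp
    moreover have "B (refl x w) y \<noteq> 0" using fixed[OF xy] w by simp
    ultimately show ?thesis using that refl_root[OF x w(1)] by blast
  qed
  have "\<exists>w2\<in>\<Phi>. 0 < B w2 x \<and> 0 < B w2 y"
  proof (cases "0 < B w1 y")
    case True then show ?thesis using w1 by blast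
  next
    case False
    have "B y x = 0" using xy B_sym by simp
    then have "0 < B (refl y w1) x" using fixed w1 by simp
    moreover have "0 < B (refl y w1) y" using flip[OF y] w1 False by simp
    ultimately show ?thesis using refl_root[OF y w1(1)] by blast
  qed
  then show ?thesis using that by blast
qed

lemma cartan_pos_integer:
  assumes "\<alpha> \<in> \<Phi>" "\<beta> \<in> \<Phi>" "0 < B \<beta> \<alpha>"
  obtains n :: int where "1 \<le> n" "2 * B \<beta> \<alpha> / B \<alpha> \<alpha> = of_int n"
proof -
  obtain n where n: "2 * B \<beta> \<alpha> / B \<alpha> \<alpha> = of_int n"
    using cartan_integer[OF assms(1,2)] B_sym[of \<beta> \<alpha>] by (auto elim: Ints_cases)
  have "0 < real_of_int n" unfolding n[symmetric] using assms B_root by simp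
  then show ?thesis using that[of n] n by simp
qed

lemma not_half_root: "x \<in> \<Phi> \<Longrightarrow> (1/2) *\<^sub>R x \<notin> \<Phi>"
proof
  assume x: "x \<in> \<Phi>" and "(1/2) *\<^sub>R x \<in> \<Phi>"
  then have "(1/2) *\<^sub>R x = 1 *\<^sub>R x \<or> (1/2) *\<^sub>R x = (- 1) *\<^sub>R x" using root_multiple by fastforce
  moreover have "x \<noteq> 0" using B_root[OF x] bilinear_lzero[OF B_bilinear] by force
  ultimately show False by (auto simp only: scaleR_cancel_right)
qed

text \<open>A linking root \<open>w\<close> has coefficients \<open>m / 2\<close> and
  \<open>n / 2\<close>, and pairing it with itself gives \<open>m * a + n * b = 4\<close>. The
  solutions make \<open>w\<close> the half sum or the sum, make half of \<open>x\<close> or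
  \<open>y\<close> a root, or let the reflection in \<open>w\<close> produce the half sum up to
  sign.\<close>

lemma orthogonal_pair:
  assumes x: "x \<in> \<Phi>" and y: "y \<in> \<Phi>" and xy: "B x y = 0"
  shows "x + y \<in> \<Phi> \<or> (\<exists>r\<in>\<Phi>. \<exists>s\<in>\<Phi>. r + s = x \<and> r - s = y)"
proof -
  obtain w where w: "w \<in> \<Phi>" "0 < B w x" "0 < B w y" using linking_root[OF x y xy] .
  note pos = B_root[OF x] B_root[OF y] B_root[OF w(1)]
  obtain m where m: "1 \<le> m" "2 * B w x / B x x = of_int m" using cartan_pos_integer[OF x w(1,2)] .
  obtain n where n: "1 \<le> n" "2 * B w y / B y y = of_int n" using cartan_pos_integer[OF y w(1,3)] .
  have w': "0 < B x w" "0 < B y w" using w B_sym by auto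
  obtain a where a: "1 \<le> a" "2 * B x w / B w w = of_int a" using cartan_pos_integer[OF w(1) x w'(1)] .
  obtain b where b: "1 \<le> b" "2 * B y w / B w w = of_int b" using cartan_pos_integer[OF w(1) y w'(2)] .
  have yx: "y \<notin> span {x}"
  proof
    assume "y \<in> span {x}"
    then have "B y y = 0" using B_span_zero[of "{x}" y y] xy B_sym by simp
    then show False using pos by simp
  qed
  define u where "u = w - (of_int m / 2) *\<^sub>R x - (of_int n / 2) *\<^sub>R y"
  have "B u x = 0" "B u y = 0"
    unfolding u_def m(2)[symmetric] n(2)[symmetric] using pos xy B_sym[of y x] by (simp_all add: B_simps)
  moreover have us: "u \<in> span {x, y}" unfolding u_def
    by (intro span_diff span_scale third_in_span[OF x y w(1) yx]) (auto intro: span_base)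
  ultimately have "B u u = 0" using B_span_zero[of "{x, y}" u u] by simp
  moreover have "u \<in> span \<Phi>" using us span_mono[of "{x, y}" \<Phi>] x y by auto
  ultimately have "u = 0" using B_definite by simp
  then have we: "w = (of_int m / 2) *\<^sub>R x + (of_int n / 2) *\<^sub>R y" by (simp add: u_def algebra_simps)
  have "B w w = (of_int m / 2) * B x w + (of_int n / 2) * B y w"
    by (subst (1) we) (simp add: B_simps)
  then have "real_of_int m * (2 * B x w / B w w) + real_of_int n * (2 * B y w / B w w) = 4"
    using pos by (simp add: field_simps)
  then have "real_of_int (m * a + n * b) = 4" unfolding a b by simp
  then have mn: "m * a + n * b = 4" by linarith
  have rx: "x - of_int a *\<^sub>R w \<in> \<Phi>" and ry: "y - of_int b *\<^sub>R w \<in> \<Phi>"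
    using refl_root[OF w(1) x] refl_root[OF w(1) y] a(2) b(2) B_sym by (simp_all add: rs_refl_def)
  consider "m = 1" "n = 1" | "m = 2" "n = 2" | "m = 1" "n = 2" "b = 1" | "m = 2" "n = 1" "a = 1"
    | "m = 1" "n = 3" "b = 1" | "m = 3" "n = 1" "a = 1"
    using int_product_cases[OF m(1) n(1) a(1) b(1) mn] by blast
  then show ?thesis
  proof cases
    case 1
    then have "w = (1/2) *\<^sub>R (x + y)" using we by (simp add: scaleR_right_distrib)
    then show ?thesis using half_sum[OF x y xy] w by simp
  next
    case 2
    then show ?thesis using we w by simp
  next
    case 3
    then have "(1/2) *\<^sub>R x \<in> \<Phi>" using root_uminus[OF ry] we by simp
    then show ?thesis using not_half_root x by blast
  next
    case 4
    then have "(1/2) *\<^sub>R y \<in> \<Phi>" using root_uminus[OF rx] we by simp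
    then show ?thesis using not_half_root y by blast
  next
    case 5
    have "w - y = (1/2) *\<^sub>R x + (3/2 - 1) *\<^sub>R y" unfolding scaleR_left_diff_distrib using 5 we by simp
    then have "(1/2) *\<^sub>R (x + y) \<in> \<Phi>" using root_uminus[OF ry] 5 by (simp add: scaleR_right_distrib)
    then show ?thesis using half_sum[OF x y xy] by blast
  next
    case 6
    have "w - x = (3/2 - 1) *\<^sub>R x + (1/2) *\<^sub>R y" unfolding scaleR_left_diff_distrib using 6 we by simp
    then have "(1/2) *\<^sub>R (x + y) \<in> \<Phi>" using root_uminus[OF rx] 6 by (simp add: scaleR_right_distrib)
    then show ?thesis using half_sum[OF x y xy] by blast
  qed
qed

lemma root_pair:
  assumes x: "x \<in> \<Phi>" and y: "y \<in> \<Phi>"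
  shows "x = y \<or> x = - y \<or> x - y \<in> \<Phi> \<or> x + y \<in> \<Phi> \<or> (\<exists>r\<in>\<Phi>. \<exists>s\<in>\<Phi>. r + s = x \<and> r - s = y)"
proof -
  consider "0 < B x y" | "0 < B x (- y)" | "B x y = 0" by (auto simp: B_simps) linarith
  then show ?thesis
  proof cases
    case 1 then show ?thesis using root_diff[OF x y] by blast
  next
    case 2 then show ?thesis using root_diff[OF x root_uminus[OF y]] by auto
  next
    case 3 then show ?thesis using orthogonal_pair[OF x y] by blast
  qed
qed

end

section \<open>The affinization as an affine plane\<close>

locale affinization = rank2_roots B \<Phi>0 \<Delta>0 for B :: "'a::real_vector \<Rightarrow> 'a \<Rightarrow> real" and \<Phi>0 \<Delta>0 +
  fixes \<delta> \<theta> :: 'a and I :: "'a set"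
  assumes delta_span: "\<delta> \<notin> span \<Phi>0" and delta_B: "B \<delta> x = 0"
    and highest: "highest_root \<Phi>0 \<Delta>0 \<theta>"
    and ideal: "order_ideal {\<alpha> + of_int k *\<^sub>R \<delta> | \<alpha> k. \<alpha> \<in> \<Phi>0} (\<Delta>0 \<union> {\<delta> - \<theta>}) I"
begin

abbreviation (input) "\<Phi> \<equiv> {\<alpha> + of_int k *\<^sub>R \<delta> | \<alpha> k. \<alpha> \<in> \<Phi>0}"
abbreviation (input) "\<Delta> \<equiv> \<Delta>0 \<union> {\<delta> - \<theta>}"
abbreviation (input) "\<Lambda> \<equiv> {x + of_int k *\<^sub>R \<delta> | x k. x \<in> span \<Phi>0}"

lemma theta: "\<theta> \<in> \<Phi>0" "\<theta> \<in> pos_span \<Delta>0"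
  using highest by (auto simp: highest_root_def pos_roots_def)

lemma theta_minus:
  assumes "\<alpha> \<in> \<Phi>0" shows "\<theta> - \<alpha> \<in> pos_span \<Delta>0"
proof (cases "\<alpha> \<in> pos_span \<Delta>0")
  case True
  then show ?thesis using highest assms by (auto simp: highest_root_def pos_roots_def)
next
  case False
  then show ?thesis using root_sign[OF assms] pos_span_add[OF theta(2), of "- \<alpha>"] by simp
qed

lemma delta_minus:
  assumes "\<alpha> \<in> \<Phi>0" shows "\<delta> - \<alpha> \<in> pos_span \<Delta>"
proof -
  have "\<delta> - \<theta> \<in> pos_span \<Delta>" by (rule pos_span_base) simp
  moreover have "\<theta> - \<alpha> \<in> pos_span \<Delta>" using theta_minus[OF assms] pos_span_mono[of \<Delta>0 \<Delta>] by auto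
  ultimately have "(\<delta> - \<theta>) + (\<theta> - \<alpha>) \<in> pos_span \<Delta>" by (rule pos_span_add)
  then show ?thesis by simp
qed

lemma delta_pos: "\<delta> \<in> pos_span \<Delta>"
  using pos_span_add[OF delta_minus[OF theta(1)], of \<theta>] theta(2) pos_span_mono[of \<Delta>0 \<Delta>] by auto

lemma base_span_eq: "span \<Delta>0 \<subseteq> span \<Phi>0"
  using base(1) span_mono by blast

lemma span_coeff:
  assumes "x + a *\<^sub>R \<delta> = y + b *\<^sub>R \<delta>" "x \<in> span \<Phi>0" "y \<in> span \<Phi>0" shows "a = b" "x = y"
proof -
  have e: "(b - a) *\<^sub>R \<delta> = x - y" using assms(1) by (simp add: algebra_simps)
  have "x - y \<in> span \<Phi>0" using assms span_diff by blast
  show "a = b"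
  proof (rule ccontr)
    assume "a \<noteq> b"
    then have "\<delta> = (1 / (b - a)) *\<^sub>R (x - y)" unfolding e[symmetric] by simp
    then show False using delta_span span_scale \<open>x - y \<in> span \<Phi>0\<close> by metis
  qed
  then show "x = y" using assms by simp
qed

text \<open>Only the affine simple root involves \<delta>, so its coefficient \<open>c\<close> is
  also the coefficient of \<delta>; hence the latter is nonnegative on the positive cone.\<close>

lemma pos_span_cases:
  assumes "x \<in> pos_span \<Delta>"
  obtains u c where "0 \<le> c" "u \<in> pos_span \<Delta>0" "x = (u - c *\<^sub>R \<theta>) + c *\<^sub>R \<delta>" "u - c *\<^sub>R \<theta> \<in> span \<Phi>0"
proof -
  obtain c r where c: "0 \<le> c" "r \<in> pos_span (\<Delta> - {\<delta> - \<theta>})" "x = c *\<^sub>R (\<delta> - \<theta>) + r"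
    using pos_span_split[OF assms] by blast
  have r: "r \<in> pos_span \<Delta>0" using c(2) pos_span_mono[of "\<Delta> - {\<delta> - \<theta>}" \<Delta>0] by auto
  then have "r \<in> span \<Phi>0" using pos_span_subset_span base_span_eq by blast
  then have "r - c *\<^sub>R \<theta> \<in> span \<Phi>0" using theta(1) by (intro span_diff span_scale) (auto intro: span_base)
  then show ?thesis using that[OF c(1) r] c(3) by (simp add: algebra_simps)
qed

lemma pos_neg:
  assumes "x \<in> pos_span \<Delta>" "- x \<in> pos_span \<Delta>" shows "x \<in> pos_span \<Delta>0" "- x \<in> pos_span \<Delta>0"
proof -
  obtain u c where u: "0 \<le> c" "u \<in> pos_span \<Delta>0" "x = (u - c *\<^sub>R \<theta>) + c *\<^sub>R \<delta>" "u - c *\<^sub>R \<theta> \<in> span \<Phi>0"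
    using pos_span_cases[OF assms(1)] .
  obtain v d where v: "0 \<le> d" "v \<in> pos_span \<Delta>0" "- x = (v - d *\<^sub>R \<theta>) + d *\<^sub>R \<delta>" "v - d *\<^sub>R \<theta> \<in> span \<Phi>0"
    using pos_span_cases[OF assms(2)] .
  have "- (v - d *\<^sub>R \<theta>) + (- d) *\<^sub>R \<delta> = x" using v(3) by (metis add.inverse_inverse minus_add_distrib scaleR_minus_left)
  then have "c = - d" using span_coeff(1)[of "u - c *\<^sub>R \<theta>" c "- (v - d *\<^sub>R \<theta>)" "- d"] u(3,4) span_neg[OF v(4)] by simp
  then have "c = 0" "d = 0" using u v by auto
  then show "x \<in> pos_span \<Delta>0" "- x \<in> pos_span \<Delta>0" using u v by auto
qed

lemma finite_root_affine: "\<alpha> \<in> \<Phi>0 \<Longrightarrow> \<alpha> \<in> pos_span \<Delta>0 \<Longrightarrow> \<alpha> \<in> pos_span \<Delta>"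
  using pos_span_mono[of \<Delta>0 \<Delta>] by auto

lemma affine_root_sign:
  assumes \<alpha>: "\<alpha> \<in> \<Phi>0"
  shows "(\<alpha> + of_int k *\<^sub>R \<delta> \<in> pos_span \<Delta>) \<noteq> (- (\<alpha> + of_int k *\<^sub>R \<delta>) \<in> pos_span \<Delta>)"
proof -
  \<comment> \<open>One \<delta> outweighs any finite root: \<open>delta_minus\<close> is applied to
    \<open>- \<beta>\<close>.\<close>
  have up: "\<beta> + of_int l *\<^sub>R \<delta> \<in> pos_span \<Delta>" if "\<beta> \<in> \<Phi>0" "1 \<le> l" for \<beta> l
  proof -
    have "(\<delta> - (- \<beta>)) + of_int (l - 1) *\<^sub>R \<delta> \<in> pos_span \<Delta>"
      using that delta_minus[OF root_uminus[OF that(1)]] delta_pos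
      by (intro pos_span_add pos_span_scale) auto
    then show ?thesis by (simp add: algebra_simps)
  qed
  have "\<alpha> + of_int k *\<^sub>R \<delta> \<in> pos_span \<Delta> \<or> - (\<alpha> + of_int k *\<^sub>R \<delta>) \<in> pos_span \<Delta>"
  proof -
    consider "1 \<le> k" | "k = 0" | "1 \<le> - k" by linarith
    then show ?thesis
    proof cases
      case 1 then show ?thesis using up \<alpha> by blast
    next
      case 2
      then show ?thesis using root_sign[OF \<alpha>] finite_root_affine[OF \<alpha>] finite_root_affine[OF root_uminus[OF \<alpha>]] by auto
    next
      case 3
      then show ?thesis using up[OF root_uminus[OF \<alpha>] 3] by simp
    qed
  qed
  moreover have False if h: "\<alpha> + of_int k *\<^sub>R \<delta> \<in> pos_span \<Delta>" "- (\<alpha> + of_int k *\<^sub>R \<delta>) \<in> pos_span \<Delta>"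
  proof -
    have p: "\<alpha> + of_int k *\<^sub>R \<delta> \<in> pos_span \<Delta>0" "- (\<alpha> + of_int k *\<^sub>R \<delta>) \<in> pos_span \<Delta>0" using pos_neg[OF h] .
    then have "\<alpha> + of_int k *\<^sub>R \<delta> \<in> span \<Phi>0" using pos_span_subset_span base_span_eq by blast
    then have "real_of_int k = 0"
      using span_coeff(1)[of \<alpha> "of_int k" "\<alpha> + of_int k *\<^sub>R \<delta>" 0] \<alpha> span_base by force
    then show False using p root_sign[OF \<alpha>] by simp
  qed
  ultimately show ?thesis by blast
qed

lemma B_shift: "B (x + a *\<^sub>R \<delta>) (y + b *\<^sub>R \<delta>) = B x y"
  using delta_B B_sym[of _ \<delta>] by (simp add: B_simps)

lemma shift_diff: "(\<alpha> + of_int k *\<^sub>R \<delta>) - (\<beta> + of_int l *\<^sub>R \<delta>) = (\<alpha> - \<beta>) + of_int (k - l) *\<^sub>R \<delta>"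
  "(\<alpha> + of_int k *\<^sub>R \<delta>) + (\<beta> + of_int l *\<^sub>R \<delta>) = (\<alpha> + \<beta>) + of_int (k + l) *\<^sub>R \<delta>"
  by (simp_all add: algebra_simps)

sublocale affine: affine_plane \<Phi> "pos_span \<Delta>" I \<delta> B \<Lambda>
proof
  show "- \<delta> \<notin> pos_span \<Delta>"
  proof
    assume "- \<delta> \<in> pos_span \<Delta>"
    then have "\<delta> \<in> pos_span \<Delta>0" using pos_neg[OF delta_pos] by blast
    then show False using delta_span pos_span_subset_span base_span_eq by blast
  qed
  show "\<exists>k::int. r + of_int k *\<^sub>R \<delta> \<in> pos_span \<Delta> \<and> \<delta> - (r + of_int k *\<^sub>R \<delta>) \<in> pos_span \<Delta>" if "r \<in> \<Phi>" for r
  proof -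
    obtain \<alpha> k where r: "r = \<alpha> + of_int k *\<^sub>R \<delta>" "\<alpha> \<in> \<Phi>0" using \<open>r \<in> \<Phi>\<close> by blast
    show ?thesis
    proof (cases "\<alpha> \<in> pos_span \<Delta>0")
      case True
      have "r + of_int (- k) *\<^sub>R \<delta> = \<alpha>" using r by simp
      then show ?thesis using delta_minus[OF r(2)] finite_root_affine[OF r(2) True] by metis
    next
      case False
      then have "- \<alpha> \<in> pos_span \<Delta>" using root_sign[OF r(2)] finite_root_affine[OF root_uminus[OF r(2)]] by blast
      moreover have "r + of_int (1 - k) *\<^sub>R \<delta> = \<delta> - (- \<alpha>)" using r by (simp add: algebra_simps)
      moreover have "\<delta> - (\<delta> - (- \<alpha>)) = - \<alpha>" by simp
      ultimately show ?thesis using delta_minus[OF root_uminus[OF r(2)]] by metis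
    qed
  qed
  show "\<exists>k::int. x = of_int k *\<^sub>R \<delta>" if "x \<in> \<Lambda>" "B x x \<le> 0" for x
  proof -
    obtain u k where u: "x = u + of_int k *\<^sub>R \<delta>" "u \<in> span \<Phi>0" using \<open>x \<in> \<Lambda>\<close> by blast
    then have "B u u \<le> 0" using \<open>B x x \<le> 0\<close> B_shift by metis
    then have "u = 0" using B_definite u by blast
    then show ?thesis using u by auto
  qed
  show "r - s \<in> \<Phi> \<or> (\<exists>k::int. r - s = of_int k *\<^sub>R \<delta>)" if rs: "r \<in> \<Phi>" "s \<in> \<Phi>" "0 < B r s" for r s
  proof -
    obtain \<alpha> k where r: "r = \<alpha> + of_int k *\<^sub>R \<delta>" "\<alpha> \<in> \<Phi>0" using rs(1) by blast
    obtain \<beta> l where s: "s = \<beta> + of_int l *\<^sub>R \<delta>" "\<beta> \<in> \<Phi>0" using rs(2) by blast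
    have "0 < B \<alpha> \<beta>" using rs(3) r s B_shift by metis
    then have "\<alpha> = \<beta> \<or> \<alpha> - \<beta> \<in> \<Phi>0" using root_diff r s by blast
    then show ?thesis
    proof
      assume "\<alpha> = \<beta>"
      then have "r - s = of_int (k - l) *\<^sub>R \<delta>" unfolding r s shift_diff by simp
      then show ?thesis by blast
    next
      assume "\<alpha> - \<beta> \<in> \<Phi>0"
      then show ?thesis unfolding r s shift_diff by blast
    qed
  qed
  show "\<exists>k::int. p - p' = of_int k *\<^sub>R \<delta> \<or> p + p' = of_int k *\<^sub>R \<delta>"
    if pq: "p \<in> \<Phi>" "p' \<in> \<Phi>" "q \<in> \<Phi>" "B p q = 0" "B p' q = 0" for p p' q
  proof -
    obtain \<alpha> k where p: "p = \<alpha> + of_int k *\<^sub>R \<delta>" "\<alpha> \<in> \<Phi>0" using pq(1) by blast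
    obtain \<beta> l where p': "p' = \<beta> + of_int l *\<^sub>R \<delta>" "\<beta> \<in> \<Phi>0" using pq(2) by blast
    obtain \<gamma> j where q: "q = \<gamma> + of_int j *\<^sub>R \<delta>" "\<gamma> \<in> \<Phi>0" using pq(3) by blast
    have "B \<alpha> \<gamma> = 0" "B \<beta> \<gamma> = 0" using pq(4,5) p p' q B_shift by metis+
    then have "\<alpha> = \<beta> \<or> \<alpha> = - \<beta>" using root_perp p p' q by blast
    then have "p - p' = of_int (k - l) *\<^sub>R \<delta> \<or> p + p' = of_int (k + l) *\<^sub>R \<delta>"
      unfolding p p' shift_diff by auto
    then show ?thesis by blast
  qed
  show "(\<exists>k::int. x - y = of_int k *\<^sub>R \<delta> \<or> x + y = of_int k *\<^sub>R \<delta>) \<or> x - y \<in> \<Phi> \<or> x + y \<in> \<Phi> \<or>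
      (\<exists>r\<in>\<Phi>. \<exists>s\<in>\<Phi>. \<exists>a c::int. r + s = x + of_int a *\<^sub>R \<delta> \<and> r - s = y + of_int c *\<^sub>R \<delta>)"
    if xy: "x \<in> \<Phi>" "y \<in> \<Phi>" for x y
  proof -
    obtain \<alpha> k where x: "x = \<alpha> + of_int k *\<^sub>R \<delta>" "\<alpha> \<in> \<Phi>0" using xy(1) by blast
    obtain \<beta> l where y: "y = \<beta> + of_int l *\<^sub>R \<delta>" "\<beta> \<in> \<Phi>0" using xy(2) by blast
    consider "\<alpha> = \<beta>" | "\<alpha> = - \<beta>" | "\<alpha> - \<beta> \<in> \<Phi>0" | "\<alpha> + \<beta> \<in> \<Phi>0"
      | r s where "r \<in> \<Phi>0" "s \<in> \<Phi>0" "r + s = \<alpha>" "r - s = \<beta>"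
      using root_pair[OF x(2) y(2)] by blast
    then show ?thesis
    proof cases
      case 1
      then have "x - y = of_int (k - l) *\<^sub>R \<delta>" unfolding x y shift_diff by simp
      then show ?thesis by blast
    next
      case 2
      then have "x + y = of_int (k + l) *\<^sub>R \<delta>" unfolding x y shift_diff by simp
      then show ?thesis by blast
    next
      case 3
      then have "x - y \<in> \<Phi>" unfolding x y shift_diff by blast
      then show ?thesis by blast
    next
      case 4
      then have "x + y \<in> \<Phi>" unfolding x y shift_diff by blast
      then show ?thesis by blast
    next
      case (5 r s)
      have "r + of_int 0 *\<^sub>R \<delta> \<in> \<Phi>" "s + of_int 0 *\<^sub>R \<delta> \<in> \<Phi>" using 5(1,2) by blast+
      then have R: "r \<in> \<Phi>" "s \<in> \<Phi>" by simp_all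
      have e: "r + s = x + of_int (- k) *\<^sub>R \<delta>" "r - s = y + of_int (- l) *\<^sub>R \<delta>" using x y 5(3,4) by simp_all
      show ?thesis using R e by blast
    qed
  qed
  show "(r \<in> pos_span \<Delta>) \<noteq> (- r \<in> pos_span \<Delta>)" if "r \<in> \<Phi>" for r
    using affine_root_sign \<open>r \<in> \<Phi>\<close> by blast
  show "- r \<in> \<Phi>" if "r \<in> \<Phi>" for r
  proof -
    obtain \<alpha> k where r: "r = \<alpha> + of_int k *\<^sub>R \<delta>" "\<alpha> \<in> \<Phi>0" using \<open>r \<in> \<Phi>\<close> by blast
    then have "- r = - \<alpha> + of_int (- k) *\<^sub>R \<delta>" "- \<alpha> \<in> \<Phi>0" using root_uminus by auto
    then show ?thesis by blast
  qed
  show "r + of_int k *\<^sub>R \<delta> \<in> \<Phi>" if "r \<in> \<Phi>" for r and k :: int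
  proof -
    obtain \<alpha> l where r: "r = \<alpha> + of_int l *\<^sub>R \<delta>" "\<alpha> \<in> \<Phi>0" using \<open>r \<in> \<Phi>\<close> by blast
    then have "r + of_int k *\<^sub>R \<delta> = \<alpha> + of_int (l + k) *\<^sub>R \<delta>" by (simp add: algebra_simps)
    then show ?thesis using r by blast
  qed
  show "0 < B r r" if "r \<in> \<Phi>" for r
  proof -
    obtain \<alpha> l where r: "r = \<alpha> + of_int l *\<^sub>R \<delta>" "\<alpha> \<in> \<Phi>0" using \<open>r \<in> \<Phi>\<close> by blast
    then show ?thesis using B_root[OF r(2)] B_shift by simp
  qed
  show "I \<subseteq> \<Phi> \<inter> pos_span \<Delta>" using ideal by (simp add: order_ideal_def pos_roots_def)
  show "s \<in> I" if "r \<in> I" "s \<in> \<Phi>" "s \<in> pos_span \<Delta>" "r - s \<in> pos_span \<Delta>" for r s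
    using ideal that unfolding order_ideal_def pos_roots_def by blast
  show "\<Phi> \<subseteq> \<Lambda>" using span_base by blast
  show "x + y \<in> \<Lambda>" if xy: "x \<in> \<Lambda>" "y \<in> \<Lambda>" for x y
  proof -
    obtain u k v l where "x = u + of_int k *\<^sub>R \<delta>" "u \<in> span \<Phi>0" "y = v + of_int l *\<^sub>R \<delta>" "v \<in> span \<Phi>0"
      using xy by blast
    then have "x + y = (u + v) + of_int (k + l) *\<^sub>R \<delta>" "u + v \<in> span \<Phi>0" using span_add by (auto simp: algebra_simps)
    then show ?thesis by blast
  qed
  show "of_int k *\<^sub>R \<delta> \<in> \<Lambda>" for k :: int
  proof -
    have "of_int k *\<^sub>R \<delta> = 0 + of_int k *\<^sub>R \<delta>" by simp
    then show ?thesis using span_zero by blast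
  qed
qed (use pos_span_add pos_span_scale delta_pos B_bilinear B_sym delta_B in auto)

text \<open>With \<delta> in place of the affine simple root, integral coordinates of the roots are
  read off from their definition.\<close>

lemma affine_independent: "independent (insert \<delta> \<Delta>0)"
  using base_independent delta_span base_span_eq by (intro independent_insertI) auto

lemma affine_int_span: "\<Phi> \<subseteq> int_span (insert \<delta> \<Delta>0)"
proof
  fix x assume "x \<in> \<Phi>"
  then obtain \<alpha> and k :: int where x: "x = \<alpha> + of_int k *\<^sub>R \<delta>" "\<alpha> \<in> \<Phi>0" by blast
  show "x \<in> int_span (insert \<delta> \<Delta>0)"
    unfolding x(1) by (rule int_span_add[OF _ int_span_multiple])
      (use x(2) base(3) int_span_mono[of \<Delta>0 "insert \<delta> \<Delta>0"] in auto)
qed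

theorem affine_ideal_clean: "clean I"
  unfolding clean_def
proof (intro allI impI)
  fix S assume S: "S \<subseteq> I" and bc: "rs_biclosed I S"
  then have b: "affine.closed_split S (I - S)"
    by (auto simp: affine.closed_split_def rs_biclosed_def rs_coclosed_def)
  show "weakly_separable I S"
  proof (rule weakly_separable_from_multisets[OF affine_independent _ S])
    show "I \<subseteq> int_span (insert \<delta> \<Delta>0)" using affine.I_roots affine_int_span by blast
  qed (use affine.no_relation[OF b] in blast)
qed

end

theorem theoremB:
  fixes B :: "'a::real_vector \<Rightarrow> 'a \<Rightarrow> real" and \<Phi> \<Delta> I :: "'a set"
  assumes "finite_root_system B \<Phi> \<Delta> \<or> rank3_untwisted_affine B \<Phi> \<Delta>"
    and "order_ideal \<Phi> \<Delta> I"
  shows "clean I"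
  using assms(1)
proof
  assume "finite_root_system B \<Phi> \<Delta>"
  then interpret finite_roots B \<Phi> \<Delta> by unfold_locales (auto simp: finite_root_system_def)
  show ?thesis using finite_ideal_clean assms(2) .
next
  assume "rank3_untwisted_affine B \<Phi> \<Delta>"
  then obtain \<Phi>0 \<Delta>0 \<delta> \<theta> where *: "finite_root_system B \<Phi>0 \<Delta>0" "irreducible_rs B \<Phi>0" "card \<Delta>0 = 2"
    "\<delta> \<notin> span \<Phi>0" "\<forall>x. B \<delta> x = 0" "highest_root \<Phi>0 \<Delta>0 \<theta>"
    "\<Phi> = {\<alpha> + of_int k *\<^sub>R \<delta> | \<alpha> k. \<alpha> \<in> \<Phi>0}" "\<Delta> = \<Delta>0 \<union> {\<delta> - \<theta>}"
    unfolding rank3_untwisted_affine_def by blast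
  interpret affinization B \<Phi>0 \<Delta>0 \<delta> \<theta> I
    by unfold_locales (use * assms(2) in \<open>auto simp: finite_root_system_def\<close>)
  show ?thesis by (rule affine_ideal_clean)
qed

end
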